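(* Let $\Omega\subset\mathbb{R}^d$ be open. Let $F:S(d)\to\mathbb{R}$ be degenerate elliptic and Lipschitz continuous, in the sense that there is a constant $C_F>0$ with $$F(M)-F(N)\le C_F\,|(N-M)_+|\qquad\text{for all }M,N\in S(d),$$ and positively homogeneous of degree $1$, i.e. $F(sM)=sF(M)$ for all $M\in S(d)$, $s\ge 0$. Let $f\in L^\infty(\Omega)$ be Lipschitz continuous. Suppose $H=H(p,x):\mathbb{R}^d\times\Omega\to\mathbb{R}$ is such that there are constants $m>1$ and $C_1,C_2,C_3>0$ with $$-C_1+C_2|p|^m\le H(p,x)\le C_3(1+|p|^m)\quad\text{for all }p\in\mathbb{R}^d,\ x\in\Omega,$$ $$|H(p,x)-H(p,y)|\le (C_3|p|^m+C_1)|x-y|\quad\text{for all }p\in\mathbb{R}^d,\ x,y\in\Omega,$$ $$|H(p,x)-H(q,x)|\le C_3(|p|+|q|+1)^{m-1}|p-q|\quad\text{for all }p,q\in\mathbb{R}^d,\ x\in\Omega.$$ Let $u\in C(\Omega)$ be a viscosity solution to $$F(D^2u)+H(Du,x)=f(x)\quad\text{in }\Omega.$$ Then $u$ is locally Lipschitz continuous in $\Omega$. Moreover, for every $\Omega'\Subset\Omega$ there exists $C>0$ such that $$|u(x)-u(y)|\le C\left(1+\|u\|_{L^\infty(\Omega)}+\|f\|_{L^\infty(\Omega)}\right)|x-y|\qquad\text{for every }x,y\in\Omega',$$ where $C$ depends only on $\Omega'$ and the data of the problem.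
   Context: $S(d)$ is the space of real symmetric $d\times d$ matrices, with partial order $M\ge N$ iff $M-N$ is positive semi-definite; $M=M_+-M_-$ denotes the decomposition of $M\in S(d)$ into its positive and negative parts (positive semi-definite, $M_+M_-=0$), and $|M|$ is the norm of $M$ (spectral norm). Degenerate elliptic means $F(M)\le F(N)$ whenever $M\ge N$; the displayed one-sided condition on $F$ is equivalent to being degenerate elliptic and Lipschitz continuous with constant $C_F$. Viscosity solution: $u\in\mathrm{USC}(\Omega)$ (upper semicontinuous) is a viscosity sub-solution if for every $x_0\in\Omega$ and $\varphi\in C^2(\Omega)$ such that $u-\varphi$ has a local maximum at $x_0$, $F(D^2\varphi(x_0))+H(D\varphi(x_0),x_0)\le f(x_0)$; $u\in\mathrm{LSC}(\Omega)$ is a viscosity supersolution if for every $x_0\in\Omega$ and $\varphi\in C^2(\Omega)$ such that $u-\varphi$ has a local minimum at $x_0$, $F(D^2\varphi(x_0))+H(D\varphi(x_0),x_0)\ge f(x_0)$; $u\in C(\Omega)$ is a viscosity solution if it is both. "Data of the problem" means $d$, $\Omega$, $C_F$, $m$, $C_1,C_2,C_3$ and the Lipschitz constant of $f$. $\Omega'\Subset\Omega$ means that $\overline{\Omega'}$ is a compact subset of $\Omega$. *)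

theory Defs
  imports "HOL-Analysis.Analysis" "HOL-Probability.Essential_Supremum"
begin

definition symmetric_mat :: "real ^ 'n ^ 'n \<Rightarrow> bool" where
  "symmetric_mat M \<longleftrightarrow> transpose M = M"

definition psd :: "real ^ 'n ^ 'n \<Rightarrow> bool" where
  "psd M \<longleftrightarrow> symmetric_mat M \<and> (\<forall>x. 0 \<le> x \<bullet> (M *v x))"

(* The pair (P, Q) is unique and exists for every symmetric M, by the spectral theorem;
   for non-symmetric M the value of pos_part is unspecified and never used. *)
definition pos_part :: "real ^ 'n ^ 'n \<Rightarrow> real ^ 'n ^ 'n" where
  "pos_part M = (THE P. \<exists>Q. psd P \<and> psd Q \<and> M = P - Q \<and> P ** Q = 0)"

definition spectral_norm :: "real ^ 'n ^ 'n \<Rightarrow> real" where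
  "spectral_norm M = onorm ((*v) M)"

(* Only the values of F at symmetric matrices matter. The inequality encodes both degenerate
   ellipticity (F M \<le> F N if M - N is positive semi-definite, as then pos_part (N - M) = 0)
   and Lipschitz continuity with constant CF. *)
definition degenerate_elliptic_lipschitz :: "real \<Rightarrow> (real ^ 'n ^ 'n \<Rightarrow> real) \<Rightarrow> bool" where
  "degenerate_elliptic_lipschitz CF F \<longleftrightarrow>
     (\<forall>M N. symmetric_mat M \<longrightarrow> symmetric_mat N \<longrightarrow>
        F M - F N \<le> CF * spectral_norm (pos_part (N - M)))"

definition positively_homogeneous :: "(real ^ 'n ^ 'n \<Rightarrow> real) \<Rightarrow> bool" where
  "positively_homogeneous F \<longleftrightarrow>
     (\<forall>M s. symmetric_mat M \<longrightarrow> 0 \<le> s \<longrightarrow> F (s *\<^sub>R M) = s * F M)"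

definition hamiltonian_conditions ::
    "(real ^ 'n) set \<Rightarrow> real \<Rightarrow> real \<Rightarrow> real \<Rightarrow> real \<Rightarrow> (real ^ 'n \<Rightarrow> real ^ 'n \<Rightarrow> real) \<Rightarrow> bool" where
  "hamiltonian_conditions \<Omega> m C1 C2 C3 H \<longleftrightarrow>
     (\<forall>p. \<forall>x\<in>\<Omega>. - C1 + C2 * norm p powr m \<le> H p x \<and> H p x \<le> C3 * (1 + norm p powr m)) \<and>
     (\<forall>p. \<forall>x\<in>\<Omega>. \<forall>y\<in>\<Omega>. \<bar>H p x - H p y\<bar> \<le> (C3 * norm p powr m + C1) * norm (x - y)) \<and>
     (\<forall>p q. \<forall>x\<in>\<Omega>. \<bar>H p x - H q x\<bar> \<le> C3 * (norm p + norm q + 1) powr (m - 1) * norm (p - q))"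

(* Extended-valued: Linf_norm \<Omega> g = \<infinity> if g is not essentially bounded on \<Omega>. *)
definition Linf_norm :: "'a::euclidean_space set \<Rightarrow> ('a \<Rightarrow> real) \<Rightarrow> ennreal" where
  "Linf_norm \<Omega> g = esssup (lebesgue_on \<Omega>) (\<lambda>x. ennreal \<bar>g x\<bar>)"

definition in_Linf :: "'a::euclidean_space set \<Rightarrow> ('a \<Rightarrow> real) \<Rightarrow> bool" where
  "in_Linf \<Omega> g \<longleftrightarrow> g \<in> borel_measurable (lebesgue_on \<Omega>) \<and> Linf_norm \<Omega> g < \<infinity>"

definition gradient :: "(real ^ 'n \<Rightarrow> real) \<Rightarrow> real ^ 'n \<Rightarrow> real ^ 'n" where
  "gradient \<phi> x = (\<chi> i. frechet_derivative \<phi> (at x) (axis i 1))"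

definition hessian :: "(real ^ 'n \<Rightarrow> real) \<Rightarrow> real ^ 'n \<Rightarrow> real ^ 'n ^ 'n" where
  "hessian \<phi> x = matrix (frechet_derivative (gradient \<phi>) (at x))"

(* For open sets \<Omega>; continuity of \<phi> and of its gradient follows from differentiability. *)
definition C2_on :: "(real ^ 'n) set \<Rightarrow> (real ^ 'n \<Rightarrow> real) \<Rightarrow> bool" where
  "C2_on \<Omega> \<phi> \<longleftrightarrow>
     (\<forall>x\<in>\<Omega>. \<phi> differentiable (at x)) \<and>
     (\<forall>x\<in>\<Omega>. gradient \<phi> differentiable (at x)) \<and>
     continuous_on \<Omega> (hessian \<phi>)"

definition usc_on :: "'a::topological_space set \<Rightarrow> ('a \<Rightarrow> real) \<Rightarrow> bool" where
  "usc_on \<Omega> u \<longleftrightarrow> (\<forall>x\<in>\<Omega>. \<forall>a. u x < a \<longrightarrow> (\<forall>\<^sub>F y in at x within \<Omega>. u y < a))"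

definition lsc_on :: "'a::topological_space set \<Rightarrow> ('a \<Rightarrow> real) \<Rightarrow> bool" where
  "lsc_on \<Omega> u \<longleftrightarrow> (\<forall>x\<in>\<Omega>. \<forall>a. a < u x \<longrightarrow> (\<forall>\<^sub>F y in at x within \<Omega>. a < u y))"

definition local_max_at :: "'a::topological_space set \<Rightarrow> ('a \<Rightarrow> real) \<Rightarrow> 'a \<Rightarrow> bool" where
  "local_max_at \<Omega> g x \<longleftrightarrow> (\<forall>\<^sub>F y in at x within \<Omega>. g y \<le> g x)"

definition local_min_at :: "'a::topological_space set \<Rightarrow> ('a \<Rightarrow> real) \<Rightarrow> 'a \<Rightarrow> bool" where
  "local_min_at \<Omega> g x \<longleftrightarrow> (\<forall>\<^sub>F y in at x within \<Omega>. g x \<le> g y)"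

definition viscosity_subsolution ::
    "(real ^ 'n) set \<Rightarrow> (real ^ 'n ^ 'n \<Rightarrow> real) \<Rightarrow> (real ^ 'n \<Rightarrow> real ^ 'n \<Rightarrow> real) \<Rightarrow>
     (real ^ 'n \<Rightarrow> real) \<Rightarrow> (real ^ 'n \<Rightarrow> real) \<Rightarrow> bool" where
  "viscosity_subsolution \<Omega> F H f u \<longleftrightarrow> usc_on \<Omega> u \<and>
     (\<forall>x0\<in>\<Omega>. \<forall>\<phi>. C2_on \<Omega> \<phi> \<and> local_max_at \<Omega> (\<lambda>x. u x - \<phi> x) x0 \<longrightarrow>
        F (hessian \<phi> x0) + H (gradient \<phi> x0) x0 \<le> f x0)"

definition viscosity_supersolution ::
    "(real ^ 'n) set \<Rightarrow> (real ^ 'n ^ 'n \<Rightarrow> real) \<Rightarrow> (real ^ 'n \<Rightarrow> real ^ 'n \<Rightarrow> real) \<Rightarrow>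
     (real ^ 'n \<Rightarrow> real) \<Rightarrow> (real ^ 'n \<Rightarrow> real) \<Rightarrow> bool" where
  "viscosity_supersolution \<Omega> F H f u \<longleftrightarrow> lsc_on \<Omega> u \<and>
     (\<forall>x0\<in>\<Omega>. \<forall>\<phi>. C2_on \<Omega> \<phi> \<and> local_min_at \<Omega> (\<lambda>x. u x - \<phi> x) x0 \<longrightarrow>
        F (hessian \<phi> x0) + H (gradient \<phi> x0) x0 \<ge> f x0)"

definition viscosity_solution ::
    "(real ^ 'n) set \<Rightarrow> (real ^ 'n ^ 'n \<Rightarrow> real) \<Rightarrow> (real ^ 'n \<Rightarrow> real ^ 'n \<Rightarrow> real) \<Rightarrow>
     (real ^ 'n \<Rightarrow> real) \<Rightarrow> (real ^ 'n \<Rightarrow> real) \<Rightarrow> bool" where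
  "viscosity_solution \<Omega> F H f u \<longleftrightarrow> continuous_on \<Omega> u \<and>
     viscosity_subsolution \<Omega> F H f u \<and> viscosity_supersolution \<Omega> F H f u"

definition locally_lipschitz_on :: "'a::metric_space set \<Rightarrow> ('a \<Rightarrow> real) \<Rightarrow> bool" where
  "locally_lipschitz_on \<Omega> u \<longleftrightarrow> (\<forall>x\<in>\<Omega>. \<exists>r>0. \<exists>K. K-lipschitz_on (cball x r \<inter> \<Omega>) u)"

definition compactly_contained :: "'a::topological_space set \<Rightarrow> 'a set \<Rightarrow> bool" where
  "compactly_contained \<Omega>' \<Omega> \<longleftrightarrow> compact (closure \<Omega>') \<and> closure \<Omega>' \<subseteq> \<Omega>"

end

theory Submission
  imports Defs
begin

text \<open>
  Suppose that \<open>u(x) - u(y) > K 2\<^sup>k |x - y|\<close> for some \<open>y\<close>, where \<open>x\<close> is the centre of a ball. Then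
  \<open>u(x) - u(y) - K \<zeta>(x) |x - y|\<close>, with a weight \<open>\<zeta>\<close> that is huge near the boundary of the ball, has a
  positive interior maximum. At the maximum, Ishii's lemma yields second order expansions of \<open>u\<close>
  with matrices \<open>X\<close>, \<open>Y\<close>. Testing the matrix inequality with the vectors \<open>(s \<eta>, \<eta>)\<close>, \<open>s = 1 + \<tau>\<close>,
  and using that \<open>F\<close> is homogeneous and elliptic gives \<open>F(Y) \<le> s\<^sup>2 F(X) + error\<close>. Subtracting
  the two equations leaves \<open>(s\<^sup>2 - 1) H(p, x)\<close>, which is coercive of order \<open>\<tau> |p|\<^sup>m\<close>, on the good side;
  with \<open>\<tau>\<close> a large multiple of \<open>|x - y|\<close>, all errors are smaller once \<open>K\<close> is large.

  Ishii's lemma is obtained by replacing \<open>u\<close> by a Lasry--Lions type envelope of class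
  \<open>C\<^sup>1\<^sup>,\<^sup>1\<close>. Small linear perturbations of the maximised function have maximum points that are mapped by
  the gradient onto a ball, hence do not form a null set, and by Rademacher's theorem some of them
  are points of twice differentiability.
\<close>

section \<open>Rademacher's theorem\<close>

text \<open>\<open>F\<close> may be degenerate, so its second order terms give no help: with test
  vectors (\<open>\<eta>\<close>, \<open>\<eta>\<close>) nothing would beat
  \<open>H(p, x) - H(p, y)\<close>, which is of order \<open>|p|^m |x - y|\<close>. Unequal vectors
  produce a competing term from homogeneity. Let \<open>P\<close> be the size of the gradient,
  \<open>\<rho> = |x - y|\<close> and \<open>\<beta>\<close> a bound for the logarithmic derivative
  of the weight. The gain is \<open>\<tau> P^m\<close>, the loss in the matrix inequality is about
  \<open>P \<tau>^2 / \<rho>\<close>. For \<open>\<tau>\<close> proportional to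
  \<open>\<beta> \<rho>\<close> the loss is \<open>\<beta> P \<tau>\<close>, of lower order in
  \<open>P\<close> because \<open>m > 1\<close>. The dependence of \<open>H\<close> on
  \<open>x\<close> and the slope of the weight cost \<open>P^m \<beta> \<rho>\<close>, which has the
  order of the gain and is absorbed by the factor in \<open>\<tau>\<close>; the rest is absorbed by
  large \<open>P\<close>. As \<open>\<beta>\<close> grows like \<open>1/D\<close> near the boundary
  of the ball, the weight is \<open>1/D^k\<close> with \<open>k (m - 1) \<ge> 1\<close>, so that
  \<open>P^(m-1)\<close> dominates \<open>\<beta>\<close>. \<open>K\<close> proportional to
  \<open>1 + M + N\<close>, where \<open>|u| \<le> M\<close> and \<open>|f| \<le> N\<close>, makes
  the estimate linear in the norms.\<close>

text \<open>The slopes of \<open>f\<close> lie in \<open>[-L, L]\<close>, so adding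
  \<open>(L + 1) * t\<close> moves them into \<open>[1, 2 * L + 1]\<close>. The lower bound makes
  the inverse Lipschitz, the upper bound makes \<open>F\<close> map null sets to null sets.\<close>

lemma lipschitz_real_bilipschitz_homeo:
  fixes f F :: "real \<Rightarrow> real"
  assumes "L-lipschitz_on UNIV f" and F_def: "F = (\<lambda>t. f t + (L + 1) * t)"
  shows "strict_mono F" "surj F" "continuous_on UNIV F" "\<And>s t. \<bar>F s - F t\<bar> \<le> (2*L+1) * \<bar>s - t\<bar>"
    "\<And>s t. \<bar>s - t\<bar> \<le> \<bar>F s - F t\<bar>"
proof -
  have L: "\<bar>f s - f t\<bar> \<le> L * \<bar>s - t\<bar>" for s t
    using lipschitz_onD[OF assms(1), of s t] by (simp add: dist_real_def)
  have L0: "L \<ge> 0" using assms(1) lipschitz_on_nonneg by blast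
  have up: "t - s \<le> F t - F s" if "s \<le> t" for s t
    using L[of t s] that by (auto simp: F_def algebra_simps abs_if split: if_splits)
  show mono: "strict_mono F"
  proof (rule strict_monoI)
    show "F s < F t" if "s < t" for s t
      using up[of s t] that by simp
  qed
  show "\<bar>F s - F t\<bar> \<le> (2*L+1) * \<bar>s - t\<bar>" for s t
  proof -
    have "F s - F t = (f s - f t) + (L+1) * (s - t)" by (simp add: F_def algebra_simps)
    then have "\<bar>F s - F t\<bar> \<le> \<bar>f s - f t\<bar> + (L+1) * \<bar>s - t\<bar>"
      using L0 by (metis abs_mult abs_of_nonneg abs_triangle_ineq add_nonneg_nonneg zero_le_one)
    then show ?thesis using L[of s t] by (simp add: algebra_simps)
  qed
  show "\<bar>s - t\<bar> \<le> \<bar>F s - F t\<bar>" for s t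
    using up[of s t] up[of t s] by linarith
  show cont: "continuous_on UNIV F"
    unfolding F_def by (intro continuous_intros lipschitz_on_continuous_on[OF assms(1)])
  show "surj F"
  proof -
    have "\<exists>x. F x = y" for y
    proof -
      define b where "b = \<bar>y - F 0\<bar>"
      have b: "b \<ge> 0" "y \<le> F b" "F (-b) \<le> y"
        using up[of 0 b] up[of "-b" 0] by (auto simp: b_def)
      then show ?thesis
        using IVT'[of F "-b" y b] cont continuous_on_subset by (meson neg_le_0_iff_le order_trans top_greatest)
    qed
    then show ?thesis by (metis surjI)
  qed
qed

text \<open>The density is the Radon--Nikodym derivative of the image of Lebesgue measure under \<open>F\<^sup>-\<^sup>1\<close>.\<close>

lemma bilipschitz_homeo_density:
  fixes F :: "real \<Rightarrow> real"
  assumes mono: "strict_mono F" and surj: "surj F" and cont: "continuous_on UNIV F"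
    and lip: "\<And>s t. \<bar>F s - F t\<bar> \<le> B * \<bar>s - t\<bar>" and lower: "\<And>s t. \<bar>s - t\<bar> \<le> \<bar>F s - F t\<bar>"
  obtains g :: "real \<Rightarrow> real" where "\<And>a b. g integrable_on cbox a b"
    "\<And>a b. a \<le> b \<Longrightarrow> integral {a..b} g = F b - F a"
proof -
  define G where "G = inv F"
  have inj: "inj F" using mono by (simp add: strict_mono_imp_inj_on)
  have GF[simp]: "G (F x) = x" "F (G x) = x" for x
    using inj surj by (auto simp: G_def surj_f_inv_f)
  have contG: "continuous_on UNIV G"
  proof -
    have "1-lipschitz_on UNIV G"
      by (rule lipschitz_onI) (use lower[of "G _" "G _"] in \<open>auto simp: dist_real_def\<close>)
    then show ?thesis by (rule lipschitz_on_continuous_on)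
  qed
  have Gm[measurable]: "G \<in> borel_measurable borel"
    using contG by (rule borel_measurable_continuous_onI)
  \<comment> \<open>This is the Stieltjes measure of \<open>F\<close>, since the preimage of
    \<open>{a..b}\<close> under \<open>G\<close> is \<open>{F a..F b}\<close>. It is absolutely
    continuous because preimages under \<open>G\<close> are images under \<open>F\<close>, and
    Lipschitz maps preserve null sets.\<close>
  define \<mu> where "\<mu> = distr lborel borel G"
  have ac: "absolutely_continuous lborel \<mu>"
    unfolding absolutely_continuous_def
  proof
    fix N assume N: "N \<in> null_sets (lborel::real measure)"
    then have Nb: "N \<in> sets borel" by auto
    have "negligible N"
      using N by (simp add: negligible_iff_null_sets null_sets_completionI)
    then have "negligible (F ` N)"
      by (rule negligible_locally_Lipschitz_image[rotated])
         (use lip in \<open>auto simp: intro!: exI[of _ UNIV] exI[of _ B]\<close>)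
    moreover have eq: "G -` N = F ` N"
      by (auto simp: image_iff) (metis GF(2))
    moreover have "G -` N \<in> sets lborel"
      using measurable_sets[OF Gm Nb] by simp
    ultimately have "emeasure lborel (G -` N) = 0"
      by (simp add: negligible_iff_null_sets null_sets_def emeasure_completion)
    then show "N \<in> null_sets \<mu>"
      using Nb by (auto simp: \<mu>_def null_sets_def emeasure_distr)
  qed
  have "sets \<mu> = sets lborel" by (simp add: \<mu>_def)
  then obtain g0 where g0m[measurable]: "g0 \<in> borel_measurable lborel" and g0: "density lborel g0 = \<mu>"
    using sigma_finite_measure.Radon_Nikodym[OF sigma_finite_lborel ac] by auto
  define g where "g = (\<lambda>x. enn2real (g0 x))"
  have nn: "(\<integral>\<^sup>+x\<in>{a..b}. g0 x \<partial>lborel) = ennreal (F b - F a)" if "a \<le> b" for a b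
  proof -
    have "(\<integral>\<^sup>+x\<in>{a..b}. g0 x \<partial>lborel) = emeasure \<mu> {a..b}"
      unfolding g0[symmetric] by (subst emeasure_density) auto
    also have "\<dots> = emeasure lborel (G -` {a..b})"
      by (simp add: \<mu>_def emeasure_distr)
    also have "G -` {a..b} = {F a..F b}"
      using mono by (auto simp: strict_mono_less_eq) (metis GF strict_mono_less_eq[OF mono])+
    finally show ?thesis using that mono by (simp add: strict_mono_less_eq)
  qed
  have int: "set_integrable lborel {a..b} g \<and> integral {a..b} g = F b - F a" if "a \<le> b" for a b
  proof -
    have "AE x in lborel. g0 x * indicator {a..b} x \<noteq> \<infinity>"
      by (rule nn_integral_noteq_infinite) (use nn[OF that] in auto)
    then have ae: "AE x in lborel. ennreal (indicator {a..b} x *\<^sub>R g x) = g0 x * indicator {a..b} x"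
      by (rule AE_mp) (auto simp: g_def indicator_def less_top)
    have Fab: "0 \<le> F b - F a" using that mono by (simp add: strict_mono_less_eq)
    have e: "(\<integral>\<^sup>+x. ennreal (indicator {a..b} x *\<^sub>R g x) \<partial>lborel) = ennreal (F b - F a)"
      using nn_integral_cong_AE[OF ae] nn[OF that] by simp
    have i: "set_integrable lborel {a..b} g"
      unfolding set_integrable_def
      by (rule integrableI_nn_integral_finite[OF _ _ e]) (auto simp: g_def)
    have "integral {a..b} g = set_lebesgue_integral lborel {a..b} g"
      using set_borel_integral_eq_integral(2)[OF i] by simp
    also have "\<dots> = F b - F a"
      unfolding set_lebesgue_integral_def
      by (subst integral_eq_nn_integral) (use e Fab in \<open>auto simp: g_def\<close>)
    finally show ?thesis using i by simp
  qed
  show thesis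
  proof
    show "g integrable_on cbox a b" for a b
      using int[of a b] set_borel_integral_eq_integral(1)[of "{a..b}" g] by (cases "a \<le> b") auto
  qed (use int in auto)
qed

text \<open>\<open>F\<close> is an indefinite integral, so Lebesgue differentiation of the density
  gives its derivative. The averages are taken over intervals to the right of a point; left
  difference quotients are right ones of the reflected density, hence the second null set and its
  mirror image.\<close>

lemma lipschitz_real_ae_derivative:
  fixes f :: "real \<Rightarrow> real"
  assumes "L-lipschitz_on UNIV f"
  obtains N where "negligible N" "\<And>t. t \<notin> N \<Longrightarrow> \<exists>D. (f has_real_derivative D) (at t)"
proof -
  define F where "F = (\<lambda>t. f t + (L + 1) * t)"
  obtain g where gi: "\<And>a b. g integrable_on cbox a b"
    and gF: "\<And>a b. a \<le> b \<Longrightarrow> integral {a..b} g = F b - F a"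
    by (rule bilipschitz_homeo_density[OF lipschitz_real_bilipschitz_homeo[OF assms F_def]])
       (erule that, assumption)
  have gr: "(\<lambda>t. g (-t)) integrable_on cbox a b" for a b
    using gi[of "-b" "-a"] integrable_reflect[of g "-a" "-b"] by simp
  obtain N1 where N1: "negligible N1" "\<And>x e. \<lbrakk>x \<notin> N1; 0 < e\<rbrakk> \<Longrightarrow>
       \<exists>d>0. \<forall>h. 0 < h \<and> h < d \<longrightarrow> norm (integral (cbox x (x + h *\<^sub>R One)) g /\<^sub>R h ^ DIM(real) - g x) < e"
    by (rule integrable_ccontinuous_explicit[of g, OF gi]) (erule that, assumption)
  obtain N2 where N2: "negligible N2" "\<And>x e. \<lbrakk>x \<notin> N2; 0 < e\<rbrakk> \<Longrightarrow>
       \<exists>d>0. \<forall>h. 0 < h \<and> h < d \<longrightarrow> norm (integral (cbox x (x + h *\<^sub>R One)) (\<lambda>t. g (-t)) /\<^sub>R h ^ DIM(real) - g (-x)) < e"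
    by (rule integrable_ccontinuous_explicit[of "\<lambda>t. g (-t)", OF gr]) (erule that, assumption)
  have "negligible (uminus ` N2)"
    by (rule negligible_locally_Lipschitz_image[OF _ N2(1)])
       (simp, rule exI[of _ UNIV], rule exI[of _ 1], simp add: abs_minus_commute)
  moreover have "\<exists>D. (f has_real_derivative D) (at t)" if "t \<notin> N1 \<union> uminus ` N2" for t
  proof -
    have t: "t \<notin> N1" "- t \<notin> N2" using that image_eqI[of t uminus "-t" N2] by auto
    have "(F has_real_derivative g t) (at t)"
      unfolding has_field_derivative_iff LIM_def
    proof (intro allI impI)
      fix e :: real assume e: "e > 0"
      have "\<exists>d>0. \<forall>h. 0 < h \<and> h < d \<longrightarrow> \<bar>integral {t..t+h} g / h - g t\<bar> < e"
        using N1(2)[OF t(1) e] by (simp add: divide_inverse mult.commute)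
      then obtain d1 where d1: "d1 > 0"
        "\<forall>h. 0 < h \<and> h < d1 \<longrightarrow> \<bar>integral {t..t+h} g / h - g t\<bar> < e" by blast
      have "\<exists>d>0. \<forall>h. 0 < h \<and> h < d \<longrightarrow> \<bar>integral {-t..-t+h} (\<lambda>t. g (-t)) / h - g t\<bar> < e"
        using N2(2)[OF t(2) e] by (simp add: divide_inverse mult.commute)
      then obtain d2 where d2: "d2 > 0"
        "\<forall>h. 0 < h \<and> h < d2 \<longrightarrow> \<bar>integral {-t..-t+h} (\<lambda>t. g (-t)) / h - g t\<bar> < e" by blast
      have "\<bar>(F y - F t) / (y - t) - g t\<bar> < e" if y: "y \<noteq> t" "\<bar>y - t\<bar> < min d1 d2" for y
      proof (cases "y > t")
        case True
        then show ?thesis using spec[OF d1(2), of "y - t"] gF[of t y] y by auto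
      next
        case False
        then have "integral {-t..-y} (\<lambda>t. g (-t)) = F t - F y"
          using gF[of y t] integral_reflect[of t y g] y by simp
        moreover have "(F t - F y) / (t - y) = (F y - F t) / (y - t)"
          by (metis minus_diff_eq minus_divide_divide)
        ultimately show ?thesis using spec[OF d2(2), of "t - y"] y False by auto
      qed
      then show "\<exists>s>0. \<forall>x. x \<noteq> t \<and> dist x t < s \<longrightarrow> dist ((F x - F t) / (x - t)) (g t) < e"
        using d1(1) d2(1) by (intro exI[of _ "min d1 d2"]) (auto simp: dist_real_def)
    qed
    then have "((\<lambda>s. F s - (L+1) * s) has_real_derivative g t - (L+1)) (at t)"
      by (auto intro!: derivative_eq_intros)
    then show ?thesis by (auto simp: F_def)
  qed
  ultimately show thesis
    using N1(1) by (intro that[of "N1 \<union> uminus ` N2"]) auto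
qed

text \<open>Fubini for \<open>{(t, x). x + t v \<in> S}\<close>: some translate of \<open>S\<close> is a null set.\<close>

lemma negligible_of_negligible_lines:
  fixes v :: "'a::euclidean_space"
  assumes S: "S \<in> sets borel" and lines: "\<And>x. negligible {t::real. x + t *\<^sub>R v \<in> S}"
  shows "negligible S"
proof -
  have [measurable]: "S \<in> sets borel" by fact
  have "AE x in lborel. AE t in (lborel::real measure). x + t *\<^sub>R v \<notin> S"
  proof (rule AE_I2)
    fix x
    have "{t. x + t *\<^sub>R v \<in> S} \<in> sets lborel" by measurable
    moreover have "{t. x + t *\<^sub>R v \<in> S} \<in> null_sets lebesgue"
      using lines by (simp add: negligible_iff_null_sets)
    ultimately have "{t. x + t *\<^sub>R v \<in> S} \<in> null_sets lborel"
      by (simp add: null_sets_completion_iff)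
    then show "AE t in (lborel::real measure). x + t *\<^sub>R v \<notin> S"
      by (auto dest: AE_not_in)
  qed
  then have "AE t in (lborel::real measure). AE x in lborel. x + t *\<^sub>R v \<notin> S"
    by (subst (asm) lborel_pair.AE_commute) measurable
  then have "\<exists>t::real. AE x in lborel. x + t *\<^sub>R v \<notin> S"
    by (rule eventually_happens'[rotated]) (simp add: ae_filter_eq_bot_iff)
  then obtain t :: real where t: "AE x in lborel. x + t *\<^sub>R v \<notin> S" ..
  have "{x. x + t *\<^sub>R v \<in> S} \<in> sets lborel" by measurable
  then have "{x. x + t *\<^sub>R v \<in> S} \<in> null_sets lborel"
    using t by (simp add: AE_iff_null_sets)
  then have "negligible {x. x + t *\<^sub>R v \<in> S}"
    by (simp add: negligible_iff_null_sets null_sets_completionI)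
  moreover have "{x. x + t *\<^sub>R v \<in> S} = (+) (- t *\<^sub>R v) ` S"
    by (auto simp: image_iff algebra_simps)
  ultimately show ?thesis by (metis negligible_translation_rev)
qed

section \<open>Density points of closed sets\<close>

text \<open>Lebesgue differentiation of the indicator uses cubes with lowest corner
  \<open>x\<close>, hence the restriction to vectors \<open>h\<close> with nonnegative coordinates.
  If \<open>S\<close> missed the small cube at \<open>x + h\<close>, a fixed fraction of the large
  cube at \<open>x\<close> would be missing, against density 1.\<close>

lemma density_points_orthant:
  fixes S :: "'a::euclidean_space set"
  assumes "closed S"
  obtains N where "negligible N"
    "\<And>x e. x \<in> S \<Longrightarrow> x \<notin> N \<Longrightarrow> 0 < e \<Longrightarrow> \<exists>d>0. \<forall>h. (\<forall>b\<in>Basis. 0 \<le> h \<bullet> b) \<longrightarrow> norm h < d \<longrightarrow>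
       (\<exists>y\<in>S. norm (x + h - y) \<le> e * norm h)"
proof -
  have lm: "S \<inter> cbox a b \<in> lmeasurable" for a b
    using assms by (intro lmeasurable_compact) (simp add: closed_Int_compact)
  have int: "indicat_real S integrable_on cbox a b" for a b
    using lm by (simp add: integrable_on_indicator)
  obtain N where N: "negligible N" "\<And>x e. \<lbrakk>x \<notin> N; 0 < e\<rbrakk> \<Longrightarrow>
     \<exists>d>0. \<forall>h. 0 < h \<and> h < d \<longrightarrow> norm (integral (cbox x (x + h *\<^sub>R One)) (indicat_real S) /\<^sub>R h ^ DIM('a) - indicat_real S x) < e"
    by (rule integrable_ccontinuous_explicit[of "indicat_real S", OF int]) (erule that, assumption)
  have cube: "measure lebesgue (cbox z (z + t *\<^sub>R One)) = t ^ DIM('a)" if "t \<ge> 0" for z :: 'a and t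
    using that by (simp add: measure_completion content_cbox inner_left_distrib)
  show thesis
  proof (rule that[OF N(1)])
    fix x and e :: real assume x: "x \<in> S" "x \<notin> N" and e: "0 < e"
    \<comment> \<open>\<open>DIM('a)\<close> coordinates of size at most
      \<open>\<eta> * norm h\<close> add up to \<open>e * norm h\<close>. Below,
      \<open>\<theta>\<close> is the volume ratio of cubes with edges \<open>\<eta> * r\<close> and
      \<open>(1 + \<eta>) * r\<close>.\<close>
    define \<eta> where "\<eta> = e / DIM('a)"
    have \<eta>: "\<eta> > 0" using e by (simp add: \<eta>_def)
    define \<theta> where "\<theta> = (\<eta> / (1 + \<eta>)) ^ DIM('a)"
    have \<theta>: "\<theta> > 0" using \<eta> by (simp add: \<theta>_def)
    obtain d where d: "d > 0" and dd: "\<And>t. 0 < t \<Longrightarrow> t < d \<Longrightarrow>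
        norm (integral (cbox x (x + t *\<^sub>R One)) (indicat_real S) /\<^sub>R t ^ DIM('a) - 1) < \<theta>"
      using N(2)[OF x(2) \<theta>] x(1) by auto
    have "\<exists>y\<in>S. norm (x + h - y) \<le> e * norm h"
      if h: "\<forall>b\<in>Basis. 0 \<le> h \<bullet> b" "norm h < d / (1 + \<eta>)" for h
    proof (cases "h = 0")
      case True then show ?thesis using x by auto
    next
      case False
      define r where "r = norm h"
      have r: "r > 0" using False by (simp add: r_def)
      define t where "t = (1 + \<eta>) * r"
      have t: "0 < t" "t < d"
        using h(2) r \<eta> by (simp add: t_def, simp add: t_def r_def field_simps)
      define C where "C = cbox x (x + t *\<^sub>R One)"
      define C' where "C' = cbox (x + h) (x + h + (\<eta> * r) *\<^sub>R One)"
      have sub: "C' \<subseteq> C"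
      proof
        fix y assume y: "y \<in> C'"
        show "y \<in> C"
          unfolding C_def mem_box
        proof
          fix b :: 'a assume b: "b \<in> Basis"
          have "h \<bullet> b \<le> r" using b norm_bound_Basis_le[of b h r] Basis_le_norm[OF b, of h] by (simp add: r_def)
          then show "x \<bullet> b \<le> y \<bullet> b \<and> y \<bullet> b \<le> (x + t *\<^sub>R One) \<bullet> b"
            using y b h(1) unfolding C'_def mem_box by (force simp: inner_left_distrib t_def algebra_simps)
        qed
      qed
      have "S \<inter> C' \<noteq> {}"
      proof
        assume emp: "S \<inter> C' = {}"
        have "integral C (indicat_real S) = measure lebesgue (S \<inter> C)"
          using lm unfolding C_def by (subst integral_indicator) auto
        also have "\<dots> \<le> measure lebesgue (C - C')"
          using emp lm by (intro measure_mono_fmeasurable) (auto simp: C_def C'_def fmeasurable_Diff)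
        also have "\<dots> = measure lebesgue C - measure lebesgue C'"
          using sub by (intro measurable_measure_Diff) (auto simp: C_def C'_def)
        also have "\<dots> = t ^ DIM('a) - (\<eta> * r) ^ DIM('a)"
          unfolding C_def C'_def using cube[of t x] cube[of "\<eta> * r" "x + h"] t \<eta> r by simp
        finally have "integral C (indicat_real S) / t ^ DIM('a) \<le> (t ^ DIM('a) - (\<eta> * r) ^ DIM('a)) / t ^ DIM('a)"
          using t by (intro divide_right_mono) auto
        also have "\<dots> = 1 - \<theta>"
          using t r \<eta> by (simp add: diff_divide_distrib \<theta>_def power_divide[symmetric] t_def)
        finally show False
          using dd[OF t] by (simp add: C_def divide_inverse mult.commute)
      qed
      then obtain y where y: "y \<in> S" "y \<in> C'" by auto
      have "norm (x + h - y) \<le> (\<Sum>b\<in>Basis. \<bar>(x + h - y) \<bullet> b\<bar>)" by (rule norm_le_l1)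
      also have "\<dots> \<le> (\<Sum>b\<in>(Basis::'a set). \<eta> * r)"
      proof (rule sum_mono)
        fix b :: 'a assume b: "b \<in> Basis"
        then show "\<bar>(x + h - y) \<bullet> b\<bar> \<le> \<eta> * r"
          using y(2) unfolding C'_def mem_box by (force simp: inner_left_distrib inner_diff_left abs_le_iff)
      qed
      also have "\<dots> = e * norm h" by (simp add: \<eta>_def r_def)
      finally show ?thesis using y by auto
    qed
    then show "\<exists>d>0. \<forall>h. (\<forall>b\<in>Basis. 0 \<le> h \<bullet> b) \<longrightarrow> norm h < d \<longrightarrow> (\<exists>y\<in>S. norm (x + h - y) \<le> e * norm h)"
      using d \<eta> by (intro exI[of _ "d / (1 + \<eta>)"]) auto
  qed
qed

text \<open>The orthant condition is removed by reflections: each of the finitely many sets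
  \<open>T\<close> of basis vectors gives a reflected copy of \<open>S\<close>, and every
  \<open>h\<close> becomes nonnegative after reflecting its negative coordinates.\<close>

lemma density_points:
  fixes S :: "'a::euclidean_space set"
  assumes "closed S"
  shows "\<exists>N. negligible N \<and> (\<forall>x e. x \<in> S \<longrightarrow> x \<notin> N \<longrightarrow> 0 < e \<longrightarrow>
       (\<exists>d>0. \<forall>h. norm h < d \<longrightarrow> (\<exists>y\<in>S. norm (x + h - y) \<le> e * norm h)))"
proof -
  define refl :: "'a set \<Rightarrow> 'a \<Rightarrow> 'a" where
    "refl T x = (\<Sum>b\<in>Basis. (if b \<in> T then - (x \<bullet> b) else x \<bullet> b) *\<^sub>R b)" for T x
  have rb: "refl T x \<bullet> b = (if b \<in> T then - (x \<bullet> b) else x \<bullet> b)" if "b \<in> Basis" for T x b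
    using that by (simp add: refl_def)
  have lin: "linear (refl T)" for T
    by (rule linearI; rule euclidean_eqI) (auto simp: rb inner_left_distrib)
  have rr: "refl T (refl T x) = x" for T x
    by (rule euclidean_eqI) (simp add: rb)
  have nr: "norm (refl T x) = norm x" for T x
    unfolding norm_eq_sqrt_inner
    by (subst (1 2) euclidean_inner) (auto intro!: arg_cong[of _ _ sqrt] sum.cong simp: rb)
  have "\<exists>N. negligible N \<and> (\<forall>x e. x \<in> refl T -` S \<longrightarrow> x \<notin> N \<longrightarrow> 0 < e \<longrightarrow> (\<exists>d>0. \<forall>h. (\<forall>b\<in>Basis. 0 \<le> h \<bullet> b) \<longrightarrow> norm h < d \<longrightarrow>
       (\<exists>y\<in>refl T -` S. norm (x + h - y) \<le> e * norm h)))" for T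
  proof -
    have "closed (refl T -` S)"
      using assms lin by (intro continuous_closed_vimage) (auto intro: linear_continuous_at linear_conv_bounded_linear[THEN iffD1])
    then show ?thesis by (rule density_points_orthant) blast
  qed
  then obtain N where N: "\<And>T. negligible (N T)" and NN: "\<And>T x e. x \<in> refl T -` S \<Longrightarrow> x \<notin> N T \<Longrightarrow> 0 < e \<Longrightarrow>
     (\<exists>d>0. \<forall>h. (\<forall>b\<in>Basis. 0 \<le> h \<bullet> b) \<longrightarrow> norm h < d \<longrightarrow> (\<exists>y\<in>refl T -` S. norm (x + h - y) \<le> e * norm h))"
    by metis
  define M where "M = (\<Union>T\<in>Pow Basis. refl T ` N T)"
  have "negligible (refl T ` N T)" for T
  proof (rule negligible_locally_Lipschitz_image[OF _ N])
    have "norm (refl T y - refl T x) = norm (y - x)" for x y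
      using nr[of T "y - x"] linear_diff[OF lin, of T y x] by simp
    then show "\<exists>U B. open U \<and> x \<in> U \<and> (\<forall>y\<in>N T \<inter> U. norm (refl T y - refl T x) \<le> B * norm (y - x))" for x
      by (intro exI[of _ UNIV] exI[of _ 1]) auto
  qed simp
  then have M: "negligible M" unfolding M_def by (intro negligible_Union) auto
  moreover have "\<exists>d>0. \<forall>h. norm h < d \<longrightarrow> (\<exists>y\<in>S. norm (x + h - y) \<le> e * norm h)"
    if x: "x \<in> S" "x \<notin> M" and e: "0 < e" for x e
  proof -
    have "\<exists>d>0. \<forall>h. (\<forall>b\<in>Basis. 0 \<le> h \<bullet> b) \<longrightarrow> norm h < d \<longrightarrow> (\<exists>y\<in>refl T -` S. norm (refl T x + h - y) \<le> e * norm h)"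
      if "T \<in> Pow Basis" for T
    proof (rule NN[OF _ _ e])
      show "refl T x \<notin> N T" using x(2) that rr unfolding M_def by (metis UN_I image_eqI)
    qed (use x rr in auto)
    then obtain d where d: "\<And>T. T \<in> Pow Basis \<Longrightarrow> d T > 0" and dd: "\<And>T h. T \<in> Pow Basis \<Longrightarrow> (\<forall>b\<in>Basis. 0 \<le> h \<bullet> b) \<Longrightarrow> norm h < d T \<Longrightarrow>
        (\<exists>y\<in>refl T -` S. norm (refl T x + h - y) \<le> e * norm h)"
      by metis
    define D where "D = Min (d ` Pow Basis)"
    have D0: "D > 0" unfolding D_def using d by (subst Min_gr_iff) auto
    have DT: "D \<le> d T" if "T \<in> Pow Basis" for T using that unfolding D_def by (intro Min_le) auto
    have "\<exists>y\<in>S. norm (x + h - y) \<le> e * norm h" if h: "norm h < D" for h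
    proof -
      define T where "T = {b\<in>Basis. h \<bullet> b < 0}"
      have T: "T \<in> Pow Basis" by (auto simp: T_def)
      have "\<forall>b\<in>Basis. 0 \<le> refl T h \<bullet> b" by (auto simp: rb T_def)
      then obtain y where y: "refl T y \<in> S" "norm (refl T x + refl T h - y) \<le> e * norm (refl T h)"
        using dd[OF T, of "refl T h"] DT[OF T] h nr[of T h] by auto
      have "x + h - refl T y = refl T (refl T x + refl T h - y)"
        by (simp add: linear_add[OF lin] linear_diff[OF lin] rr)
      then show ?thesis
        using y nr[of T "refl T x + refl T h - y"] nr[of T h] by (intro bexI[of _ "refl T y"]) simp_all
    qed
    then show ?thesis using D0 by blast
  qed
  ultimately show ?thesis by blast
qed

section \<open>Differentiability from directional slopes\<close>

text \<open>The slope may depend on the precision, as rational slopes must. Two slopes that are both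
  good near \<open>x\<close>, compared along their own difference, differ by at most the sum of
  their errors; so they converge, and the limit is the gradient.\<close>

lemma approx_linear_imp_differentiable:
  fixes f :: "'a::euclidean_space \<Rightarrow> real"
  assumes "\<And>e. e > 0 \<Longrightarrow> \<exists>p. \<exists>d>0. \<forall>h. norm h < d \<longrightarrow> \<bar>f (x + h) - f x - p \<bullet> h\<bar> \<le> e * norm h"
  shows "f differentiable (at x)"
proof -
  have "\<forall>k::nat. \<exists>p. \<exists>d>0. \<forall>h. norm h < d \<longrightarrow> \<bar>f (x + h) - f x - p \<bullet> h\<bar> \<le> 1 / Suc k * norm h"
    by (intro allI assms) simp
  then obtain p d where d: "\<And>k::nat. d k > 0" and
    pd: "\<And>k h. norm h < d k \<Longrightarrow> \<bar>f (x + h) - f x - p k \<bullet> h\<bar> \<le> 1 / Suc k * norm h"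
    by metis
  have diff: "norm (p k - p l) \<le> 1 / Suc k + 1 / Suc l" for k l
  proof (cases "p k = p l")
    case False
    define v where "v = p k - p l"
    have v: "norm v > 0" using False by (simp add: v_def)
    define s where "s = min (d k) (d l) / (2 * norm v)"
    have s: "s > 0" using d v by (simp add: s_def)
    have sv: "norm (s *\<^sub>R v) = min (d k) (d l) / 2" using v d[of k] d[of l] by (simp add: s_def)
    have "\<bar>v \<bullet> (s *\<^sub>R v)\<bar> \<le> (1 / Suc k + 1 / Suc l) * norm (s *\<^sub>R v)"
    proof -
      define w where "w = s *\<^sub>R v"
      have "norm w < d k" "norm w < d l" using sv d[of k] d[of l] by (auto simp: w_def)
      moreover have "v \<bullet> w = p k \<bullet> w - p l \<bullet> w" by (simp add: v_def inner_diff_left)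
      moreover have "(1 / Suc k + 1 / Suc l) * norm w = 1 / Suc k * norm w + 1 / Suc l * norm w"
        by (rule distrib_right)
      ultimately show ?thesis using pd[of w k] pd[of w l] unfolding w_def by linarith
    qed
    then have "(s * norm v) * norm v \<le> (s * norm v) * (1 / Suc k + 1 / Suc l)"
      using s by (simp add: dot_square_norm power2_eq_square abs_mult mult_ac)
    then have "norm v \<le> 1 / Suc k + 1 / Suc l" using s v by (simp add: mult_le_cancel_left)
    then show ?thesis by (simp add: v_def)
  qed simp
  have "Cauchy p"
  proof (rule CauchyI)
    fix e :: real assume "e > 0"
    then obtain n :: nat where n: "2 / e < n" using reals_Archimedean2 by blast
    have "1 / Suc k < e / 2" if "k \<ge> n" for k
    proof -
      have "2 / e < Suc k" using n that by linarith
      then show ?thesis using \<open>e > 0\<close> by (simp add: field_simps)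
    qed
    then show "\<exists>M. \<forall>m\<ge>M. \<forall>n\<ge>M. norm (p m - p n) < e"
      using diff by (intro exI[of _ n]) (smt (verit) field_sum_of_halves)
  qed
  then obtain P where P: "p \<longlonglongrightarrow> P" using Cauchy_convergent_iff convergent_def by blast
  have pP: "norm (p k - P) \<le> 1 / Suc k" for k
  proof -
    have "(\<lambda>l. norm (p k - p l)) \<longlonglongrightarrow> norm (p k - P)" by (intro tendsto_intros P)
    moreover have "(\<lambda>l. 1 / Suc k + 1 / Suc l) \<longlonglongrightarrow> 1 / Suc k + 0"
      by (intro tendsto_intros LIMSEQ_Suc lim_1_over_n)
    ultimately have "norm (p k - P) \<le> 1 / Suc k + 0" by (rule LIMSEQ_le) (use diff in auto)
    then show ?thesis by simp
  qed
  have "(f has_derivative (\<lambda>h. P \<bullet> h)) (at x)"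
    unfolding has_derivative_at_alt
  proof (intro conjI allI impI)
    fix e :: real assume "e > 0"
    then obtain n :: nat where n: "2 / e < n" using reals_Archimedean2 by blast
    have "2 / e < Suc n" using n by linarith
    then have n2: "1 / Suc n * 2 \<le> e" using \<open>e > 0\<close> by (simp add: field_simps)
    have "norm (f y - f x - P \<bullet> (y - x)) \<le> e * norm (y - x)" if y: "norm (y - x) < d n" for y
    proof -
      have "\<bar>f y - f x - P \<bullet> (y - x)\<bar> \<le> \<bar>f y - f x - p n \<bullet> (y - x)\<bar> + \<bar>(p n - P) \<bullet> (y - x)\<bar>"
        by (simp add: inner_diff_left)
      also have "\<dots> \<le> 1 / Suc n * norm (y - x) + 1 / Suc n * norm (y - x)"
        using pd[OF y] Cauchy_Schwarz_ineq2[of "p n - P" "y - x"] mult_right_mono[OF pP[of n], of "norm (y - x)"]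
        by (intro add_mono) auto
      also have "\<dots> = (1 / Suc n * 2) * norm (y - x)" by simp
      also have "\<dots> \<le> e * norm (y - x)" using n2 by (intro mult_right_mono) auto
      finally show ?thesis by simp
    qed
    then show "\<exists>d>0. \<forall>y. norm (y - x) < d \<longrightarrow> norm (f y - f x - P \<bullet> (y - x)) \<le> e * norm (y - x)"
      using d by blast
  qed (rule bounded_linear_inner_right)
  then show ?thesis by (rule differentiableI)
qed


text \<open>
  The sets \<open>E\<close> collect the points where the difference quotients in direction \<open>b\<close> are uniformly close to
  \<open>q\<close>. Near a common density point of such sets one can walk along the coordinate axes and replace
  each corner of the path by a nearby point of the next set.
\<close>

lemma rademacher_real:
  fixes f :: "'a::euclidean_space \<Rightarrow> real"
  assumes "L-lipschitz_on UNIV f"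
  shows "\<exists>N. negligible N \<and> (\<forall>x. x \<notin> N \<longrightarrow> f differentiable (at x))"
proof -
  have L: "\<bar>f x - f y\<bar> \<le> L * norm (x - y)" for x y
    using lipschitz_onD[OF assms, of x y] by (simp add: dist_real_def dist_norm)
  have L0: "L \<ge> 0" using assms lipschitz_on_nonneg by blast
  have cont: "continuous_on A f" for A
    using lipschitz_on_continuous_on[OF assms] continuous_on_subset by blast
  \<comment> \<open>Slope, precision and scale run through countable sets, so that countably many
    null sets suffice. Closedness of each set gives measurability and is what
    \<open>density_points\<close> asks for.\<close>
  define E where "E = (\<lambda>b (q::rat) (k::nat) (j::nat). {x::'a. \<forall>t. \<bar>t\<bar> \<le> 1 / Suc j \<longrightarrow>
     \<bar>f (x + t *\<^sub>R b) - f x - of_rat q * t\<bar> \<le> 1 / Suc k * \<bar>t\<bar>})"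
  have clE: "closed (E b q k j)" for b q k j
    unfolding E_def Collect_all_eq Collect_imp_eq
    by (intro closed_INT closed_Un ballI closed_Collect_le continuous_intros)
       (auto simp: continuous_on_const intro!: continuous_on_compose2[OF cont[of UNIV]] continuous_intros cont)
  \<comment> \<open>The points at which the quotients in direction \<open>b\<close> settle to every
    precision, that is, where the directional derivative exists. On each line parallel to
    \<open>b\<close> almost all points are of this kind.\<close>
  define G where "G b = (\<Inter>k. \<Union>q. \<Union>j. E b q k j)" for b
  have negG: "negligible (- G b)" for b
  proof (rule negligible_of_negligible_lines[where v = b])
    have "E b q k j \<in> sets borel" for q k j using clE by (rule borel_closed)
    then show "- G b \<in> sets borel" unfolding G_def by (intro borel_comp sets.countable_INT' sets.countable_UN') auto
    fix x
    have "(L * norm b)-lipschitz_on UNIV (\<lambda>s. f (x + s *\<^sub>R b))"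
    proof (rule lipschitz_onI)
      show "dist (f (x + s *\<^sub>R b)) (f (x + t *\<^sub>R b)) \<le> L * norm b * dist s t" for s t
        using L[of "x + s *\<^sub>R b" "x + t *\<^sub>R b"] by (simp add: dist_real_def scaleR_diff_left[symmetric] mult_ac)
    qed (use L0 in simp)
    then obtain N where N: "negligible N" "\<And>s. s \<notin> N \<Longrightarrow> \<exists>D. ((\<lambda>s. f (x + s *\<^sub>R b)) has_real_derivative D) (at s)"
      by (rule lipschitz_real_ae_derivative) blast
    have "s \<in> N" if s: "x + s *\<^sub>R b \<in> - G b" for s
    proof (rule ccontr)
      assume "s \<notin> N"
      then obtain D where D: "((\<lambda>s. f (x + s *\<^sub>R b)) has_real_derivative D) (at s)" using N by blast
      have "\<exists>q j. x + s *\<^sub>R b \<in> E b q k j" for k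
      proof -
        obtain q where q: "D < of_rat q" "of_rat q < D + 1 / (2 * Suc k)"
          using of_rat_dense[of D "D + 1 / (2 * Suc k)"] by auto
        have pos: "0 < 1 / (2 * real (Suc k))" by simp
        have "\<exists>d>0. \<forall>y. norm (y - s) < d \<longrightarrow>
            norm (f (x + y *\<^sub>R b) - f (x + s *\<^sub>R b) - D * (y - s)) \<le> 1 / (2 * Suc k) * norm (y - s)"
          using D[unfolded has_field_derivative_def has_derivative_at_alt, THEN conjunct2, THEN spec, THEN mp, OF pos] by simp
        then obtain d where d: "d > 0" "\<forall>y. norm (y - s) < d \<longrightarrow>
            norm (f (x + y *\<^sub>R b) - f (x + s *\<^sub>R b) - D * (y - s)) \<le> 1 / (2 * Suc k) * norm (y - s)"
          by (elim exE conjE that)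
        obtain j :: nat where "1 / d < j" using reals_Archimedean2 by blast
        then have "1 / d < Suc j" by simp
        then have j: "1 / Suc j < d" using d(1) by (simp add: field_simps)
        have "\<bar>f (x + s *\<^sub>R b + t *\<^sub>R b) - f (x + s *\<^sub>R b) - of_rat q * t\<bar> \<le> 1 / Suc k * \<bar>t\<bar>" if "\<bar>t\<bar> \<le> 1 / Suc j" for t
        proof -
          have "\<bar>f (x + (s + t) *\<^sub>R b) - f (x + s *\<^sub>R b) - D * t\<bar> \<le> 1 / (2 * Suc k) * \<bar>t\<bar>"
            using d(2)[rule_format, of "s + t"] that j by simp
          moreover have "\<bar>(of_rat q - D) * t\<bar> \<le> 1 / (2 * Suc k) * \<bar>t\<bar>"
            unfolding abs_mult using q by (intro mult_right_mono) auto
          moreover have "1 / (2 * Suc k) * \<bar>t\<bar> + 1 / (2 * Suc k) * \<bar>t\<bar> = 1 / Suc k * \<bar>t\<bar>"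
          proof -
            have "1 / (2 * a) * c + 1 / (2 * a) * c = 1 / a * c" if "a > 0" for a c :: real
              using that by (simp add: field_simps)
            from this[of "real (Suc k)" "\<bar>t\<bar>"] show ?thesis by simp
          qed
          ultimately show ?thesis by (simp add: scaleR_left_distrib add.assoc left_diff_distrib)
        qed
        then show ?thesis unfolding E_def by blast
      qed
      then show False using s by (auto simp: G_def)
    qed
    then show "negligible {t. x + t *\<^sub>R b \<in> - G b}" using N(1) by (auto intro: negligible_subset)
  qed
  obtain M where M: "\<And>b q k j. negligible (M b q k j)" and MM: "\<And>b q k j x e. x \<in> E b q k j \<Longrightarrow> x \<notin> M b q k j \<Longrightarrow> 0 < e \<Longrightarrow>
       (\<exists>d>0. \<forall>h. norm h < d \<longrightarrow> (\<exists>y\<in>E b q k j. norm (x + h - y) \<le> e * norm h))"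
    using density_points[OF clE] by metis
  define N where "N = (\<Union>b\<in>Basis. - G b \<union> (\<Union>q. \<Union>k. \<Union>j. M b q k j))"
  have "negligible N"
    unfolding N_def using M negG
    by (intro negligible_Union negligible_Un finite_imageI ballI) (auto intro!: negligible_countable_Union)
  moreover have "f differentiable (at x)" if x: "x \<notin> N" for x
  proof (rule approx_linear_imp_differentiable)
    fix e :: real assume e: "e > 0"
    \<comment> \<open>Each coordinate step costs the slope error \<open>\<epsilon> * norm h\<close>
      and twice \<open>L * \<epsilon> * norm h\<close>, for shifting both ends of the step to the
      one that starts at the nearby point \<open>y\<close>.\<close>
    define c where "c = DIM('a) * (2 * L + 1)"
    have c: "c > 0" using L0 by (simp add: c_def)
    obtain k :: nat where "c / e < k" using reals_Archimedean2 by blast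
    then have "c / e < Suc k" by simp
    then have ck: "c * (1 / Suc k) \<le> e" using e by (simp add: field_simps)
    define \<epsilon> where "\<epsilon> = 1 / Suc k"
    have \<epsilon>: "\<epsilon> > 0" by (simp add: \<epsilon>_def)
    have "\<exists>q j. x \<in> E b q k j" if "b \<in> Basis" for b
      using x that unfolding N_def G_def by blast
    then obtain q j where E: "\<And>b. b \<in> Basis \<Longrightarrow> x \<in> E b (q b) k (j b)" by metis
    have dens: "\<exists>d>0. \<forall>h. norm h < d \<longrightarrow> (\<exists>y\<in>E b (q b) k (j b). norm (x + h - y) \<le> \<epsilon> * norm h)" if "b \<in> Basis" for b
      using MM[OF E[OF that] _ \<epsilon>] x that unfolding N_def by blast
    have step: "\<exists>d>0. \<forall>h. norm h < d \<longrightarrow>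
        \<bar>f (x + (\<Sum>b\<in>B. (h \<bullet> b) *\<^sub>R b)) - f x - (\<Sum>b\<in>B. of_rat (q b) * (h \<bullet> b))\<bar> \<le> card B * ((2 * L + 1) * \<epsilon> * norm h)"
      if "B \<subseteq> Basis" for B
      using finite_subset[OF that finite_Basis] that
    proof (induction B rule: finite_induct)
      case empty then show ?case by (intro exI[of _ 1]) auto
    next
      case (insert b B)
      then obtain d where d: "d > 0" and dd: "\<And>h. norm h < d \<Longrightarrow>
        \<bar>f (x + (\<Sum>b\<in>B. (h \<bullet> b) *\<^sub>R b)) - f x - (\<Sum>b\<in>B. of_rat (q b) * (h \<bullet> b))\<bar> \<le> card B * ((2 * L + 1) * \<epsilon> * norm h)"
        by auto
      have b: "b \<in> Basis" using insert.prems by auto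
      obtain d' where d': "d' > 0" "\<And>h. norm h < d' \<Longrightarrow> \<exists>y\<in>E b (q b) k (j b). norm (x + h - y) \<le> \<epsilon> * norm h"
        using dens[OF b] by auto
      have "\<bar>f (x + (\<Sum>b\<in>insert b B. (h \<bullet> b) *\<^sub>R b)) - f x - (\<Sum>b\<in>insert b B. of_rat (q b) * (h \<bullet> b))\<bar>
           \<le> card (insert b B) * ((2 * L + 1) * \<epsilon> * norm h)"
        if h: "norm h < d" "norm h < d'" "norm h < 1 / Suc (j b)" for h
      proof -
        define w where "w = (\<Sum>b\<in>B. (h \<bullet> b) *\<^sub>R b)"
        define s where "s = h \<bullet> b"
        have w: "norm w \<le> norm h"
        proof -
          have "w \<bullet> i = (if i \<in> B then h \<bullet> i else 0)" if "i \<in> Basis" for i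
          proof -
            have "w \<bullet> i = (\<Sum>b\<in>B. (h \<bullet> b) * (b \<bullet> i))" by (simp add: w_def inner_sum_left)
            also have "\<dots> = (\<Sum>b\<in>B. if b = i then h \<bullet> i else 0)"
              using insert.prems that by (intro sum.cong) (auto simp: inner_Basis)
            finally show ?thesis using insert.hyps by simp
          qed
          then show ?thesis
            by (intro norm_le_componentwise) auto
        qed
        have s: "\<bar>s\<bar> \<le> norm h" using Basis_le_norm[OF b] by (simp add: s_def)
        obtain y where y: "y \<in> E b (q b) k (j b)" "norm (x + w - y) \<le> \<epsilon> * norm w"
          using d'(2)[of w] w h by auto
        have yl: "norm (x + w - y) \<le> \<epsilon> * norm h"
          by (rule order_trans[OF y(2) mult_left_mono[OF w less_imp_le[OF \<epsilon>]]])
        have "\<bar>f (y + s *\<^sub>R b) - f y - of_rat (q b) * s\<bar> \<le> \<epsilon> * \<bar>s\<bar>"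
          using y(1) s h(3) unfolding E_def \<epsilon>_def by auto
        moreover have "\<epsilon> * \<bar>s\<bar> \<le> \<epsilon> * norm h" using s \<epsilon> by (intro mult_left_mono) auto
        moreover have "\<bar>f (x + w + s *\<^sub>R b) - f (y + s *\<^sub>R b)\<bar> \<le> L * (\<epsilon> * norm h)"
          using L[of "x + w + s *\<^sub>R b" "y + s *\<^sub>R b"] mult_left_mono[OF yl L0] by simp
        moreover have "\<bar>f (x + w) - f y\<bar> \<le> L * (\<epsilon> * norm h)"
          using L[of "x + w" y] mult_left_mono[OF yl L0] by simp
        moreover have "(2 * L + 1) * \<epsilon> * norm h = L * (\<epsilon> * norm h) + L * (\<epsilon> * norm h) + \<epsilon> * norm h"
          by (simp add: algebra_simps)
        ultimately have st: "\<bar>f (x + w + s *\<^sub>R b) - f (x + w) - of_rat (q b) * s\<bar> \<le> (2 * L + 1) * \<epsilon> * norm h"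
          by linarith
        have e1: "x + (\<Sum>b\<in>insert b B. (h \<bullet> b) *\<^sub>R b) = x + w + s *\<^sub>R b"
          using insert.hyps by (simp add: w_def s_def add_ac)
        have e2: "(\<Sum>b\<in>insert b B. of_rat (q b) * (h \<bullet> b)) = of_rat (q b) * s + (\<Sum>b\<in>B. of_rat (q b) * (h \<bullet> b))"
          using insert.hyps by (simp add: s_def)
        have e3: "card (insert b B) * ((2 * L + 1) * \<epsilon> * norm h) = card B * ((2 * L + 1) * \<epsilon> * norm h) + (2 * L + 1) * \<epsilon> * norm h"
          using insert.hyps by (simp add: algebra_simps)
        show ?thesis
          using st dd[OF h(1), folded w_def] unfolding e1 e2 e3 by linarith
      qed
      then show ?case
        using d d'(1) by (intro exI[of _ "min d (min d' (1 / Suc (j b)))"]) auto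
    qed
    define p where "p = (\<Sum>b\<in>Basis. of_rat (q b) *\<^sub>R b :: 'a)"
    obtain d where d: "d > 0" "\<And>h. norm h < d \<Longrightarrow>
        \<bar>f (x + (\<Sum>b\<in>Basis. (h \<bullet> b) *\<^sub>R b)) - f x - (\<Sum>b\<in>Basis. of_rat (q b) * (h \<bullet> b))\<bar> \<le> DIM('a) * ((2 * L + 1) * \<epsilon> * norm h)"
      using step[of Basis] by auto
    have "\<bar>f (x + h) - f x - p \<bullet> h\<bar> \<le> e * norm h" if "norm h < d" for h
    proof -
      have "p \<bullet> h = (\<Sum>b\<in>Basis. of_rat (q b) * (h \<bullet> b))"
        unfolding p_def inner_sum_left by (intro sum.cong) (auto simp: inner_commute)
      then have "\<bar>f (x + h) - f x - p \<bullet> h\<bar> \<le> c * (1 / Suc k) * norm h"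
        using d(2)[OF that] by (simp add: euclidean_representation c_def \<epsilon>_def)
      also have "\<dots> \<le> e * norm h" using ck by (intro mult_right_mono) auto
      finally show ?thesis .
    qed
    then show "\<exists>p. \<exists>d>0. \<forall>h. norm h < d \<longrightarrow> \<bar>f (x + h) - f x - p \<bullet> h\<bar> \<le> e * norm h"
      using d(1) by blast
  qed
  ultimately show ?thesis by blast
qed

theorem rademacher:
  fixes f :: "'a::euclidean_space \<Rightarrow> 'b::euclidean_space"
  assumes "L-lipschitz_on UNIV f"
  shows "\<exists>N. negligible N \<and> (\<forall>x. x \<notin> N \<longrightarrow> f differentiable (at x))"
proof -
  have "\<exists>N. negligible N \<and> (\<forall>x. x \<notin> N \<longrightarrow> (\<lambda>x. f x \<bullet> b) differentiable (at x))" if "b \<in> Basis" for b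
  proof (rule rademacher_real)
    show "L-lipschitz_on UNIV (\<lambda>x. f x \<bullet> b)"
    proof (rule lipschitz_onI)
      show "dist (f x \<bullet> b) (f y \<bullet> b) \<le> L * dist x y" for x y
        using lipschitz_onD[OF assms, of x y] Basis_le_norm[OF that, of "f x - f y"]
        by (simp add: dist_norm inner_diff_left)
    qed (use assms lipschitz_on_nonneg in blast)
  qed
  then obtain N where N: "\<And>b. b \<in> Basis \<Longrightarrow> negligible (N b)"
    "\<And>b x. b \<in> Basis \<Longrightarrow> x \<notin> N b \<Longrightarrow> (\<lambda>x. f x \<bullet> b) differentiable (at x)" by metis
  have "f differentiable (at x)" if "x \<notin> (\<Union>b\<in>Basis. N b)" for x
    using N(2) that by (subst differentiable_componentwise_within) auto
  moreover have "negligible (\<Union>b\<in>Basis. N b)" using N(1) by (intro negligible_Union) auto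
  ultimately show ?thesis by blast
qed

section \<open>Envelopes of class \<open>C\<^sup>1\<^sup>,\<^sup>1\<close>\<close>

lemma norm_diff_sq: "(norm (x - y :: 'a::real_inner))\<^sup>2 = (norm x)\<^sup>2 - 2 * (x \<bullet> y) + (norm y)\<^sup>2"
  by (simp add: power2_norm_eq_inner inner_diff_left inner_diff_right inner_commute)

lemma norm_midpoint_sq:
  fixes x y z :: "'a::real_inner"
  shows "(norm ((1/2) *\<^sub>R (y + z) - x))\<^sup>2
    = (norm (y - x))\<^sup>2 / 2 + (norm (z - x))\<^sup>2 / 2 - (norm (y - z))\<^sup>2 / 4"
  by (simp add: power2_norm_eq_inner inner_diff_left inner_diff_right inner_add_left inner_add_right
        inner_commute field_simps)

lemma coercive_attains_inf:
  fixes f :: "'a::euclidean_space \<Rightarrow> real"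
  assumes "continuous_on UNIV f" and "\<And>y. r < norm (y - x) \<Longrightarrow> f x \<le> f y"
  shows "\<exists>y. \<forall>z. f y \<le> f z"
proof -
  have "compact (cball x \<bar>r\<bar>)" "cball x \<bar>r\<bar> \<noteq> {}" by auto
  then obtain y where y: "y \<in> cball x \<bar>r\<bar>" "\<And>z. z \<in> cball x \<bar>r\<bar> \<Longrightarrow> f y \<le> f z"
    using continuous_attains_inf[of "cball x \<bar>r\<bar>" f] continuous_on_subset[OF assms(1)] by blast
  have "f y \<le> f z" for z
  proof (cases "norm (z - x) \<le> \<bar>r\<bar>")
    case True
    then show ?thesis using y(2)[of z] by (simp add: dist_norm norm_minus_commute)
  next
    case False
    then have "r < norm (z - x)" by linarith
    then have "f x \<le> f z" by (rule assms(2))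
    then show ?thesis using y(2)[of x] by simp
  qed
  then show ?thesis by blast
qed

text \<open>
  \<open>W\<close> is the inf-convolution with parameter \<open>1/a\<close> of the sup-convolution of \<open>U\<close> with parameter \<open>2/a\<close>, so it
  is the lower envelope of all paraboloids of opening \<open>a\<close> above the sup-convolution with parameter \<open>1/a\<close>;
  \<open>P\<close> is its gradient.
\<close>

locale envelope =
  fixes K :: "'a::euclidean_space set" and U :: "'a \<Rightarrow> real" and a :: real
  assumes compact: "compact K" and nonempty: "K \<noteq> {}" and cont: "continuous_on K U" and a: "a > 0"
begin

definition supconv :: "real \<Rightarrow> 'a \<Rightarrow> real" where
  "supconv c y = (SUP x\<in>K. U x - c * (norm (y - x))\<^sup>2)"

lemma supconv_attained: "\<exists>x\<in>K. supconv c y = U x - c * (norm (y - x))\<^sup>2"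
  and supconv_upper: "x \<in> K \<Longrightarrow> U x - c * (norm (y - x))\<^sup>2 \<le> supconv c y"
proof -
  have "continuous_on K (\<lambda>x. U x - c * (norm (y - x))\<^sup>2)" by (intro continuous_intros cont)
  then obtain x0 where x0: "x0 \<in> K" "\<And>x. x \<in> K \<Longrightarrow> U x - c * (norm (y - x))\<^sup>2 \<le> U x0 - c * (norm (y - x0))\<^sup>2"
    using continuous_attains_sup[OF compact nonempty] by blast
  have "supconv c y = U x0 - c * (norm (y - x0))\<^sup>2"
    unfolding supconv_def using x0 by (intro cSup_eq_maximum) auto
  then show "\<exists>x\<in>K. supconv c y = U x - c * (norm (y - x))\<^sup>2"
    and "x \<in> K \<Longrightarrow> U x - c * (norm (y - x))\<^sup>2 \<le> supconv c y" using x0 by auto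
qed

lemma supconv_le: "(\<And>x. x \<in> K \<Longrightarrow> U x - c * (norm (y - x))\<^sup>2 \<le> M) \<Longrightarrow> supconv c y \<le> M"
  using supconv_attained[of c y] by auto

text \<open>Adding \<open>c * |y|^2\<close> leaves a supremum of affine functions of
  \<open>y\<close> with slopes \<open>2 * c * x\<close>, where \<open>x\<close> ranges over the
  bounded set \<open>K\<close>, hence a Lipschitz function.\<close>

lemma continuous_supconv:
  assumes "c \<ge> 0" shows "continuous_on UNIV (supconv c)"
proof -
  obtain B where B: "\<And>x. x \<in> K \<Longrightarrow> norm x \<le> B" "B > 0"
    using compact_imp_bounded[OF compact] bounded_pos by blast
  define A where "A = (\<lambda>y. supconv c y + c * (norm y)\<^sup>2)"
  have le: "A y - A z \<le> (2 * c * B) * norm (y - z)" for y z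
  proof -
    obtain x where x: "x \<in> K" "supconv c y = U x - c * (norm (y - x))\<^sup>2" using supconv_attained by blast
    have "A y - A z \<le> (2 * c) * ((y - z) \<bullet> x)"
      using supconv_upper[OF x(1), of c z] by (simp add: A_def x(2) norm_diff_sq algebra_simps)
    also have "\<dots> \<le> (2 * c) * (norm (y - z) * B)"
      using assms norm_cauchy_schwarz[of "y - z" x] mult_left_mono[OF B(1)[OF x(1)], of "norm (y - z)"]
      by (intro mult_left_mono) auto
    finally show ?thesis by (simp add: mult_ac)
  qed
  have "(2 * c * B)-lipschitz_on UNIV A"
  proof (rule lipschitz_onI)
    show "dist (A y) (A z) \<le> 2 * c * B * dist y z" for y z
      using le[of y z] le[of z y] by (simp add: dist_real_def dist_norm norm_minus_commute)
  qed (use assms B in simp)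
  then have "continuous_on UNIV A" by (rule lipschitz_on_continuous_on)
  then have "continuous_on UNIV (\<lambda>y. A y - c * (norm y)\<^sup>2)" by (intro continuous_intros)
  then show ?thesis by (simp add: A_def)
qed

text \<open>\<open>supconv (a / 4)\<close> becomes convex after adding \<open>a / 4 * |y|^2\<close>,
  so the term \<open>a / 2 * |x - y|^2\<close> leaves \<open>G x\<close> uniformly convex: its
  minimiser is unique and depends on \<open>x\<close> in a Lipschitz way.\<close>

definition G :: "'a \<Rightarrow> 'a \<Rightarrow> real" where
  "G x y = supconv (a / 4) y + a / 2 * (norm (x - y))\<^sup>2"

definition Y :: "'a \<Rightarrow> 'a" where
  "Y x = (SOME y. \<forall>z. G x y \<le> G x z)"

definition W :: "'a \<Rightarrow> real" where
  "W x = G x (Y x)"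

definition P :: "'a \<Rightarrow> 'a" where
  "P x = a *\<^sub>R (x - Y x)"

lemma G_min: "G x (Y x) \<le> G x z"
proof -
  obtain x0 where x0: "x0 \<in> K" using nonempty by auto
  define q where "q = norm (x - x0)"
  \<comment> \<open>From \<open>|y - x0|^2 \<le> 3/2 p^2 + 3 q^2\<close> it follows that
    \<open>G x y\<close> is at least \<open>U x0 - 3/4 a q^2 + a/8 p^2\<close>; beyond
    \<open>r\<close> this is no less than \<open>G x x\<close>.\<close>
  define r where "r = sqrt (8 / a * \<bar>G x x - U x0 + 3 * a / 4 * q\<^sup>2\<bar>)"
  have "G x x \<le> G x y" if r: "r < norm (y - x)" for y
  proof -
    define p where "p = norm (y - x)"
    have "r\<^sup>2 \<le> p\<^sup>2" using r by (intro power_mono) (auto simp: p_def r_def a less_imp_le)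
    then have "8 / a * \<bar>G x x - U x0 + 3 * a / 4 * q\<^sup>2\<bar> \<le> p\<^sup>2" using a by (simp add: r_def)
    then have "\<bar>G x x - U x0 + 3 * a / 4 * q\<^sup>2\<bar> \<le> a / 8 * p\<^sup>2" using a by (simp add: field_simps)
    moreover have "a / 4 * (norm (y - x0))\<^sup>2 \<le> a / 4 * (3 / 2 * p\<^sup>2 + 3 * q\<^sup>2)"
    proof (rule mult_left_mono)
      have "norm (y - x0) \<le> p + q" using norm_triangle_ineq[of "y - x" "x - x0"] by (simp add: p_def q_def)
      then have "(norm (y - x0))\<^sup>2 \<le> (p + q)\<^sup>2" by (intro power_mono) auto
      also have "\<dots> \<le> 3 / 2 * p\<^sup>2 + 3 * q\<^sup>2"
        using zero_le_power2[of "p - 2 * q"] by (simp add: power2_eq_square algebra_simps)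
      finally show "(norm (y - x0))\<^sup>2 \<le> 3 / 2 * p\<^sup>2 + 3 * q\<^sup>2" .
    qed (use a in simp)
    moreover have "G x y \<ge> U x0 - a / 4 * (norm (y - x0))\<^sup>2 + a / 2 * p\<^sup>2"
      using supconv_upper[OF x0, of "a / 4" y] by (simp add: G_def p_def norm_minus_commute)
    moreover have "a / 4 * (3 / 2 * p\<^sup>2 + 3 * q\<^sup>2) = 3 * a / 8 * p\<^sup>2 + 3 * a / 4 * q\<^sup>2"
      by (simp add: algebra_simps)
    moreover have "a / 2 * p\<^sup>2 = 3 * a / 8 * p\<^sup>2 + a / 8 * p\<^sup>2" by (simp add: algebra_simps)
    ultimately show ?thesis by linarith
  qed
  moreover have "continuous_on UNIV (G x)"
    unfolding G_def using a by (intro continuous_intros continuous_supconv) simp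
  ultimately have "\<exists>y. \<forall>z. G x y \<le> G x z" using coercive_attains_inf[of "G x" r x] by blast
  from someI_ex[OF this] show ?thesis unfolding Y_def by blast
qed

text \<open>Compare with the midpoint: the penalty gains \<open>a/8 |Y x - z|^2\<close>, the
  sup-convolution loses half of that, and minimality at \<open>Y x\<close> doubles the remaining
  \<open>a/16\<close>.\<close>

lemma G_strongly_min: "G x (Y x) + a / 8 * (norm (Y x - z))\<^sup>2 \<le> G x z"
proof -
  define m where "m = (1/2) *\<^sub>R (Y x + z)"
  obtain x' where x': "x' \<in> K" "supconv (a / 4) m = U x' - a / 4 * (norm (m - x'))\<^sup>2"
    using supconv_attained by blast
  have "(norm (x - m))\<^sup>2 = (norm (x - Y x))\<^sup>2 / 2 + (norm (x - z))\<^sup>2 / 2 - (norm (Y x - z))\<^sup>2 / 4"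
    using norm_midpoint_sq[of "Y x" z x] by (simp add: m_def norm_minus_commute)
  then have "G x m = U x' - a / 4 * (norm (m - x'))\<^sup>2
     + a / 2 * ((norm (x - Y x))\<^sup>2 / 2 + (norm (x - z))\<^sup>2 / 2 - (norm (Y x - z))\<^sup>2 / 4)"
    by (simp add: G_def x')
  also have "\<dots> = (U x' - a / 4 * (norm (Y x - x'))\<^sup>2) / 2 + (U x' - a / 4 * (norm (z - x'))\<^sup>2) / 2
     + a / 2 * ((norm (x - Y x))\<^sup>2 / 2 + (norm (x - z))\<^sup>2 / 2) - a / 16 * (norm (Y x - z))\<^sup>2"
    unfolding m_def norm_midpoint_sq[of "Y x" z x'] by (simp add: field_simps)
  also have "\<dots> \<le> supconv (a / 4) (Y x) / 2 + supconv (a / 4) z / 2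
     + a / 2 * ((norm (x - Y x))\<^sup>2 / 2 + (norm (x - z))\<^sup>2 / 2) - a / 16 * (norm (Y x - z))\<^sup>2"
    using supconv_upper[OF x'(1), of "a / 4" "Y x"] supconv_upper[OF x'(1), of "a / 4" z]
    by (intro diff_right_mono add_right_mono add_mono divide_right_mono) auto
  also have "\<dots> = (G x (Y x) + G x z) / 2 - a / 16 * (norm (Y x - z))\<^sup>2"
    by (simp add: G_def field_simps)
  finally show ?thesis using G_min[of x m] by (simp add: field_simps)
qed

text \<open>Adding strong minimality at \<open>x\<close> and at \<open>z\<close> cancels all values
  of the sup-convolution and leaves only the mixed term
  \<open>a * ((x - z) \<bullet> (Y x - Y z))\<close>.\<close>

lemma Y_lipschitz: "norm (Y x - Y z) \<le> 4 * norm (x - z)"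
proof (cases "Y x = Y z")
  case False
  define d where "d = Y x - Y z"
  have d: "norm d > 0" using False by (simp add: d_def)
  have "a / 8 * (norm d)\<^sup>2 \<le> G x (Y z) - G x (Y x)" "a / 8 * (norm d)\<^sup>2 \<le> G z (Y x) - G z (Y z)"
    using G_strongly_min[of x "Y z"] G_strongly_min[of z "Y x"] by (auto simp: d_def norm_minus_commute)
  moreover have "G x (Y z) - G x (Y x) + (G z (Y x) - G z (Y z)) = a * ((x - z) \<bullet> d)"
    by (simp add: G_def norm_diff_sq d_def inner_diff_left inner_diff_right field_simps)
  ultimately have "a / 4 * (norm d)\<^sup>2 \<le> a * ((x - z) \<bullet> d)" by linarith
  also have "\<dots> \<le> a * (norm (x - z) * norm d)"
    using a norm_cauchy_schwarz by (intro mult_left_mono) auto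
  finally have "(a * norm d) * norm d \<le> (a * norm d) * (4 * norm (x - z))"
    by (simp add: power2_eq_square algebra_simps)
  then show ?thesis using a d by (simp add: d_def)
qed simp

lemma P_lipschitz: "(5 * a)-lipschitz_on UNIV P"
proof (rule lipschitz_onI)
  show "dist (P x) (P z) \<le> 5 * a * dist x z" for x z
  proof -
    have "P x - P z = a *\<^sub>R ((x - z) - (Y x - Y z))" by (simp add: P_def algebra_simps)
    then have "norm (P x - P z) = a * norm ((x - z) - (Y x - Y z))" using a by simp
    also have "\<dots> \<le> a * (norm (x - z) + 4 * norm (x - z))"
      using a Y_lipschitz[of x z] norm_triangle_ineq4[of "x - z" "Y x - Y z"] by (intro mult_left_mono) auto
    finally show ?thesis by (simp add: dist_norm algebra_simps)
  qed
qed (use a in simp)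

lemma W_upper: "W (x + h) \<le> W x + P x \<bullet> h + a / 2 * (norm h)\<^sup>2"
proof -
  have "W (x + h) \<le> G (x + h) (Y x)" unfolding W_def by (rule G_min)
  also have "\<dots> = W x + P x \<bullet> h + a / 2 * (norm h)\<^sup>2"
    by (simp add: W_def G_def P_def power2_norm_eq_inner inner_diff_left inner_diff_right
          inner_add_left inner_add_right inner_commute field_simps)
  finally show ?thesis .
qed

text \<open>\<open>W_upper\<close> at \<open>x\<close> bounds the increment from above. Read
  backwards from \<open>y\<close>, it bounds it from below with slope \<open>P y\<close>, and
  replacing \<open>P y\<close> by \<open>P x\<close> costs a quadratic term because \<open>P\<close>
  is Lipschitz.\<close>

lemma W_has_derivative: "(W has_derivative (\<lambda>h. P x \<bullet> h)) (at x)"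
  unfolding has_derivative_at_alt
proof (intro conjI allI impI)
  fix e :: real assume e: "e > 0"
  have "norm (W y - W x - P x \<bullet> (y - x)) \<le> e * norm (y - x)" if y: "norm (y - x) < e / (6 * a)" for y
  proof -
    define h where "h = y - x"
    have y: "y = x + h" by (simp add: h_def)
    have "W y - W x - P x \<bullet> h \<le> a / 2 * (norm h)\<^sup>2" using W_upper[of x h] by (simp add: y)
    moreover have "W x \<le> W y + P y \<bullet> (- h) + a / 2 * (norm h)\<^sup>2" using W_upper[of y "-h"] by (simp add: y)
    then have "- (5 * a * (norm h)\<^sup>2 + a / 2 * (norm h)\<^sup>2) \<le> W y - W x - P x \<bullet> h"
    proof -
      have "norm (P y - P x) \<le> 5 * a * norm h"
        using lipschitz_onD[OF P_lipschitz, of y x] by (simp add: dist_norm h_def)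
      then have "norm (P y - P x) * norm h \<le> 5 * a * norm h * norm h" by (rule mult_right_mono) simp
      then have "\<bar>(P y - P x) \<bullet> h\<bar> \<le> 5 * a * (norm h)\<^sup>2"
        using Cauchy_Schwarz_ineq2[of "P y - P x" h] by (simp add: power2_eq_square mult.assoc)
      then show ?thesis
        using \<open>W x \<le> W y + P y \<bullet> (- h) + a / 2 * (norm h)\<^sup>2\<close> by (simp add: inner_diff_left)
    qed
    moreover have "0 \<le> a * (norm h)\<^sup>2" using a by simp
    ultimately have "\<bar>W y - W x - P x \<bullet> h\<bar> \<le> 6 * a * (norm h)\<^sup>2" by (simp add: abs_le_iff)
    also have "\<dots> = (6 * a * norm h) * norm h" by (simp add: power2_eq_square)
    also have "\<dots> \<le> e * norm h"
      using that a by (intro mult_right_mono) (auto simp: h_def field_simps)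
    finally show ?thesis by (simp add: h_def)
  qed
  then show "\<exists>d>0. \<forall>y. norm (y - x) < d \<longrightarrow> norm (W y - W x - P x \<bullet> (y - x)) \<le> e * norm (y - x)"
    using e a by (intro exI[of _ "e / (6 * a)"]) auto
qed (rule bounded_linear_inner_right)

lemma continuous_W: "continuous_on UNIV W"
  using W_has_derivative by (intro has_derivative_continuous_on) blast

text \<open>In \<open>|Y x - x'|^2 \<le> 2 |x - Y x|^2 + 2 |x - x'|^2\<close>, multiplied by
  \<open>a / 4\<close>, the first term is paid exactly by the penalty in \<open>G\<close>. This
  fixes the ratio of the two convolution parameters.\<close>

lemma W_ge:
  assumes "x' \<in> K" shows "U x' - a / 2 * (norm (x - x'))\<^sup>2 \<le> W x"
proof -
  have "(norm (Y x - x'))\<^sup>2 \<le> 2 * (norm (x - Y x))\<^sup>2 + 2 * (norm (x - x'))\<^sup>2"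
  proof -
    have "0 \<le> (norm ((x - Y x) + (x - x')))\<^sup>2" by simp
    then show ?thesis
      by (simp add: power2_norm_eq_inner inner_diff_left inner_diff_right inner_add_left inner_add_right inner_commute)
  qed
  then have "a / 4 * (norm (Y x - x'))\<^sup>2 \<le> a / 4 * (2 * (norm (x - Y x))\<^sup>2 + 2 * (norm (x - x'))\<^sup>2)"
    using a by (intro mult_left_mono) auto
  then show ?thesis
    using supconv_upper[OF assms, of "a / 4" "Y x"] by (simp add: W_def G_def algebra_simps)
qed

lemma supconv_le_W: "supconv (a / 2) x \<le> W x"
  by (rule supconv_le) (rule W_ge)

text \<open>Completing the square moves the paraboloid to its vertex \<open>y\<close>. Its value
  \<open>c'\<close> there bounds \<open>supconv (a / 4) y\<close>, which makes \<open>y\<close> a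
  good competitor in the infimum \<open>W z\<close>.\<close>

lemma W_le_paraboloid:
  assumes "\<And>x. supconv (a / 2) x \<le> c + s \<bullet> (x - z) + a / 2 * (norm (x - z))\<^sup>2"
  shows "W z \<le> c"
proof -
  define y where "y = z - (1 / a) *\<^sub>R s"
  define c' where "c' = c - (norm s)\<^sup>2 / (2 * a)"
  have sq: "c + s \<bullet> (x - z) + a / 2 * (norm (x - z))\<^sup>2 = c' + a / 2 * (norm (x - y))\<^sup>2" for x
  proof -
    have "x - y = (x - z) + (1 / a) *\<^sub>R s" by (simp add: y_def)
    then have "(norm (x - y))\<^sup>2 = (norm (x - z))\<^sup>2 + 2 / a * (s \<bullet> (x - z)) + (norm s)\<^sup>2 / a\<^sup>2"
      by (simp only: power2_norm_eq_inner) (simp add: inner_add_left inner_add_right inner_commute power2_eq_square)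
    then show ?thesis using a by (simp add: c'_def field_simps power2_eq_square)
  qed
  have "supconv (a / 4) y \<le> c'"
  proof (rule supconv_le)
    fix x' assume x': "x' \<in> K"
    \<comment> \<open>At the midpoint both squared distances are a quarter of
      \<open>|y - x'|^2\<close>, so the assumption yields
      \<open>U x' - a/8 |y - x'|^2 \<le> c' + a/8 |y - x'|^2\<close>.\<close>
    define m where "m = (1/2) *\<^sub>R (x' + y)"
    have "(1/2) *\<^sub>R v + (1/2) *\<^sub>R v = v" for v :: 'a by (simp flip: scaleR_left_distrib)
    then have "m - x' = (1/2) *\<^sub>R (y - x')" "m - y = (- 1/2) *\<^sub>R (y - x')"
      by (auto simp: m_def algebra_simps)
    then have q: "(norm (m - x'))\<^sup>2 = (norm (y - x'))\<^sup>2 / 4" "(norm (m - y))\<^sup>2 = (norm (y - x'))\<^sup>2 / 4"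
      by (simp_all only: norm_scaleR power_mult_distrib) (simp_all add: power2_eq_square)
    then show "U x' - a / 4 * (norm (y - x'))\<^sup>2 \<le> c'"
      using supconv_upper[OF x', of "a / 2" m] assms[of m] unfolding sq q by simp
  qed
  then have "G z y \<le> c' + a / 2 * (norm (z - y))\<^sup>2" by (simp add: G_def)
  also have "\<dots> = c" using sq[of z] by simp
  finally show ?thesis using G_min[of z y] unfolding W_def by simp
qed

text \<open>The paraboloid touching \<open>W\<close> has opening \<open>b < a\<close>; without contact, one of opening \<open>a\<close> could be lowered.\<close>

lemma W_contact:
  assumes b: "b < a" and up: "\<And>x. W x \<le> W z + s \<bullet> (x - z) + b / 2 * (norm (x - z))\<^sup>2"
  obtains x' where "x' \<in> K" "W z = U x' - a / 2 * (norm (z - x'))\<^sup>2"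
proof -
  have "W z \<le> supconv (a / 2) z"
  proof (rule ccontr)
    assume "\<not> W z \<le> supconv (a / 2) z"
    define D where "D = (\<lambda>x. W z + s \<bullet> (x - z) + a / 2 * (norm (x - z))\<^sup>2 - supconv (a / 2) x)"
    have "D z > 0" using \<open>\<not> W z \<le> supconv (a / 2) z\<close> by (simp add: D_def)
    have "continuous_on UNIV D"
      unfolding D_def using a by (intro continuous_intros continuous_supconv) simp
    then have "isCont D z" by (simp add: continuous_on_eq_continuous_at)
    then have "\<exists>\<delta>>0. \<forall>x. dist x z < \<delta> \<longrightarrow> dist (D x) (D z) < D z / 2"
      using \<open>D z > 0\<close> unfolding continuous_at_eps_delta by (meson half_gt_zero)
    then obtain \<delta> where \<delta>: "\<delta> > 0" "\<And>x. dist x z < \<delta> \<Longrightarrow> dist (D x) (D z) < D z / 2" by auto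
    \<comment> \<open>The amount by which the paraboloid of opening \<open>a\<close> can be lowered:
      near \<open>z\<close> continuity leaves half of \<open>D z\<close>, away from \<open>z\<close>
      the gap between the openings leaves \<open>(a - b) / 2 * \<delta>^2\<close>.\<close>
    define \<eta> where "\<eta> = min (D z / 2) ((a - b) / 2 * \<delta>\<^sup>2)"
    have \<eta>: "\<eta> > 0" using \<open>D z > 0\<close> \<delta> b by (simp add: \<eta>_def)
    have "\<eta> \<le> D x" for x
    proof (cases "dist x z < \<delta>")
      case True
      have "\<eta> \<le> D z / 2" by (simp add: \<eta>_def)
      then show ?thesis using \<delta>(2)[OF True] unfolding dist_real_def by linarith
    next
      case False
      have "(a - b) / 2 * \<delta>\<^sup>2 \<le> (a - b) / 2 * (norm (x - z))\<^sup>2"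
        using False \<delta>(1) b by (intro mult_left_mono power_mono) (auto simp: dist_norm)
      also have "\<dots> \<le> D x"
        using up[of x] supconv_le_W[of x] by (simp add: D_def algebra_simps diff_divide_distrib)
      finally show ?thesis by (simp add: \<eta>_def)
    qed
    then have "W z \<le> W z - \<eta>"
      by (intro W_le_paraboloid[of _ s]) (use D_def in \<open>auto simp: algebra_simps\<close>)
    then show False using \<eta> by simp
  qed
  moreover obtain x' where "x' \<in> K" "supconv (a / 2) z = U x' - a / 2 * (norm (z - x'))\<^sup>2"
    using supconv_attained by blast
  ultimately show thesis using that[of x'] W_ge[of x' z] supconv_le_W[of z] by simp
qed

end

section \<open>Ishii's lemma for quadratic penalizations\<close>

text \<open>Differentiability of the gradient is assumed at the single point \<open>x\<close> only.
  The mean value theorem for the remainder along the segment to \<open>x + h\<close> reduces the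
  expansion of \<open>W\<close> to that of \<open>P\<close>; symmetry of \<open>A\<close> is not
  assumed.\<close>

lemma second_order_expansion:
  fixes W :: "'a::euclidean_space \<Rightarrow> real"
  assumes W: "\<And>z. (W has_derivative (\<lambda>h. P z \<bullet> h)) (at z)"
    and P: "(P has_derivative A) (at x)" and \<delta>: "\<delta> > 0"
  shows "\<exists>d>0. \<forall>h. norm h < d \<longrightarrow> \<bar>W (x + h) - W x - P x \<bullet> h - (h \<bullet> A h) / 2\<bar> \<le> \<delta> * (norm h)\<^sup>2"
proof -
  have linA: "linear A" using P has_derivative_linear by blast
  obtain d where d: "d > 0" and dd: "\<And>y. norm (y - x) < d \<Longrightarrow> norm (P y - P x - A (y - x)) \<le> \<delta> * norm (y - x)"
    using P[unfolded has_derivative_at_alt] \<delta> by auto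
  have "\<bar>W (x + h) - W x - P x \<bullet> h - (h \<bullet> A h) / 2\<bar> \<le> \<delta> * (norm h)\<^sup>2" if h: "norm h < d" for h
  proof -
    define \<phi> where "\<phi> t = W (x + t *\<^sub>R h) - t * (P x \<bullet> h) - t\<^sup>2 / 2 * (h \<bullet> A h)" for t :: real
    define \<phi>' where "\<phi>' t = (P (x + t *\<^sub>R h) - P x - A (t *\<^sub>R h)) \<bullet> h" for t :: real
    have der: "(\<phi> has_real_derivative \<phi>' t) (at t)" for t
    proof -
      have "((\<lambda>t. W (x + t *\<^sub>R h)) has_derivative (\<lambda>s. P (x + t *\<^sub>R h) \<bullet> (s *\<^sub>R h))) (at t)"
        by (rule has_derivative_compose[OF _ W, of "\<lambda>t. x + t *\<^sub>R h"]) (auto intro!: derivative_eq_intros)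
      then have "((\<lambda>t. W (x + t *\<^sub>R h)) has_real_derivative P (x + t *\<^sub>R h) \<bullet> h) (at t)"
        by (simp add: has_field_derivative_def mult_commute_abs)
      then have "(\<phi> has_real_derivative (P (x + t *\<^sub>R h) \<bullet> h - P x \<bullet> h - t * (h \<bullet> A h))) (at t)"
        unfolding \<phi>_def by (auto intro!: derivative_eq_intros)
      moreover have "P (x + t *\<^sub>R h) \<bullet> h - P x \<bullet> h - t * (h \<bullet> A h) = \<phi>' t"
        by (simp add: \<phi>'_def inner_diff_left linear_scale[OF linA] inner_commute[of h "A h"])
      ultimately show ?thesis by simp
    qed
    obtain t where t: "0 < t" "t < 1" "\<phi> 1 - \<phi> 0 = \<phi>' t"
      using MVT2[of 0 1 \<phi> \<phi>'] der by auto
    have th: "norm (t *\<^sub>R h) \<le> norm h" using t by (simp add: mult_left_le_one_le)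
    have "\<bar>\<phi>' t\<bar> \<le> norm (P (x + t *\<^sub>R h) - P x - A (t *\<^sub>R h)) * norm h"
      unfolding \<phi>'_def by (rule Cauchy_Schwarz_ineq2)
    also have "\<dots> \<le> (\<delta> * norm (t *\<^sub>R h)) * norm h"
      using dd[of "x + t *\<^sub>R h"] th h by (intro mult_right_mono) auto
    also have "\<dots> \<le> (\<delta> * norm h) * norm h"
      using th \<delta> by (intro mult_right_mono mult_left_mono) auto
    finally show ?thesis using t(3) by (simp add: \<phi>_def power2_eq_square mult.assoc)
  qed
  then show ?thesis using d by blast
qed

lemma quadratic_form_shift:
  fixes T :: "'a::real_inner \<Rightarrow> 'a"
  assumes "linear T" "\<And>z w. z \<bullet> T w = T z \<bullet> w"
  shows "(z + h) \<bullet> T (z + h) = z \<bullet> T z + 2 * (T z \<bullet> h) + h \<bullet> T h"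
  using assms(2)[of h z] by (simp add: linear_add[OF assms(1)] inner_add_left inner_add_right assms(2)[of z h] inner_commute)

lemma norm_Pair_sq: "(norm (x, y))\<^sup>2 = (norm x)\<^sup>2 + (norm y)\<^sup>2"
  by (simp add: norm_Pair)

text \<open>The effect of displacing the argument by \<open>d\<close>, as in a sup-convolution.
  Mixed terms in \<open>z\<close> and \<open>d\<close> are split by Young's inequality: half of the
  \<open>\<kappa>\<close> term is spent on them, and \<open>a / 2 * |d|^2\<close> pays for the rest
  up to \<open>|l|^2 / a\<close>, which is small for large \<open>a\<close>.\<close>

lemma sup_convolution_quadratic_bound:
  fixes T :: "'a::euclidean_space \<Rightarrow> 'a"
  assumes T: "linear T" "\<And>z w. z \<bullet> T w = T z \<bullet> w" and M: "\<And>z. norm (T z) \<le> M * norm z"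
    and \<kappa>: "\<kappa> > 0" and a: "a > 0" "a / 4 \<ge> M / 2 + (M + 2 * \<kappa>)\<^sup>2 / (2 * \<kappa>)" and M0: "M \<ge> 0"
  shows "l \<bullet> (z - d) + ((z - d) \<bullet> T (z - d)) / 2 - \<kappa> * (norm (z - d))\<^sup>2 - a / 2 * (norm d)\<^sup>2
     \<le> l \<bullet> z + (z \<bullet> T z) / 2 - \<kappa> / 2 * (norm z)\<^sup>2 + (norm l)\<^sup>2 / a"
proof -
  define nd where "nd = norm d"
  define nz where "nz = norm z"
  define c where "c = (M + 2 * \<kappa>)\<^sup>2 / (2 * \<kappa>)"
  define l2 where "l2 = (norm l)\<^sup>2 / a"
  have 1: "(z - d) \<bullet> T (z - d) = z \<bullet> T z - 2 * (T z \<bullet> d) + d \<bullet> T d"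
    using quadratic_form_shift[OF T, of z "- d"] by (simp add: linear_neg[OF T(1)])
  have 2: "\<bar>T z \<bullet> d\<bar> \<le> M * (nz * nd)"
    using Cauchy_Schwarz_ineq2[of "T z" d] mult_right_mono[OF M[of z], of "norm d"] by (simp add: nd_def nz_def mult.assoc)
  have 3: "\<bar>d \<bullet> T d\<bar> \<le> M * nd\<^sup>2"
    using Cauchy_Schwarz_ineq2[of d "T d"] mult_left_mono[OF M[of d], of "norm d"] by (simp add: nd_def power2_eq_square mult_ac)
  have 4: "\<bar>l \<bullet> d\<bar> \<le> norm l * nd" using Cauchy_Schwarz_ineq2[of l d] by (simp add: nd_def)
  have 5: "\<kappa> * (norm (z - d))\<^sup>2 = \<kappa> * nz\<^sup>2 - 2 * (\<kappa> * (z \<bullet> d)) + \<kappa> * nd\<^sup>2"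
    by (simp add: norm_diff_sq nd_def nz_def algebra_simps)
  have "\<bar>z \<bullet> d\<bar> \<le> nz * nd" using Cauchy_Schwarz_ineq2[of z d] by (simp add: nd_def nz_def)
  then have 6: "\<kappa> * (z \<bullet> d) \<le> \<kappa> * (nz * nd)" using \<kappa> by (intro mult_left_mono) auto
  have 7: "M * (nz * nd) + 2 * (\<kappa> * (nz * nd)) \<le> \<kappa> * nz\<^sup>2 / 2 + c * nd\<^sup>2"
  proof -
    have "0 \<le> (\<kappa> * nz - (M + 2 * \<kappa>) * nd)\<^sup>2 / (2 * \<kappa>)" using \<kappa> by simp
    also have "\<dots> = \<kappa> * nz\<^sup>2 / 2 + c * nd\<^sup>2 - (M + 2 * \<kappa>) * (nz * nd)"
      using \<kappa> by (simp add: c_def power2_diff power_mult_distrib field_simps) (simp add: power2_eq_square algebra_simps)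
    finally show ?thesis by (simp add: algebra_simps)
  qed
  have 8: "norm l * nd \<le> a * nd\<^sup>2 / 4 + l2"
  proof -
    have "0 \<le> (a / 2 * nd - norm l)\<^sup>2 / a" using a by simp
    also have "\<dots> = a * nd\<^sup>2 / 4 + l2 - norm l * nd"
      using a by (simp add: l2_def power2_diff power_mult_distrib field_simps) (simp add: power2_eq_square algebra_simps)
    finally show ?thesis by simp
  qed
  have "(M / 2 + c) * nd\<^sup>2 \<le> a / 4 * nd\<^sup>2"
    using a unfolding c_def by (intro mult_right_mono) auto
  then have 9: "M * nd\<^sup>2 / 2 + c * nd\<^sup>2 \<le> a * nd\<^sup>2 / 4" by (simp add: algebra_simps)
  have 10: "0 \<le> \<kappa> * nd\<^sup>2" using \<kappa> by simp
  have arith: "ld \<le> nl \<Longrightarrow> nl \<le> q / 4 + l2 \<Longrightarrow> mm / 2 + cc \<le> q / 4 \<Longrightarrow> mz + 2 * kz \<le> kn / 2 + cc \<Longrightarrow> zd \<le> kz \<Longrightarrow> td \<le> mz \<Longrightarrow> dd \<le> mm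
     \<Longrightarrow> 0 \<le> kd \<Longrightarrow> lz + ld + (zz + 2 * td + dd) / 2 - (kn - 2 * zd + kd) - q / 2 \<le> lz + zz / 2 - kn / 2 + l2"
    for ld nl q mm cc mz kz kn zd td dd kd lz zz :: real by argo
  have "l \<bullet> z + (- (l \<bullet> d)) + (z \<bullet> T z + 2 * (- (T z \<bullet> d)) + d \<bullet> T d) / 2 - (\<kappa> * nz\<^sup>2 - 2 * (\<kappa> * (z \<bullet> d)) + \<kappa> * nd\<^sup>2) - a * nd\<^sup>2 / 2
    \<le> l \<bullet> z + (z \<bullet> T z) / 2 - \<kappa> * nz\<^sup>2 / 2 + l2"
    by (rule arith[OF _ 8 9 7 6 _ _ 10]) (use 2 3 4 in auto)
  then show ?thesis unfolding 1 5 by (simp add: inner_diff_right nd_def nz_def l2_def)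
qed

text \<open>A form of Ishii's lemma without limits of matrices: base points and gradients are only
  near the given ones, but the matrix inequality holds with \<open>T\<close> itself. The penalty
  \<open>\<kappa>\<close> localises maxima and does not enter \<open>T\<close>.
  \<open>W_contact\<close> carries the expansions of the envelopes back to \<open>U1\<close> and
  \<open>U2\<close>.\<close>

theorem doubling_quadratic_expansions:
  fixes U1 U2 :: "'a::euclidean_space \<Rightarrow> real" and T :: "'a \<times> 'a \<Rightarrow> 'a \<times> 'a"
  assumes r: "r > 0" and cont: "continuous_on (cball x0 r) U1" "continuous_on (cball y0 r) U2"
    and T: "linear T" "\<And>z w. z \<bullet> T w = T z \<bullet> w" and \<kappa>: "\<kappa> > 0"
    and upper: "\<And>x y. x \<in> cball x0 r \<Longrightarrow> y \<in> cball y0 r \<Longrightarrow>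
       U1 x + U2 y \<le> U1 x0 + U2 y0 + l \<bullet> ((x, y) - (x0, y0)) + (((x, y) - (x0, y0)) \<bullet> T ((x, y) - (x0, y0))) / 2
          - \<kappa> * (norm ((x, y) - (x0, y0)))\<^sup>2"
    and \<epsilon>: "\<epsilon> > 0"
  obtains x y p1 p2 A1 A2 where "norm (x - x0) < \<epsilon>" "norm (y - y0) < \<epsilon>" "norm (p1 - fst l) < \<epsilon>" "norm (p2 - snd l) < \<epsilon>"
    "linear A1" "linear A2"
    "\<And>\<delta>. \<delta> > 0 \<Longrightarrow> \<exists>d>0. \<forall>h. norm h < d \<longrightarrow> x + h \<in> cball x0 r \<longrightarrow> U1 (x + h) \<le> U1 x + p1 \<bullet> h + (h \<bullet> A1 h) / 2 + \<delta> * (norm h)\<^sup>2"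
    "\<And>\<delta>. \<delta> > 0 \<Longrightarrow> \<exists>d>0. \<forall>h. norm h < d \<longrightarrow> y + h \<in> cball y0 r \<longrightarrow> U2 (y + h) \<le> U2 y + p2 \<bullet> h + (h \<bullet> A2 h) / 2 + \<delta> * (norm h)\<^sup>2"
    "\<And>\<xi> \<eta>. \<xi> \<bullet> A1 \<xi> + \<eta> \<bullet> A2 \<eta> \<le> (\<xi>, \<eta>) \<bullet> T (\<xi>, \<eta>)"
proof -
  obtain M where M: "M > 0" "\<And>z. norm (T z) \<le> M * norm z"
    using linear_bounded_pos[OF T(1)] by blast
  define z0 where "z0 = (x0, y0)"
  define C0 where "C0 = U1 x0 + U2 y0"
  obtain B where B: "\<And>x. x \<in> cball x0 r \<Longrightarrow> \<bar>U1 x\<bar> \<le> B" "\<And>y. y \<in> cball y0 r \<Longrightarrow> \<bar>U2 y\<bar> \<le> B" "B > 0"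
  proof -
    obtain B1 where B1: "B1 > 0" "\<And>x. x \<in> cball x0 r \<Longrightarrow> \<bar>U1 x\<bar> \<le> B1"
      using compact_imp_bounded[OF compact_continuous_image[OF cont(1) compact_cball]]
      unfolding bounded_pos by auto
    obtain B2 where B2: "B2 > 0" "\<And>x. x \<in> cball y0 r \<Longrightarrow> \<bar>U2 x\<bar> \<le> B2"
      using compact_imp_bounded[OF compact_continuous_image[OF cont(2) compact_cball]]
      unfolding bounded_pos by auto
    show thesis using B1 B2 by (intro that[of "max B1 B2"]) fastforce+
  qed
  \<comment> \<open>A maximum point within \<open>\<epsilon>1\<close> of \<open>z0\<close> changes
    the gradient by at most \<open>M * \<epsilon>1\<close> through \<open>T\<close>; both quantities
    are to stay within \<open>\<epsilon> / 4\<close>.\<close>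
  define \<epsilon>1 where "\<epsilon>1 = (\<epsilon> / 4) / (M + 1)"
  have \<epsilon>1: "\<epsilon>1 > 0" "\<epsilon>1 \<le> \<epsilon> / 4" "M * \<epsilon>1 \<le> \<epsilon> / 4"
  proof -
    show pos: "\<epsilon>1 > 0" using \<epsilon> M(1) by (simp add: \<epsilon>1_def)
    have "M + 1 \<noteq> 0" using M(1) by linarith
    then have "\<epsilon>1 * (M + 1) = \<epsilon> / 4" using nonzero_eq_divide_eq \<epsilon>1_def by blast
    moreover have "0 < M * \<epsilon>1" using M(1) pos by simp
    ultimately show "\<epsilon>1 \<le> \<epsilon> / 4" "M * \<epsilon>1 \<le> \<epsilon> / 4" using pos by (simp_all add: algebra_simps)
  qed
  define \<rho> where "\<rho> = min (\<kappa> * \<epsilon>1 / 8) (\<epsilon> / 4)"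
  have \<rho>: "\<rho> > 0" "\<rho> \<le> \<kappa> * \<epsilon>1 / 8" "\<rho> \<le> \<epsilon> / 4" using \<kappa> \<epsilon>1 \<epsilon> by (auto simp: \<rho>_def)
  define c where "c = M / 2 + (M + 2 * \<kappa>)\<^sup>2 / (2 * \<kappa>)"
  have c: "c \<ge> 0" using M \<kappa> by (simp add: c_def)
  define q1 where "q1 = (norm l)\<^sup>2 / (\<kappa> * \<epsilon>1\<^sup>2 / 4)"
  define q2 where "q2 = 4 * B / (\<epsilon> / 4)\<^sup>2"
  \<comment> \<open>\<open>4 * c\<close> pays for \<open>sup_convolution_quadratic_bound\<close>,
    \<open>q1\<close> makes its error \<open>|l|^2 / a\<close> smaller than the penalty at distance
    \<open>\<epsilon>1\<close>, \<open>q2\<close> keeps the contact points close, and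
    \<open>M\<close> ensures \<open>M < a\<close> for contact.\<close>
  define a where "a = 4 * c + q1 + q2 + M + 1"
  have q: "q1 \<ge> 0" "q2 \<ge> 0" using \<kappa> \<epsilon>1 \<epsilon> B by (auto simp: q1_def q2_def)
  have a: "a > 0" "M < a" "a / 4 \<ge> c" using c q M by (auto simp: a_def)
  have la: "(norm l)\<^sup>2 / a < \<kappa> * \<epsilon>1\<^sup>2 / 4"
  proof -
    have "q1 < a" using c q M by (simp add: a_def)
    then show ?thesis using \<kappa> \<epsilon>1 a by (simp add: q1_def field_simps)
  qed
  have Ba: "4 * B / a < (\<epsilon> / 4)\<^sup>2"
  proof -
    have "q2 < a" using c q M by (simp add: a_def)
    then show ?thesis using \<epsilon> a by (simp add: q2_def field_simps)
  qed
  interpret E1: envelope "cball x0 r" U1 a using cont r a by unfold_locales auto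
  interpret E2: envelope "cball y0 r" U2 a using cont r a by unfold_locales auto
  define \<Theta> where "\<Theta> z = C0 + l \<bullet> (z - z0) + ((z - z0) \<bullet> T (z - z0)) / 2 - \<kappa> / 2 * (norm (z - z0))\<^sup>2 + (norm l)\<^sup>2 / a" for z
  have S_le: "E1.supconv (a / 2) x + E2.supconv (a / 2) y \<le> \<Theta> (x, y)" for x y
  proof -
    obtain x' where x': "x' \<in> cball x0 r" "E1.supconv (a / 2) x = U1 x' - a / 2 * (norm (x - x'))\<^sup>2"
      using E1.supconv_attained by blast
    obtain y' where y': "y' \<in> cball y0 r" "E2.supconv (a / 2) y = U2 y' - a / 2 * (norm (y - y'))\<^sup>2"
      using E2.supconv_attained by blast
    define d where "d = (x, y) - (x', y')"
    have zd: "(x', y') - (x0, y0) = ((x, y) - z0) - d" by (simp add: d_def z0_def)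
    have "a / 2 * (norm d)\<^sup>2 = a / 2 * (norm (x - x'))\<^sup>2 + a / 2 * (norm (y - y'))\<^sup>2"
      by (simp add: d_def norm_Pair_sq distrib_left)
    then show ?thesis
      using upper[OF x'(1) y'(1)] sup_convolution_quadratic_bound[OF T M(2) \<kappa> a(1) a(3)[unfolded c_def] less_imp_le[OF M(1)], of l "(x, y) - z0" d]
      unfolding zd \<Theta>_def x'(2) y'(2) C0_def by linarith
  qed
  have \<Theta>_shift: "\<Theta> (z + h) \<le> \<Theta> z + (l + T (z - z0) - \<kappa> *\<^sub>R (z - z0)) \<bullet> h + a / 2 * (norm h)\<^sup>2" for z h
  proof -
    have "h \<bullet> T h \<le> M * (norm h)\<^sup>2"
      using norm_cauchy_schwarz[of h "T h"] mult_left_mono[OF M(2)[of h], of "norm h"] by (simp add: power2_eq_square mult_ac)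
    also have "\<dots> \<le> a * (norm h)\<^sup>2" using a by (intro mult_right_mono) auto
    finally have "h \<bullet> T h \<le> a * (norm h)\<^sup>2" .
    moreover define v where "v = z - z0"
    have "(v + h) \<bullet> T (v + h) = v \<bullet> T v + 2 * (T v \<bullet> h) + h \<bullet> T h"
      by (rule quadratic_form_shift[OF T])
    moreover have "(norm (v + h))\<^sup>2 = (norm v)\<^sup>2 + 2 * (v \<bullet> h) + (norm h)\<^sup>2"
      by (simp add: power2_norm_eq_inner inner_add_left inner_add_right inner_commute)
    moreover have "z + h - z0 = v + h" by (simp add: v_def)
    moreover have "0 \<le> \<kappa> * (norm h)\<^sup>2" using \<kappa> by simp
    ultimately show ?thesis
      unfolding \<Theta>_def v_def[symmetric]
      by (simp add: inner_add_left inner_add_right inner_diff_left field_simps)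
  qed
  \<comment> \<open>Sup-convolutions are replaced by envelopes one variable at a time: in each
    variable \<open>\<Theta>\<close> lies below a paraboloid of opening \<open>a\<close> that
    touches it at the given point, as \<open>W_le_paraboloid\<close> requires.\<close>
  have W_S: "E1.W x + E2.supconv (a / 2) y \<le> \<Theta> (x, y)" for x y
  proof -
    have "E1.W x \<le> \<Theta> (x, y) - E2.supconv (a / 2) y"
    proof (rule E1.W_le_paraboloid)
      show "E1.supconv (a / 2) x' \<le> \<Theta> (x, y) - E2.supconv (a / 2) y
         + fst (l + T ((x, y) - z0) - \<kappa> *\<^sub>R ((x, y) - z0)) \<bullet> (x' - x) + a / 2 * (norm (x' - x))\<^sup>2" for x'
        using S_le[of x' y] \<Theta>_shift[of "(x, y)" "(x' - x, 0)"] by (simp add: inner_prod_def norm_Pair)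
    qed
    then show ?thesis by simp
  qed
  have W_le: "E1.W x + E2.W y \<le> \<Theta> (x, y)" for x y
  proof -
    have "E2.W y \<le> \<Theta> (x, y) - E1.W x"
    proof (rule E2.W_le_paraboloid)
      show "E2.supconv (a / 2) y' \<le> \<Theta> (x, y) - E1.W x
         + snd (l + T ((x, y) - z0) - \<kappa> *\<^sub>R ((x, y) - z0)) \<bullet> (y' - y) + a / 2 * (norm (y' - y))\<^sup>2" for y'
        using W_S[of x y'] \<Theta>_shift[of "(x, y)" "(0, y' - y)"] by (simp add: inner_prod_def norm_Pair)
    qed
    then show ?thesis by simp
  qed
  \<comment> \<open>The \<open>\<kappa>\<close> term is left out of \<open>w\<close>; it survives in
    \<open>w_le\<close>, where it forces the maxima of small linear perturbations to be near
    \<open>z0\<close>.\<close>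
  define w where "w z = E1.W (fst z) + E2.W (snd z) - l \<bullet> (z - z0) - ((z - z0) \<bullet> T (z - z0)) / 2" for z
  have w_le: "w z \<le> C0 + (norm l)\<^sup>2 / a - \<kappa> / 2 * (norm (z - z0))\<^sup>2" for z
    using W_le[of "fst z" "snd z"] by (simp add: w_def \<Theta>_def)
  have w0: "C0 \<le> w z0"
  proof -
    have "fst z0 = x0" "snd z0 = y0" by (auto simp: z0_def)
    then show ?thesis
      using E1.W_ge[of x0 x0] E2.W_ge[of y0 y0] r by (simp add: w_def C0_def linear_0[OF T(1)])
  qed
  have cont_T: "continuous_on UNIV T" using T(1) by (simp add: linear_continuous_on linear_conv_bounded_linear)
  have cont_w: "continuous_on UNIV w"
  proof -
    have "continuous_on UNIV (\<lambda>z. E1.W (fst z))" "continuous_on UNIV (\<lambda>z. E2.W (snd z))" "continuous_on UNIV (\<lambda>z. T (z - z0))"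
      by (rule continuous_on_compose2[OF E1.continuous_W] continuous_on_compose2[OF E2.continuous_W]
           continuous_on_compose2[OF cont_T]; auto intro!: continuous_intros)+
    then show ?thesis
      unfolding w_def
      by (intro continuous_on_diff continuous_on_add continuous_on_divide continuous_on_inner continuous_on_const continuous_on_id) auto
  qed
  define Pm where "Pm z = (E1.P (fst z), E2.P (snd z))" for z
  define Dw where "Dw z = Pm z - l - T (z - z0)" for z
  have w_der: "(w has_derivative (\<lambda>h. Dw z \<bullet> h)) (at z)" for z
  proof -
    have T_der: "((\<lambda>z. T (z - z0)) has_derivative T) (at z)"
    proof -
      have bl: "bounded_linear T" using T(1) by (simp add: linear_conv_bounded_linear)
      have "((\<lambda>z. z - z0) has_derivative (\<lambda>h. h)) (at z)" by (auto intro!: derivative_eq_intros)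
      from bounded_linear.has_derivative[OF bl this] show ?thesis .
    qed
    have "((\<lambda>z. E1.W (fst z)) has_derivative (\<lambda>h. E1.P (fst z) \<bullet> fst h)) (at z)"
      by (rule has_derivative_compose[OF _ E1.W_has_derivative, of fst]) (auto intro!: derivative_eq_intros)
    moreover have "((\<lambda>z. E2.W (snd z)) has_derivative (\<lambda>h. E2.P (snd z) \<bullet> snd h)) (at z)"
      by (rule has_derivative_compose[OF _ E2.W_has_derivative, of snd]) (auto intro!: derivative_eq_intros)
    moreover have "((\<lambda>z. l \<bullet> (z - z0)) has_derivative (\<lambda>h. l \<bullet> h)) (at z)"
      by (auto intro!: derivative_eq_intros)
    moreover have "((\<lambda>z. ((z - z0) \<bullet> T (z - z0)) / 2) has_derivative (\<lambda>h. T (z - z0) \<bullet> h)) (at z)"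
    proof -
      have "((\<lambda>z. ((z - z0) \<bullet> T (z - z0)) / 2) has_derivative (\<lambda>h. ((z - z0) \<bullet> T h + h \<bullet> T (z - z0)) / 2)) (at z)"
        by (auto intro!: derivative_eq_intros T_der)
      moreover have "((z - z0) \<bullet> T h + h \<bullet> T (z - z0)) / 2 = T (z - z0) \<bullet> h" for h
        using T(2)[of "z - z0" h] by (simp add: inner_commute)
      ultimately show ?thesis by simp
    qed
    ultimately have "(w has_derivative (\<lambda>h. E1.P (fst z) \<bullet> fst h + E2.P (snd z) \<bullet> snd h - l \<bullet> h - T (z - z0) \<bullet> h)) (at z)"
      unfolding w_def by (intro has_derivative_diff has_derivative_add)
    moreover have "E1.P (fst z) \<bullet> fst h + E2.P (snd z) \<bullet> snd h - l \<bullet> h - T (z - z0) \<bullet> h = Dw z \<bullet> h" for h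
      by (simp add: Dw_def Pm_def inner_diff_left inner_prod_def)
    ultimately show ?thesis by simp
  qed
  have ex_max: "\<exists>z. (\<forall>z'. w z' - p \<bullet> z' \<le> w z - p \<bullet> z) \<and> norm (z - z0) < \<epsilon>1" if p: "norm p < \<rho>" for p
  proof -
    have far: "w z' - p \<bullet> z' < w z0 - p \<bullet> z0" if "\<epsilon>1 \<le> norm (z' - z0)" for z'
    proof -
      define t where "t = norm (z' - z0)"
      have "- (p \<bullet> (z' - z0)) \<le> \<rho> * t"
        using Cauchy_Schwarz_ineq2[of p "z' - z0"] mult_right_mono[OF less_imp_le[OF p], of t] by (simp add: t_def)
      also have "\<dots> \<le> (\<kappa> * \<epsilon>1 / 8) * t" using \<rho>(2) by (intro mult_right_mono) (auto simp: t_def)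
      also have "\<dots> \<le> (\<kappa> * t / 8) * t"
        using that \<kappa> \<epsilon>1 by (intro mult_right_mono divide_right_mono mult_left_mono) (auto simp: t_def)
      finally have 1: "- (p \<bullet> (z' - z0)) \<le> \<kappa> * t\<^sup>2 / 8" by (simp add: power2_eq_square)
      have "\<kappa> * \<epsilon>1\<^sup>2 \<le> \<kappa> * t\<^sup>2" using that \<kappa> \<epsilon>1 by (intro mult_left_mono power_mono) (auto simp: t_def)
      moreover have "0 < \<kappa> * \<epsilon>1\<^sup>2" using \<kappa> \<epsilon>1 by simp
      moreover have "\<kappa> / 2 * t\<^sup>2 = \<kappa> * t\<^sup>2 / 2" by simp
      ultimately have "(norm l)\<^sup>2 / a + \<kappa> * t\<^sup>2 / 8 < \<kappa> / 2 * t\<^sup>2" using la by linarith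
      then show ?thesis using 1 w_le[of z'] w0 unfolding t_def inner_diff_right by linarith
    qed
    have "continuous_on UNIV (\<lambda>z. - (w z - p \<bullet> z))"
      by (intro continuous_on_minus continuous_on_diff cont_w continuous_on_inner continuous_on_const continuous_on_id)
    moreover have "- (w z0 - p \<bullet> z0) \<le> - (w z' - p \<bullet> z')" if "\<epsilon>1 < norm (z' - z0)" for z'
      using far[of z'] that by simp
    ultimately have "\<exists>z. \<forall>z'. - (w z - p \<bullet> z) \<le> - (w z' - p \<bullet> z')"
      by (rule coercive_attains_inf)
    then obtain z where z: "\<forall>z'. - (w z - p \<bullet> z) \<le> - (w z' - p \<bullet> z')" by blast
    have "w z' - p \<bullet> z' \<le> w z - p \<bullet> z" for z' using spec[OF z, of z'] by linarith
    moreover have "norm (z - z0) < \<epsilon>1"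
    proof (rule ccontr)
      assume "\<not> norm (z - z0) < \<epsilon>1"
      then show False using far[of z] spec[OF z, of z0] by linarith
    qed
    ultimately show ?thesis by blast
  qed
  have ex_grad: "Dw z = p" if z: "\<And>z'. w z' - p \<bullet> z' \<le> w z - p \<bullet> z" for z p
  proof -
    have d: "((\<lambda>z. w z - p \<bullet> z) has_derivative (\<lambda>h. Dw z \<bullet> h - p \<bullet> h)) (at z)"
      by (auto intro!: derivative_eq_intros w_der)
    have "(\<lambda>h. Dw z \<bullet> h - p \<bullet> h) = (\<lambda>h. 0)"
      by (rule differential_zero_maxmin[OF UNIV_I open_UNIV d]) (use z in auto)
    then have "(Dw z - p) \<bullet> (Dw z - p) = 0" by (metis inner_diff_left)
    then show ?thesis by simp
  qed
  have Pm_lip: "(10 * a)-lipschitz_on UNIV Pm"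
  proof (rule lipschitz_onI)
    fix z z' :: "'a \<times> 'a"
    have "dist (Pm z) (Pm z') \<le> dist (E1.P (fst z)) (E1.P (fst z')) + dist (E2.P (snd z)) (E2.P (snd z'))"
      unfolding Pm_def dist_Pair_Pair by (rule sqrt_sum_squares_le_sum) auto
    also have "\<dots> \<le> 5 * a * dist (fst z) (fst z') + 5 * a * dist (snd z) (snd z')"
      by (intro add_mono lipschitz_onD[OF E1.P_lipschitz] lipschitz_onD[OF E2.P_lipschitz]) auto
    also have "\<dots> \<le> 5 * a * dist z z' + 5 * a * dist z z'"
      using a by (intro add_mono mult_left_mono dist_fst_le dist_snd_le) auto
    finally show "dist (Pm z) (Pm z') \<le> 10 * a * dist z z'" by simp
  qed (use a in simp)
  obtain N where N: "negligible N" "\<And>z. z \<notin> N \<Longrightarrow> Pm differentiable (at z)"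
    using rademacher[OF Pm_lip] by blast
  have "\<exists>p z. norm p < \<rho> \<and> (\<forall>z'. w z' - p \<bullet> z' \<le> w z - p \<bullet> z) \<and> norm (z - z0) < \<epsilon>1 \<and> z \<notin> N"
  proof (rule ccontr)
    assume neg: "\<not> ?thesis"
    have "ball 0 \<rho> \<subseteq> Dw ` N"
    proof
      fix p :: "'a \<times> 'a" assume p: "p \<in> ball 0 \<rho>"
      then obtain z where z: "\<And>z'. w z' - p \<bullet> z' \<le> w z - p \<bullet> z" "norm (z - z0) < \<epsilon>1" using ex_max[of p] by auto
      have "norm p < \<rho>" using p by simp
      with neg z have "z \<in> N" by blast
      then show "p \<in> Dw ` N" using ex_grad[OF z(1)] by blast
    qed
    moreover have "negligible (Dw ` N)"
    proof (rule negligible_locally_Lipschitz_image[OF _ N(1)])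
      have "norm (Dw z' - Dw z) \<le> (10 * a + M) * norm (z' - z)" for z z'
      proof -
        have "Dw z' - Dw z = (Pm z' - Pm z) - T (z' - z)" by (simp add: Dw_def linear_diff[OF T(1)])
        then show ?thesis
          using norm_triangle_ineq4[of "Pm z' - Pm z" "T (z' - z)"] M(2)[of "z' - z"] lipschitz_onD[OF Pm_lip, of z' z]
          by (simp add: dist_norm distrib_right)
      qed
      then show "\<exists>T B. open T \<and> z \<in> T \<and> (\<forall>y\<in>N \<inter> T. norm (Dw y - Dw z) \<le> B * norm (y - z))" for z
        by (intro exI[of _ UNIV] exI[of _ "10 * a + M"]) auto
    qed simp
    ultimately have "negligible (ball (0 :: 'a \<times> 'a) \<rho>)" by (rule negligible_subset[rotated])
    then show False using open_not_negligible[of "ball (0 :: 'a \<times> 'a) \<rho>"] \<rho>(1) by auto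
  qed
  then obtain p z where p: "norm p < \<rho>" and zmax: "\<And>z'. w z' - p \<bullet> z' \<le> w z - p \<bullet> z"
    and zz0: "norm (z - z0) < \<epsilon>1" and zN: "z \<notin> N" by blast
  obtain x y where z: "z = (x, y)" by (cases z)
  define g where "g = l + T (z - z0) + p"
  have Pg: "E1.P x = fst g" "E2.P y = snd g"
  proof -
    have "Pm z = g" using ex_grad[OF zmax] by (simp add: Dw_def g_def algebra_simps)
    then show "E1.P x = fst g" "E2.P y = snd g" by (auto simp: Pm_def z)
  qed
  have gl: "norm (g - l) < \<epsilon>"
  proof -
    have "norm (T (z - z0)) \<le> M * \<epsilon>1"
      using M(2)[of "z - z0"] mult_left_mono[OF less_imp_le[OF zz0], of M] M(1) by linarith
    then show ?thesis
      using norm_triangle_ineq[of "T (z - z0)" p] \<epsilon>1(3) p \<rho>(3) \<epsilon> by (simp add: g_def)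
  qed
  obtain Dp where Dp: "(Pm has_derivative Dp) (at z)" using N(2)[OF zN] differentiable_def by blast
  \<comment> \<open>Maximality rewritten for the envelopes. The second order part is exactly
    \<open>T\<close>, and in each variable separately the opening is at most \<open>M < a\<close>,
    the hypothesis of \<open>W_contact\<close>.\<close>
  have slice: "E1.W (x + \<xi>) + E2.W (y + \<eta>) \<le> E1.W x + E2.W y + g \<bullet> (\<xi>, \<eta>) + ((\<xi>, \<eta>) \<bullet> T (\<xi>, \<eta>)) / 2" for \<xi> \<eta>
  proof -
    define h where "h = (\<xi>, \<eta>)"
    have "w (z + h) - w z \<le> p \<bullet> h" using zmax[of "z + h"] by (simp add: inner_add_right)
    moreover have "(z - z0 + h) \<bullet> T (z - z0 + h) = (z - z0) \<bullet> T (z - z0) + 2 * (T (z - z0) \<bullet> h) + h \<bullet> T h"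
      by (rule quadratic_form_shift[OF T])
    moreover have "z + h - z0 = z - z0 + h" by simp
    ultimately show ?thesis
      by (simp add: w_def g_def inner_add_left inner_add_right h_def[symmetric] add_divide_distrib) (simp add: z h_def)
  qed
  have TM: "h \<bullet> T h \<le> M * (norm h)\<^sup>2" for h
    using norm_cauchy_schwarz[of h "T h"] mult_left_mono[OF M(2)[of h], of "norm h"] by (simp add: power2_eq_square mult_ac)
  obtain x' where x': "x' \<in> cball x0 r" "E1.W x = U1 x' - a / 2 * (norm (x - x'))\<^sup>2"
  proof (rule E1.W_contact[OF a(2)])
    show "E1.W x'' \<le> E1.W x + fst g \<bullet> (x'' - x) + M / 2 * (norm (x'' - x))\<^sup>2" for x''
      using slice[of "x'' - x" 0] TM[of "(x'' - x, 0)"] by (simp add: inner_prod_def norm_Pair)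
  qed
  obtain y' where y': "y' \<in> cball y0 r" "E2.W y = U2 y' - a / 2 * (norm (y - y'))\<^sup>2"
  proof (rule E2.W_contact[OF a(2)])
    show "E2.W y'' \<le> E2.W y + snd g \<bullet> (y'' - y) + M / 2 * (norm (y'' - y))\<^sup>2" for y''
      using slice[of 0 "y'' - y"] TM[of "(0, y'' - y)"] by (simp add: inner_prod_def norm_Pair)
  qed
  have close: "norm (v' - v0) < \<epsilon>"
    if "a / 2 * (norm (v - v'))\<^sup>2 \<le> 2 * B + a / 2 * (norm (v - v0))\<^sup>2" "norm (v - v0) < \<epsilon>1" for v v' v0 :: 'a
  proof -
    have "(norm (v - v'))\<^sup>2 \<le> 4 * B / a + (norm (v - v0))\<^sup>2"
      using that(1) a by (simp add: field_simps)
    also have "\<dots> < (\<epsilon> / 4)\<^sup>2 + (\<epsilon> / 4)\<^sup>2"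
      using Ba that(2) \<epsilon>1 by (intro add_less_le_mono power_mono) auto
    also have "\<dots> \<le> (\<epsilon> / 2)\<^sup>2" by (simp add: power2_eq_square)
    finally have "norm (v - v') < \<epsilon> / 2" using \<epsilon> by (auto dest: power_less_imp_less_base)
    then show ?thesis
      using norm_triangle_ineq[of "v' - v" "v - v0"] that(2) \<epsilon>1(2) \<epsilon> by (simp add: norm_minus_commute)
  qed
  have xx0: "norm (x - x0) < \<epsilon>1" "norm (y - y0) < \<epsilon>1"
    using zz0 norm_fst_le[of "x - x0" "y - y0"] norm_snd_le[of "y - y0" "x - x0"] by (auto simp: z z0_def)
  show thesis
  proof (rule that[of x' y' "fst g" "snd g" "\<lambda>h. fst (Dp (h, 0))" "\<lambda>h. snd (Dp (0, h))"])
    show "norm (x' - x0) < \<epsilon>"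
    proof (rule close[OF _ xx0(1)])
      show "a / 2 * (norm (x - x'))\<^sup>2 \<le> 2 * B + a / 2 * (norm (x - x0))\<^sup>2"
        using E1.W_ge[of x0 x] x' B(1)[of x0] B(1)[of x'] r by auto
    qed
    show "norm (y' - y0) < \<epsilon>"
    proof (rule close[OF _ xx0(2)])
      show "a / 2 * (norm (y - y'))\<^sup>2 \<le> 2 * B + a / 2 * (norm (y - y0))\<^sup>2"
        using E2.W_ge[of y0 y] y' B(2)[of y0] B(2)[of y'] r by auto
    qed
    show "norm (fst g - fst l) < \<epsilon>" "norm (snd g - snd l) < \<epsilon>"
    proof -
      have "norm (fst (g - l)) \<le> norm (g - l)" "norm (snd (g - l)) \<le> norm (g - l)"
        using norm_fst_le[of "fst (g - l)" "snd (g - l)"] norm_snd_le[of "snd (g - l)" "fst (g - l)"]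
        by (simp_all only: prod.collapse)
      then show "norm (fst g - fst l) < \<epsilon>" "norm (snd g - snd l) < \<epsilon>" using gl by simp_all
    qed
    have linD: "linear Dp" using Dp has_derivative_linear by blast
    show lin1: "linear (\<lambda>h. fst (Dp (h, 0)))"
      using linear_compose[OF linear_compose[OF _ linD, of "\<lambda>h. (h, 0)"] linear_fst] by (simp add: o_def linear_iff)
    show lin2: "linear (\<lambda>h. snd (Dp (0, h)))"
      using linear_compose[OF linear_compose[OF _ linD, of "\<lambda>h. (0, h)"] linear_snd] by (simp add: o_def linear_iff)
    have D1: "(E1.P has_derivative (\<lambda>h. fst (Dp (h, 0)))) (at x)"
    proof -
      have "((\<lambda>x. Pm (x, y)) has_derivative (\<lambda>h. Dp (h, 0))) (at x)"
        by (rule has_derivative_compose[of "\<lambda>x. (x, y)" "\<lambda>h. (h, 0)" x UNIV Pm Dp])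
          (use Dp z in \<open>auto intro!: derivative_eq_intros\<close>)
      from has_derivative_fst[OF this] show ?thesis by (simp add: Pm_def)
    qed
    have D2: "(E2.P has_derivative (\<lambda>h. snd (Dp (0, h)))) (at y)"
    proof -
      have "((\<lambda>y. Pm (x, y)) has_derivative (\<lambda>h. Dp (0, h))) (at y)"
        by (rule has_derivative_compose[of "\<lambda>y. (x, y)" "\<lambda>h. (0, h)" y UNIV Pm Dp])
          (use Dp z in \<open>auto intro!: derivative_eq_intros\<close>)
      from has_derivative_snd[OF this] show ?thesis by (simp add: Pm_def)
    qed
    note ex1 = second_order_expansion[OF E1.W_has_derivative D1, unfolded Pg]
    note ex2 = second_order_expansion[OF E2.W_has_derivative D2, unfolded Pg]
    \<comment> \<open>\<open>W (x + h)\<close> dominates \<open>U1 (x' + h)\<close> minus the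
      constant \<open>a / 2 * |x - x'|^2\<close>, with equality for \<open>h = 0\<close>. So the
      upper expansion at \<open>x\<close> passes to \<open>U1\<close> at \<open>x'\<close> with the
      same gradient and matrix.\<close>
    show "\<exists>d>0. \<forall>h. norm h < d \<longrightarrow> x' + h \<in> cball x0 r \<longrightarrow>
        U1 (x' + h) \<le> U1 x' + fst g \<bullet> h + (h \<bullet> fst (Dp (h, 0))) / 2 + \<delta> * (norm h)\<^sup>2" if \<delta>: "\<delta> > 0" for \<delta>
    proof -
      obtain d where d: "d > 0" "\<And>h. norm h < d \<Longrightarrow>
          \<bar>E1.W (x + h) - E1.W x - fst g \<bullet> h - (h \<bullet> fst (Dp (h, 0))) / 2\<bar> \<le> \<delta> * (norm h)\<^sup>2"
        using ex1[OF \<delta>] by auto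
      have "U1 (x' + h) \<le> U1 x' + fst g \<bullet> h + (h \<bullet> fst (Dp (h, 0))) / 2 + \<delta> * (norm h)\<^sup>2"
        if "norm h < d" "x' + h \<in> cball x0 r" for h
        using d(2)[OF that(1)] E1.W_ge[OF that(2), of "x + h"] x'(2) by (simp add: abs_le_iff)
      then show ?thesis using d(1) by blast
    qed
    show "\<exists>d>0. \<forall>h. norm h < d \<longrightarrow> y' + h \<in> cball y0 r \<longrightarrow>
        U2 (y' + h) \<le> U2 y' + snd g \<bullet> h + (h \<bullet> snd (Dp (0, h))) / 2 + \<delta> * (norm h)\<^sup>2" if \<delta>: "\<delta> > 0" for \<delta>
    proof -
      obtain d where d: "d > 0" "\<And>h. norm h < d \<Longrightarrow>
          \<bar>E2.W (y + h) - E2.W y - snd g \<bullet> h - (h \<bullet> snd (Dp (0, h))) / 2\<bar> \<le> \<delta> * (norm h)\<^sup>2"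
        using ex2[OF \<delta>] by auto
      have "U2 (y' + h) \<le> U2 y' + snd g \<bullet> h + (h \<bullet> snd (Dp (0, h))) / 2 + \<delta> * (norm h)\<^sup>2"
        if "norm h < d" "y' + h \<in> cball y0 r" for h
        using d(2)[OF that(1)] E2.W_ge[OF that(2), of "y + h"] y'(2) by (simp add: abs_le_iff)
      then show ?thesis using d(1) by blast
    qed
    show "\<xi> \<bullet> fst (Dp (\<xi>, 0)) + \<eta> \<bullet> snd (Dp (0, \<eta>)) \<le> (\<xi>, \<eta>) \<bullet> T (\<xi>, \<eta>)" for \<xi> \<eta>
    proof (rule field_le_epsilon)
      fix e :: real assume e: "e > 0"
      define n where "n = (norm \<xi>)\<^sup>2 + (norm \<eta>)\<^sup>2 + 1"
      have n: "n > 0" by (simp add: n_def add_nonneg_pos)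
      define \<delta> where "\<delta> = e / (2 * n)"
      have \<delta>: "\<delta> > 0" using e n by (simp add: \<delta>_def)
      obtain d1 where d1: "d1 > 0" "\<And>h. norm h < d1 \<Longrightarrow>
          \<bar>E1.W (x + h) - E1.W x - fst g \<bullet> h - (h \<bullet> fst (Dp (h, 0))) / 2\<bar> \<le> \<delta> * (norm h)\<^sup>2"
        using ex1[OF \<delta>] by auto
      obtain d2 where d2: "d2 > 0" "\<And>h. norm h < d2 \<Longrightarrow>
          \<bar>E2.W (y + h) - E2.W y - snd g \<bullet> h - (h \<bullet> snd (Dp (0, h))) / 2\<bar> \<le> \<delta> * (norm h)\<^sup>2"
        using ex2[OF \<delta>] by auto
      \<comment> \<open>Scaling by a small \<open>t\<close> brings both vectors into the range of
        the expansions. All second order terms carry the factor \<open>t^2\<close>, which is divided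
        out; the remainder is then at most \<open>2 * \<delta> * n = e\<close>.\<close>
      define t where "t = (min d1 d2 / 2) / (norm \<xi> + norm \<eta> + 1)"
      have den: "norm \<xi> + norm \<eta> + 1 > 0" by (simp add: add_nonneg_pos)
      have t: "t > 0" using d1(1) d2(1) den by (simp add: t_def)
      have tt: "t * (norm \<xi> + norm \<eta> + 1) = min d1 d2 / 2"
        using den nonzero_eq_divide_eq[of "norm \<xi> + norm \<eta> + 1" t "min d1 d2 / 2"] t_def by linarith
      have "t * norm \<xi> \<le> t * (norm \<xi> + norm \<eta> + 1)" "t * norm \<eta> \<le> t * (norm \<xi> + norm \<eta> + 1)"
        using t by (auto intro!: mult_left_mono)
      then have small: "norm (t *\<^sub>R \<xi>) < d1" "norm (t *\<^sub>R \<eta>) < d2" using tt d1(1) d2(1) t by auto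
      have q1: "t *\<^sub>R \<xi> \<bullet> fst (Dp (t *\<^sub>R \<xi>, 0)) = t\<^sup>2 * (\<xi> \<bullet> fst (Dp (\<xi>, 0)))"
        using linear_scale[OF lin1, of t \<xi>] by (simp add: power2_eq_square)
      have q2: "t *\<^sub>R \<eta> \<bullet> snd (Dp (0, t *\<^sub>R \<eta>)) = t\<^sup>2 * (\<eta> \<bullet> snd (Dp (0, \<eta>)))"
        using linear_scale[OF lin2, of t \<eta>] by (simp add: power2_eq_square)
      have q3: "(t *\<^sub>R \<xi>, t *\<^sub>R \<eta>) \<bullet> T (t *\<^sub>R \<xi>, t *\<^sub>R \<eta>) = t\<^sup>2 * ((\<xi>, \<eta>) \<bullet> T (\<xi>, \<eta>))"
        using linear_scale[OF T(1), of t "(\<xi>, \<eta>)"] by (simp add: power2_eq_square flip: scaleR_Pair)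
      have q4: "(norm (t *\<^sub>R \<xi>))\<^sup>2 = t\<^sup>2 * (norm \<xi>)\<^sup>2" "(norm (t *\<^sub>R \<eta>))\<^sup>2 = t\<^sup>2 * (norm \<eta>)\<^sup>2"
        by (auto simp: power_mult_distrib)
      have q5: "g \<bullet> (t *\<^sub>R \<xi>, t *\<^sub>R \<eta>) = fst g \<bullet> (t *\<^sub>R \<xi>) + snd g \<bullet> (t *\<^sub>R \<eta>)" by (simp add: inner_prod_def)
      have "t\<^sup>2 * (\<xi> \<bullet> fst (Dp (\<xi>, 0))) / 2 + t\<^sup>2 * (\<eta> \<bullet> snd (Dp (0, \<eta>))) / 2
         \<le> t\<^sup>2 * ((\<xi>, \<eta>) \<bullet> T (\<xi>, \<eta>)) / 2 + \<delta> * (t\<^sup>2 * (norm \<xi>)\<^sup>2) + \<delta> * (t\<^sup>2 * (norm \<eta>)\<^sup>2)"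
        using d1(2)[OF small(1)] d2(2)[OF small(2)] slice[of "t *\<^sub>R \<xi>" "t *\<^sub>R \<eta>"]
        unfolding q1 q2 q3 q4 q5 by linarith
      then have "t\<^sup>2 * (\<xi> \<bullet> fst (Dp (\<xi>, 0)) + \<eta> \<bullet> snd (Dp (0, \<eta>)))
         \<le> t\<^sup>2 * ((\<xi>, \<eta>) \<bullet> T (\<xi>, \<eta>) + 2 * \<delta> * ((norm \<xi>)\<^sup>2 + (norm \<eta>)\<^sup>2))"
        by (simp add: algebra_simps)
      then have "\<xi> \<bullet> fst (Dp (\<xi>, 0)) + \<eta> \<bullet> snd (Dp (0, \<eta>)) \<le> (\<xi>, \<eta>) \<bullet> T (\<xi>, \<eta>) + 2 * \<delta> * ((norm \<xi>)\<^sup>2 + (norm \<eta>)\<^sup>2)"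
        using t by (simp add: mult_le_cancel_left)
      also have "2 * \<delta> * ((norm \<xi>)\<^sup>2 + (norm \<eta>)\<^sup>2) \<le> 2 * \<delta> * n"
        using \<delta> by (intro mult_left_mono) (auto simp: n_def)
      also have "2 * \<delta> * n = e" using n by (simp add: \<delta>_def)
      finally show "\<xi> \<bullet> fst (Dp (\<xi>, 0)) + \<eta> \<bullet> snd (Dp (0, \<eta>)) \<le> (\<xi>, \<eta>) \<bullet> T (\<xi>, \<eta>) + e" by simp
    qed
  qed
qed

section \<open>Elliptic operators and quadratic test functions\<close>

lemma symmetric_mat_add: "symmetric_mat A \<Longrightarrow> symmetric_mat B \<Longrightarrow> symmetric_mat (A + B)"
  by (simp add: symmetric_mat_def transpose_def vec_eq_iff)

lemma symmetric_mat_diff: "symmetric_mat A \<Longrightarrow> symmetric_mat B \<Longrightarrow> symmetric_mat (A - B)"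
  by (simp add: symmetric_mat_def transpose_def vec_eq_iff)

lemma symmetric_mat_scaleR: "symmetric_mat A \<Longrightarrow> symmetric_mat (c *\<^sub>R A)"
  by (simp add: symmetric_mat_def transpose_def vec_eq_iff)

lemma symmetric_mat_1: "symmetric_mat (mat 1)"
  by (simp add: symmetric_mat_def transpose_mat)

lemmas symmetric_intros = symmetric_mat_add symmetric_mat_diff symmetric_mat_scaleR symmetric_mat_1

lemma symmetric_mat_inner:
  assumes "symmetric_mat M" shows "x \<bullet> (M *v y) = (M *v x) \<bullet> y"
proof -
  have "(M *v x) \<bullet> y = (transpose M *v x) \<bullet> y" using assms by (simp add: symmetric_mat_def)
  also have "\<dots> = x \<bullet> (M *v y)" by (simp add: transpose_matrix_vector dot_lmul_matrix)
  finally show ?thesis by simp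
qed

text \<open>The form at \<open>v + t P v\<close> is \<open>2 t |P v|^2 + O(t^2)\<close>, which would
  be negative for some small negative \<open>t\<close> unless \<open>P v = 0\<close>.\<close>

lemma psd_null:
  assumes P: "psd P" and v: "v \<bullet> (P *v v) = 0"
  shows "P *v v = 0"
proof -
  define w where "w = P *v v"
  define a where "a = w \<bullet> w"
  define c where "c = w \<bullet> (P *v w)"
  have c: "c \<ge> 0" using P by (simp add: psd_def c_def)
  have sym: "v \<bullet> (P *v w) = a" using P by (simp add: psd_def symmetric_mat_inner a_def w_def)
  have "0 \<le> (v + t *\<^sub>R w) \<bullet> (P *v (v + t *\<^sub>R w))" for t using P by (simp add: psd_def)
  moreover have "(v + t *\<^sub>R w) \<bullet> (P *v (v + t *\<^sub>R w)) = 2 * t * a + t\<^sup>2 * c" for t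
    using v sym by (simp add: matrix_vector_right_distrib matrix_vector_mult_scaleR inner_add_left inner_add_right
      power2_eq_square a_def c_def algebra_simps flip: w_def)
  ultimately have "0 \<le> 2 * t * a + t\<^sup>2 * c" for t by simp
  note nonneg = this
  define s where "s = a / (c + 1)"
  have a: "a = s * (c + 1)" using c by (simp add: s_def)
  have "0 \<le> 2 * (- s) * a + (- s)\<^sup>2 * c" by (rule nonneg)
  also have "\<dots> = - (s\<^sup>2 * (c + 2))" by (simp add: a algebra_simps power2_eq_square)
  finally have "s\<^sup>2 * (c + 2) \<le> 0" by simp
  moreover have "0 < s\<^sup>2 * (c + 2)" if "s \<noteq> 0" using that c by simp
  ultimately have "s = 0" by force
  then have "a = 0" using a by simp
  then show ?thesis by (simp add: a_def w_def)
qed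

text \<open>\<open>pos_part\<close> is a definite description, so uniqueness must be shown. On the
  range of \<open>P\<close> the form of \<open>R\<close> vanishes because \<open>P ** R = 0\<close>;
  there the form of \<open>P\<close> is minus that of \<open>Q\<close>, hence 0, and
  \<open>psd_null\<close> applies.\<close>

lemma pos_part_uminus_psd:
  assumes Q: "psd Q" shows "pos_part (- Q) = 0"
  unfolding pos_part_def
proof (rule the_equality)
  have "psd 0" by (simp add: psd_def symmetric_mat_def transpose_def vec_eq_iff)
  moreover have "0 ** Q = 0" by (simp add: matrix_matrix_mult_def vec_eq_iff)
  ultimately show "\<exists>R. psd 0 \<and> psd R \<and> - Q = 0 - R \<and> 0 ** R = 0" using Q by (intro exI[of _ Q]) simp
next
  fix P assume "\<exists>R. psd P \<and> psd R \<and> - Q = P - R \<and> P ** R = 0"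
  then obtain R where P: "psd P" and R: "psd R" and eq: "- Q = P - R" and PR: "P ** R = 0" by blast
  have "P *v y = 0" for y
  proof -
    define v where "v = P *v y"
    have "P *v v = R *v v - Q *v v"
    proof -
      have "(- Q) *v v = - (Q *v v)" by (simp add: matrix_vector_mult_def vec_eq_iff sum_negf)
      then show ?thesis
        using arg_cong[OF eq, of "\<lambda>A. A *v v"] by (simp add: matrix_vector_mult_diff_rdistrib algebra_simps)
    qed
    moreover have "v \<bullet> (R *v v) = 0"
      using P PR by (simp add: v_def psd_def symmetric_mat_inner[symmetric] matrix_vector_mul_assoc matrix_mul_assoc)
    ultimately have "v \<bullet> (P *v v) \<le> 0" using Q by (simp add: psd_def inner_diff_right)
    then have "v \<bullet> (P *v v) = 0" using P by (metis antisym psd_def)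
    then have "P *v v = 0" by (rule psd_null[OF P])
    then have "v \<bullet> v = 0" using P unfolding v_def psd_def by (metis inner_zero_right symmetric_mat_inner)
    then show ?thesis by (simp add: v_def)
  qed
  then show "P = 0" by (simp add: matrix_eq)
qed

text \<open>With the previous lemma, these are the only values of \<open>pos_part\<close> through
  which the condition on \<open>F\<close> enters: the former gives monotonicity, this one the
  Lipschitz bound along the identity. For \<open>v\<close> in the range of \<open>Q\<close>,
  \<open>P ** Q = 0\<close> leaves \<open>Q *v v = - (E *\<^sub>R v)\<close>, which forces
  \<open>v = 0\<close>.\<close>

lemma pos_part_scaled_identity:
  assumes "E \<ge> 0" shows "pos_part (E *\<^sub>R mat 1 :: real ^ 'n ^ 'n) = E *\<^sub>R mat 1"
  unfolding pos_part_def
proof (rule the_equality)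
  have mv: "(E *\<^sub>R mat 1 :: real ^ 'n ^ 'n) *v x = E *\<^sub>R x" for x
    by (metis matrix_vector_mul_lid scaleR_matrix_vector_assoc)
  have "psd (0 :: real ^ 'n ^ 'n)" by (simp add: psd_def symmetric_mat_def transpose_def vec_eq_iff)
  moreover have "psd (E *\<^sub>R mat 1 :: real ^ 'n ^ 'n)"
    using assms by (simp add: psd_def mv symmetric_intros)
  moreover have "(E *\<^sub>R mat 1 :: real ^ 'n ^ 'n) ** 0 = 0" by (simp add: matrix_matrix_mult_def vec_eq_iff)
  ultimately show "\<exists>Q. psd (E *\<^sub>R mat 1 :: real ^ 'n ^ 'n) \<and> psd Q \<and> E *\<^sub>R mat 1 = E *\<^sub>R mat 1 - Q \<and> (E *\<^sub>R mat 1 :: real ^ 'n ^ 'n) ** Q = 0"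
    by (intro exI[of _ 0]) simp
  fix P :: "real ^ 'n ^ 'n"
  assume "\<exists>Q. psd P \<and> psd Q \<and> E *\<^sub>R mat 1 = P - Q \<and> P ** Q = 0"
  then obtain Q where P: "psd P" and Q: "psd Q" and eq: "E *\<^sub>R mat 1 = P - Q" and PQ: "P ** Q = 0" by blast
  have "Q *v x = 0" for x
  proof -
    define v where "v = Q *v x"
    have "E *\<^sub>R v = P *v v - Q *v v"
      using arg_cong[OF eq, of "\<lambda>A. A *v v"] by (simp add: matrix_vector_mult_diff_rdistrib mv)
    moreover have "P *v v = 0" using PQ by (simp add: v_def matrix_vector_mul_assoc)
    ultimately have "Q *v v = - (E *\<^sub>R v)" by simp
    moreover have "v \<bullet> v = x \<bullet> (Q *v v)" using Q by (simp add: psd_def symmetric_mat_inner v_def)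
    ultimately have "v \<bullet> v = - (E * (x \<bullet> (Q *v x)))" by (simp add: v_def)
    moreover have "0 \<le> E * (x \<bullet> (Q *v x))" using assms Q by (simp add: psd_def)
    ultimately have "v \<bullet> v = 0" using inner_ge_zero[of v] by linarith
    then show ?thesis by (simp add: v_def)
  qed
  then have "Q = 0" by (simp add: matrix_eq)
  then show "P = E *\<^sub>R mat 1" using eq by simp
qed

lemma scaled_identity_mult: "(E *\<^sub>R mat 1 :: real ^ 'n ^ 'n) *v x = E *\<^sub>R x"
  by (metis matrix_vector_mul_lid scaleR_matrix_vector_assoc)

lemma elliptic_antimono:
  assumes F: "degenerate_elliptic_lipschitz CF F" and sym: "symmetric_mat M" "symmetric_mat N"
    and le: "\<And>x. x \<bullet> (M *v x) \<le> x \<bullet> (N *v x)"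
  shows "F N \<le> F M"
proof -
  have "psd (N - M)"
    using sym le by (simp add: psd_def symmetric_intros matrix_vector_mult_diff_rdistrib inner_diff_right)
  then have "pos_part (M - N) = 0" using pos_part_uminus_psd[of "N - M"] by simp
  moreover have "spectral_norm (0 :: real ^ 'a ^ 'a) = 0"
  proof -
    have "((*v) (0 :: real ^ 'a ^ 'a)) = (\<lambda>x. 0)" by (rule ext) simp
    then show ?thesis by (simp add: spectral_norm_def onorm_zero)
  qed
  ultimately show ?thesis
    using F sym unfolding degenerate_elliptic_lipschitz_def by (metis diff_le_0_iff_le mult_zero_right)
qed

lemma elliptic_shift:
  assumes F: "degenerate_elliptic_lipschitz CF F" "CF \<ge> 0" and sym: "symmetric_mat N" and E: "E \<ge> 0"
  shows "F (N - E *\<^sub>R mat 1) \<le> F N + CF * E"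
proof -
  have "F (N - E *\<^sub>R mat 1) - F N \<le> CF * spectral_norm (pos_part (N - (N - E *\<^sub>R mat 1)))"
    using F(1) sym symmetric_mat_diff[OF sym symmetric_mat_scaleR[OF symmetric_mat_1]]
    unfolding degenerate_elliptic_lipschitz_def by blast
  also have "N - (N - E *\<^sub>R mat 1) = E *\<^sub>R mat 1" by simp
  also have "pos_part (E *\<^sub>R mat 1 :: real ^ 'a ^ 'a) = E *\<^sub>R mat 1" by (rule pos_part_scaled_identity[OF E])
  also have "CF * spectral_norm (E *\<^sub>R mat 1 :: real ^ 'a ^ 'a) \<le> CF * E"
    unfolding spectral_norm_def
    by (intro mult_left_mono onorm_le F(2)) (simp add: scaled_identity_mult E)
  finally show ?thesis by simp
qed

section \<open>Test functions from second order expansions\<close>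

lemma quadratic_test_function:
  fixes X :: "real ^ 'n ^ 'n" and p x0 :: "real ^ 'n"
  assumes X: "symmetric_mat X"
  defines "\<phi> \<equiv> \<lambda>x. p \<bullet> (x - x0) + ((x - x0) \<bullet> (X *v (x - x0))) / 2"
  shows "gradient \<phi> = (\<lambda>x. p + X *v (x - x0))" and "hessian \<phi> = (\<lambda>x. X)" and "C2_on \<Omega> \<phi>"
proof -
  have bl: "bounded_linear ((*v) X)" by (simp add: matrix_vector_mul_bounded_linear)
  have dX: "((\<lambda>x. X *v (x - x0)) has_derivative ((*v) X)) (at x)" for x
  proof (rule bounded_linear.has_derivative[OF bl])
    show "((\<lambda>x. x - x0) has_derivative (\<lambda>h. h)) (at x)" by (auto intro!: derivative_eq_intros)
  qed
  have der: "(\<phi> has_derivative (\<lambda>h. (p + X *v (x - x0)) \<bullet> h)) (at x)" for x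
  proof -
    have "(\<phi> has_derivative (\<lambda>h. p \<bullet> h + ((x - x0) \<bullet> (X *v h) + h \<bullet> (X *v (x - x0))) / 2)) (at x)"
      unfolding \<phi>_def by (auto intro!: derivative_eq_intros dX)
    moreover have "p \<bullet> h + ((x - x0) \<bullet> (X *v h) + h \<bullet> (X *v (x - x0))) / 2 = (p + X *v (x - x0)) \<bullet> h" for h
      using symmetric_mat_inner[OF X, of "x - x0" h] by (simp add: inner_add_left inner_add_right inner_commute)
    ultimately show ?thesis by simp
  qed
  show grad: "gradient \<phi> = (\<lambda>x. p + X *v (x - x0))"
    unfolding gradient_def by (rule ext) (simp add: frechet_derivative_at[OF der, symmetric] inner_axis vec_eq_iff)
  have der2: "(gradient \<phi> has_derivative ((*v) X)) (at x)" for x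
    unfolding grad using dX by (auto intro!: derivative_eq_intros)
  show hess: "hessian \<phi> = (\<lambda>x. X)"
    unfolding hessian_def by (rule ext) (simp add: frechet_derivative_at[OF der2, symmetric] matrix_of_matrix_vector_mul)
  show "C2_on \<Omega> \<phi>"
    unfolding C2_on_def hess using der der2 by (auto intro: differentiableI)
qed

lemma scaled_identity_quadratic:
  "h \<bullet> ((X + c *\<^sub>R mat 1) *v h) = h \<bullet> (X *v h) + c * (norm h)\<^sup>2" for X :: "real ^ 'n ^ 'n"
  by (simp add: matrix_vector_mult_add_rdistrib scaled_identity_mult inner_add_right power2_norm_eq_inner)

text \<open>An expansion with error \<open>\<delta> |h|^2\<close> becomes a local maximum against a
  quadratic test function once \<open>2 * \<delta>\<close> times the identity is added to
  \<open>X\<close>; \<open>elliptic_shift\<close> bounds the price by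
  \<open>2 * CF * \<delta> = e\<close>.\<close>

lemma viscosity_subsolution_expansion:
  fixes X :: "real ^ 'n ^ 'n"
  assumes sub: "viscosity_subsolution \<Omega> F H f u" and x: "x \<in> \<Omega>"
    and F: "degenerate_elliptic_lipschitz CF F" "CF > 0" and X: "symmetric_mat X"
    and ex: "\<And>\<delta>. \<delta> > 0 \<Longrightarrow> \<exists>d>0. \<forall>h. norm h < d \<longrightarrow> u (x + h) \<le> u x + p \<bullet> h + (h \<bullet> (X *v h)) / 2 + \<delta> * (norm h)\<^sup>2"
  shows "F X + H p x \<le> f x"
proof (rule field_le_epsilon)
  fix e :: real assume e: "e > 0"
  define \<delta> where "\<delta> = e / (2 * CF)"
  have \<delta>: "\<delta> > 0" using e F by (simp add: \<delta>_def)
  define X' where "X' = X + (2 * \<delta>) *\<^sub>R mat 1"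
  define \<phi> where "\<phi> = (\<lambda>z. p \<bullet> (z - x) + ((z - x) \<bullet> (X' *v (z - x))) / 2)"
  have X': "symmetric_mat X'" using X by (simp add: X'_def symmetric_intros)
  note q = quadratic_test_function[where p = p and ?x0.0 = x, OF X', folded \<phi>_def]
  obtain d where d: "d > 0" "\<And>h. norm h < d \<Longrightarrow> u (x + h) \<le> u x + p \<bullet> h + (h \<bullet> (X *v h)) / 2 + \<delta> * (norm h)\<^sup>2"
    using ex[OF \<delta>] by auto
  have "u y - \<phi> y \<le> u x - \<phi> x" if "dist y x < d" for y
    using d(2)[of "y - x"] that
    by (simp add: \<phi>_def X'_def scaled_identity_quadratic dist_norm add_divide_distrib)
  then have "local_max_at \<Omega> (\<lambda>z. u z - \<phi> z) x"
    unfolding local_max_at_def eventually_at using d(1) by blast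
  then have "F (hessian \<phi> x) + H (gradient \<phi> x) x \<le> f x"
    using sub x q(3)[of \<Omega>] unfolding viscosity_subsolution_def by blast
  then have "F X' + H p x \<le> f x" by (simp add: q)
  moreover have "F X \<le> F X' + e"
    using elliptic_shift[OF F(1) _ X', of "2 * \<delta>"] F(2) \<delta> by (simp add: X'_def \<delta>_def)
  ultimately show "F X + H p x \<le> f x + e" by simp
qed

lemma viscosity_supersolution_expansion:
  fixes X :: "real ^ 'n ^ 'n"
  assumes super: "viscosity_supersolution \<Omega> F H f u" and x: "x \<in> \<Omega>"
    and F: "degenerate_elliptic_lipschitz CF F" "CF > 0" and X: "symmetric_mat X"
    and ex: "\<And>\<delta>. \<delta> > 0 \<Longrightarrow> \<exists>d>0. \<forall>h. norm h < d \<longrightarrow> u x + p \<bullet> h + (h \<bullet> (X *v h)) / 2 - \<delta> * (norm h)\<^sup>2 \<le> u (x + h)"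
  shows "f x \<le> F X + H p x"
proof (rule field_le_epsilon)
  fix e :: real assume e: "e > 0"
  define \<delta> where "\<delta> = e / (2 * CF)"
  have \<delta>: "\<delta> > 0" using e F by (simp add: \<delta>_def)
  define X' where "X' = X + (- 2 * \<delta>) *\<^sub>R mat 1"
  define \<phi> where "\<phi> = (\<lambda>z. p \<bullet> (z - x) + ((z - x) \<bullet> (X' *v (z - x))) / 2)"
  have X': "symmetric_mat X'" unfolding X'_def by (intro symmetric_intros X)
  note q = quadratic_test_function[where p = p and ?x0.0 = x, OF X', folded \<phi>_def]
  obtain d where d: "d > 0" "\<And>h. norm h < d \<Longrightarrow> u x + p \<bullet> h + (h \<bullet> (X *v h)) / 2 - \<delta> * (norm h)\<^sup>2 \<le> u (x + h)"
    using ex[OF \<delta>] by auto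
  have "u x - \<phi> x \<le> u y - \<phi> y" if "dist y x < d" for y
    using d(2)[of "y - x"] that
    unfolding \<phi>_def X'_def scaled_identity_quadratic by (simp add: dist_norm add_divide_distrib diff_divide_distrib)
  then have "local_min_at \<Omega> (\<lambda>z. u z - \<phi> z) x"
    unfolding local_min_at_def eventually_at using d(1) by blast
  then have "F (hessian \<phi> x) + H (gradient \<phi> x) x \<ge> f x"
    using super x q(3)[of \<Omega>] unfolding viscosity_supersolution_def by blast
  then have "f x \<le> F X' + H p x" by (simp add: q)
  moreover have "F X' \<le> F X + e"
    using elliptic_shift[OF F(1) _ X, of "2 * \<delta>"] F(2) \<delta> by (simp add: X'_def \<delta>_def)
  ultimately show "f x \<le> F X + H p x + e" by simp
qed

text \<open>The linear maps from \<open>doubling_quadratic_expansions\<close> are not known to be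
  symmetric. Only their quadratic forms enter, so the symmetric part serves as Hessian.\<close>

lemma symmetrized_matrix:
  fixes A :: "real ^ 'n \<Rightarrow> real ^ 'n"
  assumes "linear A"
  obtains X where "symmetric_mat X" "\<And>h. h \<bullet> (X *v h) = h \<bullet> A h"
proof
  define X where "X = (1/2) *\<^sub>R (matrix A + transpose (matrix A))"
  show "symmetric_mat X" by (simp add: X_def symmetric_mat_def transpose_def vec_eq_iff)
  show "h \<bullet> (X *v h) = h \<bullet> A h" for h
  proof -
    have "h \<bullet> (transpose (matrix A) *v h) = h \<bullet> (matrix A *v h)"
      by (simp add: transpose_matrix_vector dot_lmul_matrix inner_commute[of h "h v* _"])
    then show ?thesis
      using assms by (simp add: X_def matrix_works matrix_vector_mult_add_rdistrib inner_add_right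
          flip: scaleR_matrix_vector_assoc)
  qed
qed

section \<open>Comparison of the equations at a doubled maximum\<close>

lemma hamiltonian_locally_lipschitz:
  assumes H: "hamiltonian_conditions \<Omega> m C1 C2 C3 H" and m: "m > 1" and C: "C1 > 0" "C3 > 0" and x0: "x0 \<in> \<Omega>"
  obtains c where "c \<ge> 0" "\<And>p x. x \<in> \<Omega> \<Longrightarrow> norm (p - l) \<le> 1 \<Longrightarrow> \<bar>H p x - H l x0\<bar> \<le> c * (norm (p - l) + norm (x - x0))"
proof -
  define c1 where "c1 = C3 * (2 * norm l + 2) powr (m - 1)"
  define c2 where "c2 = C3 * norm l powr m + C1"
  have c: "c1 \<ge> 0" "c2 \<ge> 0" using C by (auto simp: c1_def c2_def)
  have "\<bar>H p x - H l x0\<bar> \<le> (c1 + c2) * (norm (p - l) + norm (x - x0))" if x: "x \<in> \<Omega>" and p: "norm (p - l) \<le> 1" for p x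
  proof -
    have "norm p \<le> norm l + 1" using norm_triangle_ineq2[of p l] p by linarith
    then have "(norm p + norm l + 1) powr (m - 1) \<le> (2 * norm l + 2) powr (m - 1)"
      using m by (intro powr_mono2) auto
    then have "C3 * (norm p + norm l + 1) powr (m - 1) * norm (p - l) \<le> c1 * norm (p - l)"
      unfolding c1_def using C by (intro mult_right_mono mult_left_mono) auto
    moreover have "\<bar>H p x - H l x\<bar> \<le> C3 * (norm p + norm l + 1) powr (m - 1) * norm (p - l)"
      using H x unfolding hamiltonian_conditions_def by blast
    moreover have "\<bar>H l x - H l x0\<bar> \<le> c2 * norm (x - x0)"
      using H x x0 unfolding hamiltonian_conditions_def c2_def by blast
    moreover have "c1 * norm (p - l) + c2 * norm (x - x0) \<le> (c1 + c2) * (norm (p - l) + norm (x - x0))"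
      using c by (simp add: algebra_simps)
    ultimately show ?thesis by linarith
  qed
  then show thesis using that[of "c1 + c2"] c by auto
qed

text \<open>Read as quadratic forms, the test vectors give \<open>s^2 X - E \<le> Y\<close>;
  ellipticity reverses the order and homogeneity takes \<open>s^2\<close> out of \<open>F\<close>.
  The equations hold only near \<open>x0\<close> and \<open>y0\<close>, but neither \<open>T\<close>
  nor \<open>E\<close> depends on the precision \<open>\<epsilon>\<close>, which can be sent to
  0.\<close>

lemma doubling_viscosity_inequality:
  fixes u f :: "real ^ 'n \<Rightarrow> real" and T :: "(real ^ 'n) \<times> (real ^ 'n) \<Rightarrow> (real ^ 'n) \<times> (real ^ 'n)"
  assumes F: "degenerate_elliptic_lipschitz CF F" "CF > 0" "positively_homogeneous F"
    and sol: "viscosity_solution \<Omega> F H f u" and f: "L-lipschitz_on \<Omega> f"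
    and H: "hamiltonian_conditions \<Omega> m C1 C2 C3 H" "m > 1" "C1 > 0" "C3 > 0"
    and r: "r > 0" "cball x0 r \<subseteq> \<Omega>" "cball y0 r \<subseteq> \<Omega>"
    and T: "linear T" "\<And>z w. z \<bullet> T w = T z \<bullet> w" and \<kappa>: "\<kappa> > 0"
    and upper: "\<And>x y. x \<in> cball x0 r \<Longrightarrow> y \<in> cball y0 r \<Longrightarrow>
       u x - u y \<le> u x0 - u y0 + l \<bullet> ((x, y) - (x0, y0)) + (((x, y) - (x0, y0)) \<bullet> T ((x, y) - (x0, y0))) / 2
          - \<kappa> * (norm ((x, y) - (x0, y0)))\<^sup>2"
    and E: "E \<ge> 0" "\<And>\<eta>. (s *\<^sub>R \<eta>, \<eta>) \<bullet> T (s *\<^sub>R \<eta>, \<eta>) \<le> E * (norm \<eta>)\<^sup>2"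
  shows "s\<^sup>2 * H (fst l) x0 - H (- snd l) y0 \<le> s\<^sup>2 * f x0 - f y0 + CF * E"
proof (rule field_le_epsilon)
  fix e0 :: real assume e0: "e0 > 0"
  have x0: "x0 \<in> \<Omega>" and y0: "y0 \<in> \<Omega>" using r by (auto simp: subset_iff)
  obtain c1 where c1: "c1 \<ge> 0" "\<And>p x. x \<in> \<Omega> \<Longrightarrow> norm (p - fst l) \<le> 1 \<Longrightarrow> \<bar>H p x - H (fst l) x0\<bar> \<le> c1 * (norm (p - fst l) + norm (x - x0))"
    by (rule hamiltonian_locally_lipschitz[OF H x0, of "fst l"]) (erule that, assumption)
  obtain c2 where c2: "c2 \<ge> 0" "\<And>p x. x \<in> \<Omega> \<Longrightarrow> norm (p - - snd l) \<le> 1 \<Longrightarrow> \<bar>H p x - H (- snd l) y0\<bar> \<le> c2 * (norm (p - - snd l) + norm (x - y0))"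
    by (rule hamiltonian_locally_lipschitz[OF H y0, of "- snd l"]) (erule that, assumption)
  have L: "L \<ge> 0" "\<And>x y. x \<in> \<Omega> \<Longrightarrow> y \<in> \<Omega> \<Longrightarrow> \<bar>f x - f y\<bar> \<le> L * norm (x - y)"
    using lipschitz_on_nonneg[OF f] lipschitz_onD[OF f] by (auto simp: dist_norm)
  \<comment> \<open>Collects the Lipschitz constants of all terms that are moved by at most
    \<open>\<epsilon>\<close>; the factors 2 arise because \<open>H\<close> is moved in the gradient
    and in the point.\<close>
  define c where "c = s\<^sup>2 * (2 * c1 + L) + 2 * c2 + L + 1"
  have c: "c > 0" using c1(1) c2(1) L(1) by (simp add: c_def add_nonneg_pos)
  define \<epsilon> where "\<epsilon> = min (min 1 (r / 2)) (e0 / c)"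
  have \<epsilon>: "\<epsilon> > 0" "\<epsilon> \<le> 1" "\<epsilon> \<le> r / 2" "\<epsilon> \<le> e0 / c"
  proof -
    show "\<epsilon> > 0" using r e0 c by (simp add: \<epsilon>_def)
    show "\<epsilon> \<le> 1" unfolding \<epsilon>_def by (rule min.coboundedI1, rule min.cobounded1)
    show "\<epsilon> \<le> r / 2" unfolding \<epsilon>_def by (rule min.coboundedI1, rule min.cobounded2)
    show "\<epsilon> \<le> e0 / c" unfolding \<epsilon>_def by (rule min.cobounded2)
  qed
  have ce: "c * \<epsilon> \<le> e0" using \<epsilon>(4) c by (simp add: pos_le_divide_eq mult.commute)
  have cu: "continuous_on (cball x0 r) u" "continuous_on (cball y0 r) (\<lambda>y. - u y)"
    using sol r unfolding viscosity_solution_def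
    by (auto intro: continuous_on_subset intro!: continuous_on_minus)
  have upper': "u x + - u y \<le> u x0 + - u y0 + l \<bullet> ((x, y) - (x0, y0)) + (((x, y) - (x0, y0)) \<bullet> T ((x, y) - (x0, y0))) / 2
          - \<kappa> * (norm ((x, y) - (x0, y0)))\<^sup>2" if "x \<in> cball x0 r" "y \<in> cball y0 r" for x y
    using upper[OF that] by linarith
  obtain x y p1 p2 A1 A2 where near: "norm (x - x0) < \<epsilon>" "norm (y - y0) < \<epsilon>" "norm (p1 - fst l) < \<epsilon>" "norm (p2 - snd l) < \<epsilon>"
    and A: "linear A1" "linear A2"
    and ex1: "\<And>\<delta>. \<delta> > 0 \<Longrightarrow> \<exists>d>0. \<forall>h. norm h < d \<longrightarrow> x + h \<in> cball x0 r \<longrightarrow> u (x + h) \<le> u x + p1 \<bullet> h + (h \<bullet> A1 h) / 2 + \<delta> * (norm h)\<^sup>2"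
    and ex2: "\<And>\<delta>. \<delta> > 0 \<Longrightarrow> \<exists>d>0. \<forall>h. norm h < d \<longrightarrow> y + h \<in> cball y0 r \<longrightarrow> - u (y + h) \<le> - u y + p2 \<bullet> h + (h \<bullet> A2 h) / 2 + \<delta> * (norm h)\<^sup>2"
    and le: "\<And>\<xi> \<eta>. \<xi> \<bullet> A1 \<xi> + \<eta> \<bullet> A2 \<eta> \<le> (\<xi>, \<eta>) \<bullet> T (\<xi>, \<eta>)"
    by (rule doubling_quadratic_expansions[OF r(1) cu T \<kappa> upper' \<epsilon>(1)]) (assumption | rule that)+
  have xball: "z + h \<in> cball z0 r" if "norm (z - z0) < \<epsilon>" "norm h < r / 2" for z z0 h :: "real ^ 'n"
    using norm_triangle_ineq[of "z - z0" h] that \<epsilon>(3) by (simp add: dist_norm norm_minus_commute algebra_simps)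
  have x: "x \<in> \<Omega>" and y: "y \<in> \<Omega>"
    using xball[OF near(1), of 0] xball[OF near(2), of 0] r by (auto simp: subset_iff)
  obtain X where X: "symmetric_mat X" "\<And>h. h \<bullet> (X *v h) = h \<bullet> A1 h" by (rule symmetrized_matrix[OF A(1)]) blast
  have "linear (\<lambda>h. - A2 h)" using A(2) by (rule linear_compose_neg)
  then obtain Y where Y: "symmetric_mat Y" "\<And>h. h \<bullet> (Y *v h) = h \<bullet> - A2 h" by (rule symmetrized_matrix) blast
  have sub: "F X + H p1 x \<le> f x"
  proof (rule viscosity_subsolution_expansion[OF _ x F(1,2) X(1)])
    show "viscosity_subsolution \<Omega> F H f u" using sol by (simp add: viscosity_solution_def)
    fix \<delta> :: real assume "\<delta> > 0"
    then obtain d where d: "d > 0" "\<And>h. norm h < d \<Longrightarrow> x + h \<in> cball x0 r \<Longrightarrow> u (x + h) \<le> u x + p1 \<bullet> h + (h \<bullet> A1 h) / 2 + \<delta> * (norm h)\<^sup>2"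
      using ex1 by meson
    show "\<exists>d>0. \<forall>h. norm h < d \<longrightarrow> u (x + h) \<le> u x + p1 \<bullet> h + (h \<bullet> (X *v h)) / 2 + \<delta> * (norm h)\<^sup>2"
      using d r xball[OF near(1)] by (intro exI[of _ "min d (r / 2)"]) (auto simp: X(2))
  qed
  have super: "f y \<le> F Y + H (- p2) y"
  proof (rule viscosity_supersolution_expansion[OF _ y F(1,2) Y(1)])
    show "viscosity_supersolution \<Omega> F H f u" using sol by (simp add: viscosity_solution_def)
    fix \<delta> :: real assume "\<delta> > 0"
    then obtain d where d: "d > 0" "\<And>h. norm h < d \<Longrightarrow> y + h \<in> cball y0 r \<Longrightarrow> - u (y + h) \<le> - u y + p2 \<bullet> h + (h \<bullet> A2 h) / 2 + \<delta> * (norm h)\<^sup>2"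
      using ex2 by meson
    have "u y + - p2 \<bullet> h + (h \<bullet> (Y *v h)) / 2 - \<delta> * (norm h)\<^sup>2 \<le> u (y + h)" if h: "norm h < min d (r / 2)" for h
      using d(2)[of h] xball[OF near(2), of h] h by (simp add: Y(2))
    then show "\<exists>d>0. \<forall>h. norm h < d \<longrightarrow> u y + - p2 \<bullet> h + (h \<bullet> (Y *v h)) / 2 - \<delta> * (norm h)\<^sup>2 \<le> u (y + h)"
      using d(1) r by (intro exI[of _ "min d (r / 2)"]) auto
  qed
  have "F Y \<le> s\<^sup>2 * F X + CF * E"
  proof -
    have sX: "symmetric_mat (s\<^sup>2 *\<^sub>R X)" using X by (intro symmetric_intros)
    have "F Y \<le> F (s\<^sup>2 *\<^sub>R X - E *\<^sub>R mat 1)"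
    proof (rule elliptic_antimono[OF F(1) _ Y(1)])
      show "symmetric_mat (s\<^sup>2 *\<^sub>R X - E *\<^sub>R mat 1)" by (rule symmetric_mat_diff[OF sX symmetric_mat_scaleR[OF symmetric_mat_1]])
      fix \<eta>
      have "(s *\<^sub>R \<eta>) \<bullet> A1 (s *\<^sub>R \<eta>) = s\<^sup>2 * (\<eta> \<bullet> A1 \<eta>)"
        by (simp add: linear_scale[OF A(1)] power2_eq_square)
      then have "s\<^sup>2 * (\<eta> \<bullet> A1 \<eta>) + \<eta> \<bullet> A2 \<eta> \<le> E * (norm \<eta>)\<^sup>2"
        using le[of "s *\<^sub>R \<eta>" \<eta>] E(2)[of \<eta>] by linarith
      moreover have "\<eta> \<bullet> ((s\<^sup>2 *\<^sub>R X - E *\<^sub>R mat 1) *v \<eta>) = s\<^sup>2 * (\<eta> \<bullet> A1 \<eta>) - E * (norm \<eta>)\<^sup>2"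
        by (simp add: matrix_vector_mult_diff_rdistrib scaled_identity_mult inner_diff_right X(2) power2_norm_eq_inner
            flip: scaleR_matrix_vector_assoc)
      ultimately show "\<eta> \<bullet> ((s\<^sup>2 *\<^sub>R X - E *\<^sub>R mat 1) *v \<eta>) \<le> \<eta> \<bullet> (Y *v \<eta>)"
        by (simp add: Y(2))
    qed
    also have "\<dots> \<le> F (s\<^sup>2 *\<^sub>R X) + CF * E"
      using elliptic_shift[OF F(1) less_imp_le[OF F(2)] sX E(1)] .
    also have "F (s\<^sup>2 *\<^sub>R X) = s\<^sup>2 * F X" using F(3) X(1) unfolding positively_homogeneous_def by simp
    finally show ?thesis .
  qed
  moreover have "s\<^sup>2 * (F X + H p1 x) \<le> s\<^sup>2 * f x" using sub by (intro mult_left_mono) auto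
  ultimately have main: "s\<^sup>2 * H p1 x - H (- p2) y \<le> s\<^sup>2 * f x - f y + CF * E"
    using super by (simp add: distrib_left)
  have b1: "\<bar>H p1 x - H (fst l) x0\<bar> \<le> c1 * (2 * \<epsilon>)"
    using c1(2)[OF x, of p1] near \<epsilon>(2) mult_left_mono[OF _ c1(1), of "norm (p1 - fst l) + norm (x - x0)" "2 * \<epsilon>"] by linarith
  have nl: "norm (- p2 - - snd l) = norm (p2 - snd l)" by (simp add: norm_minus_commute)
  have b2: "\<bar>H (- p2) y - H (- snd l) y0\<bar> \<le> c2 * (2 * \<epsilon>)"
    using c2(2)[OF y, of "- p2"] near \<epsilon>(2) mult_left_mono[OF _ c2(1), of "norm (p2 - snd l) + norm (y - y0)" "2 * \<epsilon>"]
    unfolding nl by linarith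
  have b3: "\<bar>f x - f x0\<bar> \<le> L * \<epsilon>"
    using L(2)[OF x x0] mult_left_mono[OF less_imp_le[OF near(1)] L(1)] by linarith
  have b4: "\<bar>f y - f y0\<bar> \<le> L * \<epsilon>"
    using L(2)[OF y y0] mult_left_mono[OF less_imp_le[OF near(2)] L(1)] by linarith
  have "s\<^sup>2 * H (fst l) x0 \<le> s\<^sup>2 * (H p1 x + c1 * (2 * \<epsilon>))" using b1 by (intro mult_left_mono) auto
  moreover have "s\<^sup>2 * f x \<le> s\<^sup>2 * (f x0 + L * \<epsilon>)" using b3 by (intro mult_left_mono) auto
  moreover have "c * \<epsilon> = s\<^sup>2 * (c1 * (2 * \<epsilon>)) + s\<^sup>2 * (L * \<epsilon>) + c2 * (2 * \<epsilon>) + L * \<epsilon> + \<epsilon>"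
    by (simp add: c_def algebra_simps)
  ultimately show "s\<^sup>2 * H (fst l) x0 - H (- snd l) y0 \<le> s\<^sup>2 * f x0 - f y0 + CF * E + e0"
    using main b2 b4 ce \<epsilon>(1) unfolding distrib_left by linarith
qed

section \<open>The Lipschitz estimate\<close>

text \<open>The linear term must be exact, since it becomes the gradient of the weight. Each
  induction step multiplies by \<open>1 / (1 - t) \<le> 1 + t + 2 t^2\<close> and absorbs cubic and
  quartic terms into the quadratic one.\<close>

lemma inverse_power_quadratic_bound:
  "\<exists>C\<ge>0. \<forall>t::real. \<bar>t\<bar> \<le> 1 / 2 \<longrightarrow> 1 / (1 - t) ^ k \<le> 1 + real k * t + C * t\<^sup>2"
proof (induction k)
  case 0 then show ?case by (intro exI[of _ 0]) auto
next
  case (Suc k)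
  then obtain C where C: "C \<ge> 0" "\<And>t::real. \<bar>t\<bar> \<le> 1 / 2 \<Longrightarrow> 1 / (1 - t) ^ k \<le> 1 + real k * t + C * t\<^sup>2" by auto
  have "1 / (1 - t) ^ Suc k \<le> 1 + real (Suc k) * t + (4 * C + 3 * real k + 2) * t\<^sup>2" if t: "\<bar>t\<bar> \<le> 1 / 2" for t :: real
  proof -
    have pos: "1 - t > 0" using t by linarith
    have "0 \<le> t\<^sup>2 * (1 - 2 * t)" using t by (intro mult_nonneg_nonneg) auto
    then have "1 \<le> (1 + t + 2 * t\<^sup>2) * (1 - t)" by (simp add: algebra_simps power2_eq_square)
    then have B: "1 / (1 - t) \<le> 1 + t + 2 * t\<^sup>2" using pos by (simp add: pos_divide_le_eq)
    have A: "1 / (1 - t) ^ k \<le> 1 + real k * t + C * t\<^sup>2" "0 \<le> 1 / (1 - t) ^ k" using C(2)[OF t] pos by auto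
    have "1 / (1 - t) ^ Suc k = (1 / (1 - t) ^ k) * (1 / (1 - t))" by simp
    also have "\<dots> \<le> (1 + real k * t + C * t\<^sup>2) * (1 + t + 2 * t\<^sup>2)"
      by (intro mult_mono A(1) B order_trans[OF A(2) A(1)]) (use pos in simp)
    also have "\<dots> = 1 + real (Suc k) * t + (C + real k + 2) * t\<^sup>2 + (C + 2 * real k) * (t * t\<^sup>2) + 2 * C * (t\<^sup>2 * t\<^sup>2)"
      by (simp add: algebra_simps power2_eq_square)
    also have "\<dots> \<le> 1 + real (Suc k) * t + (C + real k + 2) * t\<^sup>2 + (C + 2 * real k) * (1 * t\<^sup>2) + 2 * C * (1 * t\<^sup>2)"
    proof -
      have "t\<^sup>2 \<le> 1\<^sup>2" using t by (intro abs_le_square_iff[THEN iffD1]) simp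
      then show ?thesis using t C(1) by (intro add_mono mult_left_mono mult_right_mono order_refl) auto
    qed
    also have "\<dots> = 1 + real (Suc k) * t + (4 * C + 3 * real k + 2) * t\<^sup>2" by (simp add: algebra_simps)
    finally show ?thesis .
  qed
  then show ?case using C(1) by (intro exI[of _ "4 * C + 3 * real k + 2"]) auto
qed

text \<open>\<open>D\<close> drops by the relative amount \<open>\<tau>\<close>, and
  \<open>inverse_power_quadratic_bound\<close> applies at \<open>t = \<tau>\<close>. The weight
  varies on the length scale \<open>R * D xb\<close>: a third of it keeps
  \<open>\<bar>\<tau>\<bar>\<close> at most \<open>1/2\<close>, and each order of the expansion
  costs a factor \<open>1 / (R * D xb)\<close>.\<close>

lemma cutoff_upper_bound:
  fixes x0 xb \<xi> :: "'a::real_inner"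
  assumes C: "C \<ge> 0" "\<And>t::real. \<bar>t\<bar> \<le> 1 / 2 \<Longrightarrow> 1 / (1 - t) ^ k \<le> 1 + real k * t + C * t\<^sup>2"
    and R: "R > 0" and D: "D = (\<lambda>x. (1 + \<delta> - (norm (x - x0))\<^sup>2 / R\<^sup>2) / 2)"
    and Db: "0 < D xb" "D xb \<le> 1" and xb: "norm (xb - x0) \<le> R" and \<xi>: "norm \<xi> \<le> R * D xb / 3"
  shows "0 < D (xb + \<xi>)"
    "1 / D (xb + \<xi>) ^ k \<le> 1 / D xb ^ k * (1 + ((real k / (R\<^sup>2 * D xb)) *\<^sub>R (xb - x0)) \<bullet> \<xi> + (real k + 3 * C) / (R\<^sup>2 * (D xb)\<^sup>2) * (norm \<xi>)\<^sup>2)"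
proof -
  define A where "A = D xb"
  define n where "n = norm \<xi>"
  define i where "i = (xb - x0) \<bullet> \<xi>"
  have A: "0 < A" "A \<le> 1" using Db by (auto simp: A_def)
  define \<tau> where "\<tau> = (i / R\<^sup>2 + n\<^sup>2 / (2 * R\<^sup>2)) / A"
  define v where "v = n / (R * A)"
  have n: "0 \<le> n" "n \<le> R * A / 3" using \<xi> by (auto simp: n_def A_def)
  have v: "0 \<le> v" "v \<le> 1 / 3" using n R A by (auto simp: v_def field_simps)
  have nv: "n = v * (R * A)" using R A by (simp add: v_def)
  have nR: "n \<le> R"
  proof -
    have "R * A \<le> R * 1" using R A by (intro mult_left_mono) auto
    then show ?thesis using n R by linarith
  qed
  have "(norm (xb + \<xi> - x0))\<^sup>2 = (norm (xb - x0))\<^sup>2 + 2 * i + n\<^sup>2"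
  proof -
    have "xb + \<xi> - x0 = (xb - x0) + \<xi>" by simp
    then show ?thesis
      by (simp only: power2_norm_eq_inner i_def n_def) (simp add: inner_add_left inner_add_right inner_commute)
  qed
  then have "(norm (xb + \<xi> - x0))\<^sup>2 / R\<^sup>2 = (norm (xb - x0))\<^sup>2 / R\<^sup>2 + 2 * (i / R\<^sup>2) + 2 * (n\<^sup>2 / (2 * R\<^sup>2))"
    by (simp add: add_divide_distrib)
  then have "D (xb + \<xi>) = D xb - (i / R\<^sup>2 + n\<^sup>2 / (2 * R\<^sup>2))"
    unfolding D by argo
  then have D1: "D (xb + \<xi>) = A * (1 - \<tau>)" using A by (simp add: \<tau>_def A_def right_diff_distrib)
  have \<tau>: "\<bar>\<tau>\<bar> \<le> 3 / 2 * v"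
  proof -
    have "\<bar>i\<bar> \<le> R * n"
      using Cauchy_Schwarz_ineq2[of "xb - x0" \<xi>] mult_right_mono[OF xb, of n] by (simp add: i_def n_def)
    moreover have "n\<^sup>2 \<le> R * n" using nR n by (simp add: power2_eq_square mult_right_mono)
    ultimately have "\<bar>i + n\<^sup>2 / 2\<bar> \<le> 3 / 2 * (R * n)" using zero_le_power2[of n] by linarith
    then have t1: "\<bar>i + n\<^sup>2 / 2\<bar> / (R\<^sup>2 * A) \<le> 3 / 2 * (R * n) / (R\<^sup>2 * A)" using A by (intro divide_right_mono) auto
    have t2: "\<tau> = (i + n\<^sup>2 / 2) / (R\<^sup>2 * A)" using R A by (simp add: \<tau>_def field_simps)
    have t3: "3 / 2 * (R * n) / (R\<^sup>2 * A) = 3 / 2 * v" using R A by (simp add: v_def power2_eq_square)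
    have t4: "\<bar>(i + n\<^sup>2 / 2) / (R\<^sup>2 * A)\<bar> = \<bar>i + n\<^sup>2 / 2\<bar> / (R\<^sup>2 * A)" using A by (simp add: abs_mult)
    have "\<bar>\<tau>\<bar> \<le> 3 / 2 * (R * n) / (R\<^sup>2 * A)" using t1 by (simp only: t2 t4)
    then show ?thesis by (simp only: t3)
  qed
  then have \<tau>2: "\<bar>\<tau>\<bar> \<le> 1 / 2" using v by linarith
  then show "0 < D (xb + \<xi>)" using A unfolding D1 by (intro mult_pos_pos) auto
  have "\<tau>\<^sup>2 \<le> (3 / 2 * v)\<^sup>2" using \<tau> v by (intro abs_le_square_iff[THEN iffD1]) simp
  also have "\<dots> \<le> 3 * v\<^sup>2" by (simp add: power2_eq_square)
  finally have 1: "C * \<tau>\<^sup>2 \<le> C * (3 * v\<^sup>2)" using C by (intro mult_left_mono) auto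
  have 2: "real k * \<tau> \<le> (real k / (R\<^sup>2 * A)) * i + real k * v\<^sup>2"
  proof -
    have "\<tau> = i / (R\<^sup>2 * A) + v\<^sup>2 * (A / 2)"
      using R A by (simp add: \<tau>_def nv power_mult_distrib add_divide_distrib power2_eq_square)
    moreover have "v\<^sup>2 * (A / 2) \<le> v\<^sup>2 * 1" using A by (intro mult_left_mono) auto
    ultimately have "\<tau> \<le> i / (R\<^sup>2 * A) + v\<^sup>2" by simp
    then have "real k * \<tau> \<le> real k * (i / (R\<^sup>2 * A) + v\<^sup>2)" by (intro mult_left_mono) auto
    then show ?thesis by (simp add: distrib_left)
  qed
  have "1 / D (xb + \<xi>) ^ k = 1 / A ^ k * (1 / (1 - \<tau>) ^ k)" by (simp add: D1 power_mult_distrib)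
  also have "\<dots> \<le> 1 / A ^ k * (1 + (real k / (R\<^sup>2 * A)) * i + (real k + 3 * C) * v\<^sup>2)"
    using C(2)[OF \<tau>2] 1 2 A by (intro mult_left_mono) (auto simp: algebra_simps)
  also have "(real k + 3 * C) * v\<^sup>2 = (real k + 3 * C) / (R\<^sup>2 * A\<^sup>2) * n\<^sup>2"
    by (simp add: v_def power_divide power_mult_distrib)
  finally show "1 / D (xb + \<xi>) ^ k \<le> 1 / D xb ^ k * (1 + ((real k / (R\<^sup>2 * D xb)) *\<^sub>R (xb - x0)) \<bullet> \<xi>
      + (real k + 3 * C) / (R\<^sup>2 * (D xb)\<^sup>2) * (norm \<xi>)\<^sup>2)"
    by (simp add: A_def n_def i_def)
qed

text \<open>Linearising the square root gives
  \<open>|z + d| \<le> \<rho> + e \<bullet> d + |d|^2 / (2 \<rho>)\<close>, without the negative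
  second order part along \<open>e\<close>. After multiplication with the bound for
  \<open>g\<close>, the terms of order three and higher carry a factor \<open>r\<close> and form the
  last summand.\<close>

lemma weighted_distance_bound:
  fixes z b \<xi> \<eta> :: "'a::real_inner"
  assumes z: "z \<noteq> 0" and \<rho>: "\<rho> = norm z" and e: "e = (1 / \<rho>) *\<^sub>R z"
    and g: "0 \<le> g" "g \<le> 1 + b \<bullet> \<xi> + c * (norm \<xi>)\<^sup>2" and b: "norm b \<le> \<beta>" and c: "0 \<le> c"
    and r: "norm \<xi> \<le> r" "norm \<eta> \<le> r"
  shows "g * norm (z + \<xi> - \<eta>) \<le> \<rho> + (e \<bullet> (\<xi> - \<eta>) + \<rho> * (b \<bullet> \<xi>))
     + ((norm (\<xi> - \<eta>))\<^sup>2 / (2 * \<rho>) + (b \<bullet> \<xi>) * (e \<bullet> (\<xi> - \<eta>)) + c * \<rho> * (norm \<xi>)\<^sup>2)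
     + (\<beta> * r / \<rho> + 2 * c * r + c * r\<^sup>2 / \<rho>) * ((norm \<xi>)\<^sup>2 + (norm \<eta>)\<^sup>2)"
proof -
  have \<rho>0: "\<rho> > 0" using z \<rho> by simp
  have r0: "r \<ge> 0" using r norm_ge_zero order_trans by blast
  have \<beta>0: "\<beta> \<ge> 0" using b norm_ge_zero order_trans by blast
  define d where "d = \<xi> - \<eta>"
  define i where "i = e \<bullet> d"
  define w where "w = (norm d)\<^sup>2 / (2 * \<rho>)"
  define B where "B = b \<bullet> \<xi>"
  define X where "X = (norm \<xi>)\<^sup>2"
  define q where "q = X + (norm \<eta>)\<^sup>2"
  have pos: "0 \<le> X" "X \<le> q" "0 \<le> w" using \<rho>0 by (auto simp: X_def q_def w_def)
  have ne: "norm e = 1" using \<rho>0 by (simp add: e \<rho>)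
  have S: "norm (z + d) \<le> \<rho> + i + w"
  proof -
    have "\<rho> * i = z \<bullet> d" using z by (simp add: i_def e \<rho>)
    then have "(norm (z + d))\<^sup>2 = \<rho>\<^sup>2 + 2 * (\<rho> * i) + (norm d)\<^sup>2"
      by (simp add: power2_norm_eq_inner \<rho> inner_add_left inner_add_right inner_commute)
    moreover have "0 \<le> (norm (z + d) - \<rho>)\<^sup>2" by simp
    ultimately have "2 * \<rho> * norm (z + d) \<le> 2 * \<rho>\<^sup>2 + 2 * (\<rho> * i) + (norm d)\<^sup>2"
      by (simp add: power2_diff algebra_simps)
    also have "\<dots> = 2 * \<rho> * (\<rho> + i + w)" using \<rho>0 by (simp add: w_def power2_eq_square algebra_simps)
    finally show ?thesis using \<rho>0 by simp
  qed
  have "g * norm (z + d) \<le> (1 + B + c * X) * (\<rho> + i + w)"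
    using g S by (intro mult_mono) (auto simp: B_def X_def intro: order_trans[OF norm_ge_zero])
  also have "\<dots> = \<rho> + (i + \<rho> * B) + (w + B * i + c * \<rho> * X) + (B * w + (c * X) * i + (c * X) * w)"
    by (simp add: algebra_simps)
  also have "\<dots> \<le> \<rho> + (i + \<rho> * B) + (w + B * i + c * \<rho> * X) + (\<beta> * r * (q / \<rho>) + c * q * (2 * r) + c * r\<^sup>2 * (q / \<rho>))"
  proof -
    have dq: "(norm d)\<^sup>2 \<le> 2 * q"
      using zero_le_power2[of "norm (\<xi> + \<eta>)"]
      by (simp add: d_def q_def X_def power2_norm_eq_inner inner_add_left inner_add_right inner_diff_left inner_diff_right inner_commute)
    then have wq: "w \<le> q / \<rho>" using \<rho>0 by (simp add: w_def field_simps)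
    have "B \<le> \<beta> * r"
      using norm_cauchy_schwarz[of b \<xi>] mult_mono[OF b r(1) \<beta>0 norm_ge_zero] by (simp add: B_def)
    then have 1: "B * w \<le> \<beta> * r * (q / \<rho>)"
      using wq pos \<beta>0 r0 by (intro mult_mono) auto
    have "norm d \<le> 2 * r" using norm_triangle_ineq4[of \<xi> \<eta>] r by (simp add: d_def)
    then have "i \<le> 2 * r" using norm_cauchy_schwarz[of e d] ne by (simp add: i_def)
    then have "(c * X) * i \<le> (c * X) * (2 * r)" using c pos by (intro mult_left_mono) auto
    also have "\<dots> \<le> c * q * (2 * r)" using c pos r0 by (intro mult_right_mono mult_left_mono) auto
    finally have 2: "(c * X) * i \<le> c * q * (2 * r)" .
    have "X \<le> r\<^sup>2" using r by (simp add: X_def power_mono)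
    then have "(c * X) * w \<le> (c * r\<^sup>2) * (q / \<rho>)" using c wq pos by (intro mult_mono mult_left_mono) auto
    then show ?thesis using 1 2 by linarith
  qed
  also have "\<dots> = \<rho> + (i + \<rho> * B) + (w + B * i + c * \<rho> * X) + (\<beta> * r / \<rho> + 2 * c * r + c * r\<^sup>2 / \<rho>) * q"
    by (simp add: algebra_simps)
  finally show ?thesis
    by (simp add: d_def i_def w_def B_def X_def q_def add_diff_eq)
qed

text \<open>\<open>\<delta>\<close> keeps the weight finite on the closed ball, so that a maximum
  exists, and makes it at least \<open>2 / \<delta>\<close> on the sphere. There a maximum is
  impossible: if \<open>xb\<close> and \<open>yb\<close> are close, uniform continuity keeps
  \<open>u xb - u yb\<close> below the maximal value; if not, the penalty exceeds the oscillation
  \<open>2 * M\<close>. The condition \<open>2 * M < K * R\<close> keeps \<open>yb\<close> inside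
  the larger ball.\<close>

lemma penalized_maximum:
  fixes u :: "'a::euclidean_space \<Rightarrow> real"
  assumes cont: "continuous_on (cball x0 (2 * R)) u" and M: "\<And>x. x \<in> cball x0 (2 * R) \<Longrightarrow> \<bar>u x\<bar> \<le> M"
    and R: "R > 0" and K: "K > 0" "2 * M < K * R" and k: "k \<ge> 1"
    and y1: "y1 \<in> cball x0 (2 * R)" "K * 2 ^ k * norm (x0 - y1) < u x0 - u y1"
  obtains \<delta> D xb yb where "\<delta> > 0" "\<delta> \<le> 1" "D = (\<lambda>x. (1 + \<delta> - (norm (x - x0))\<^sup>2 / R\<^sup>2) / 2)"
    "norm (xb - x0) < R" "norm (yb - x0) < 2 * R" "xb \<noteq> yb"
    "\<And>x y. x \<in> cball x0 R \<Longrightarrow> y \<in> cball x0 (2 * R) \<Longrightarrow>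
       u x - u y - K * (1 / D x ^ k) * norm (x - y) \<le> u xb - u yb - K * (1 / D xb ^ k) * norm (xb - yb)"
    "K * (1 / D xb ^ k) * norm (xb - yb) \<le> 2 * M"
proof -
  define \<gamma> where "\<gamma> = u x0 - u y1 - K * 2 ^ k * norm (x0 - y1)"
  have \<gamma>: "\<gamma> > 0" using y1 by (simp add: \<gamma>_def)
  have M0: "M \<ge> 0" using M[of x0] R by (simp add: order_trans[OF abs_ge_zero])
  have "uniformly_continuous_on (cball x0 (2 * R)) u"
    using cont by (rule compact_uniformly_continuous) simp
  then obtain \<eta> where \<eta>: "\<eta> > 0" "\<And>x y. x \<in> cball x0 (2 * R) \<Longrightarrow> y \<in> cball x0 (2 * R) \<Longrightarrow> dist y x < \<eta> \<Longrightarrow> dist (u y) (u x) < \<gamma>"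
    using \<gamma> unfolding uniformly_continuous_on_def by meson
  \<comment> \<open>\<open>\<eta>\<close> is the continuity scale for the excess
    \<open>\<gamma>\<close>. The choice gives
    \<open>K * (2 / \<delta>) * \<eta> \<ge> 2 * (M + 1)\<close>, more than the oscillation of
    \<open>u\<close>.\<close>
  define \<delta> where "\<delta> = min 1 (K * \<eta> / (M + 1))"
  have \<delta>: "\<delta> > 0" "\<delta> \<le> 1" using K \<eta> M0 by (auto simp: \<delta>_def)
  have \<delta>2: "\<delta> * (M + 1) \<le> K * \<eta>"
  proof -
    have "\<delta> \<le> K * \<eta> / (M + 1)" unfolding \<delta>_def by (rule min.cobounded2)
    then show ?thesis using M0 by (simp add: pos_le_divide_eq)
  qed
  define D where "D = (\<lambda>x. (1 + \<delta> - (norm (x - x0))\<^sup>2 / R\<^sup>2) / 2)"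
  have D: "\<delta> / 2 \<le> D x" "D x \<le> 1" if "x \<in> cball x0 R" for x
  proof -
    have "(norm (x - x0))\<^sup>2 \<le> R\<^sup>2" using that by (intro power_mono) (auto simp: dist_norm norm_minus_commute)
    then have "(norm (x - x0))\<^sup>2 / R\<^sup>2 \<le> 1" using R by simp
    moreover have "0 \<le> (norm (x - x0))\<^sup>2 / R\<^sup>2" by simp
    ultimately show "\<delta> / 2 \<le> D x" "D x \<le> 1" using \<delta> unfolding D_def by argo+
  qed
  have D0: "0 < D x" if "x \<in> cball x0 R" for x using D(1)[OF that] \<delta> by linarith
  have \<zeta>1: "1 \<le> 1 / D x ^ k" if "x \<in> cball x0 R" for x
    using D[OF that] D0[OF that] by (simp add: power_le_one)
  define \<Phi> where "\<Phi> z = u (fst z) - u (snd z) - K * (1 / D (fst z) ^ k) * norm (fst z - snd z)" for z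
  define B where "B = cball x0 R \<times> cball x0 (2 * R)"
  have sub: "x \<in> cball x0 (2 * R)" if "x \<in> cball x0 R" for x using that R by (auto simp: dist_norm)
  have "continuous_on B \<Phi>"
  proof -
    have c: "continuous_on B (\<lambda>z. u (fst z))" "continuous_on B (\<lambda>z. u (snd z))"
      by (rule continuous_on_compose2[OF cont]; use sub in \<open>auto simp: B_def intro!: continuous_intros\<close>)+
    have cD: "continuous_on B (\<lambda>z. D (fst z))"
      unfolding D_def using R by (intro continuous_intros) auto
    have "\<forall>z\<in>B. D (fst z) ^ k \<noteq> 0" using D0 by (force simp: B_def)
    then have "continuous_on B (\<lambda>z. 1 / D (fst z) ^ k)"
      by (intro continuous_on_divide continuous_on_const continuous_on_power cD)
    then show ?thesis
      unfolding \<Phi>_def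
      by (intro continuous_on_diff continuous_on_mult continuous_on_const continuous_on_norm
          continuous_on_fst continuous_on_snd continuous_on_id c)
  qed
  moreover have "compact B" "B \<noteq> {}" using R by (auto simp: B_def intro!: compact_Times)
  ultimately obtain z where z: "z \<in> B" "\<And>z'. z' \<in> B \<Longrightarrow> \<Phi> z' \<le> \<Phi> z"
    using continuous_attains_sup[of B \<Phi>] by blast
  obtain xb yb where zb: "z = (xb, yb)" by (cases z)
  have xb: "xb \<in> cball x0 R" and yb: "yb \<in> cball x0 (2 * R)" using z(1) by (auto simp: B_def zb)
  \<comment> \<open>At the centre \<open>D x0 \<ge> 1 / 2\<close>, so the weight there is at most
    \<open>2 ^ k\<close>; this is where that factor in the estimate comes from.\<close>
  have big: "\<gamma> \<le> \<Phi> z"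
  proof -
    have "D x0 = (1 + \<delta>) / 2" by (simp add: D_def)
    then have "1 / 2 \<le> D x0" using \<delta> by simp
    then have "(1 / 2) ^ k \<le> D x0 ^ k" by (intro power_mono) auto
    then have "1 / D x0 ^ k \<le> 1 / (1 / 2) ^ k" by (intro divide_left_mono) (use D0[of x0] R in auto)
    then have "K * (1 / D x0 ^ k) * norm (x0 - y1) \<le> K * 2 ^ k * norm (x0 - y1)"
      using K by (intro mult_right_mono mult_left_mono) (auto simp: power_one_over)
    then have "\<gamma> \<le> \<Phi> (x0, y1)" by (simp add: \<Phi>_def \<gamma>_def)
    also have "\<dots> \<le> \<Phi> z" by (rule z(2)) (use y1 R in \<open>auto simp: B_def\<close>)
    finally show ?thesis .
  qed
  have osc: "u xb - u yb \<le> 2 * M" using M[OF sub[OF xb]] M[OF yb] by linarith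
  have le2M: "K * (1 / D xb ^ k) * norm (xb - yb) \<le> 2 * M"
    using big \<gamma> osc by (simp add: \<Phi>_def zb)
  have ne: "xb \<noteq> yb" using big \<gamma> by (auto simp: \<Phi>_def zb)
  have xb_int: "norm (xb - x0) < R"
  proof (rule ccontr)
    assume "\<not> norm (xb - x0) < R"
    then have "norm (xb - x0) = R" using xb by (simp add: dist_norm norm_minus_commute)
    then have Dxb: "D xb = \<delta> / 2" using R by (simp add: D_def)
    have "2 / \<delta> \<le> 1 / D xb ^ k"
    proof -
      have "D xb ^ k \<le> D xb ^ 1" using D[OF xb] D0[OF xb] k by (intro power_decreasing) auto
      then have "1 / D xb ^ 1 \<le> 1 / D xb ^ k" using D0[OF xb] by (intro divide_left_mono) auto
      then show ?thesis by (simp add: Dxb)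
    qed
    show False
    proof (cases "norm (xb - yb) < \<eta>")
      case True
      then have "dist (u yb) (u xb) < \<gamma>"
        using \<eta>(2)[OF sub[OF xb] yb] by (simp add: dist_norm norm_minus_commute)
      then have "u xb - u yb < \<gamma>" by (simp add: dist_real_def)
      moreover have "0 \<le> K * (1 / D xb ^ k) * norm (xb - yb)" using K D0[OF xb] by simp
      ultimately show False using big by (simp add: \<Phi>_def zb)
    next
      case False
      have "K * (2 / \<delta>) * \<eta> \<le> K * (1 / D xb ^ k) * norm (xb - yb)"
        using False K \<eta> \<delta> \<open>2 / \<delta> \<le> 1 / D xb ^ k\<close> D0[OF xb] by (intro mult_mono mult_left_mono) auto
      moreover have "2 * (M + 1) \<le> K * (2 / \<delta>) * \<eta>"
        using \<delta>2 \<delta> by (simp add: field_simps)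
      ultimately have "2 * (M + 1) \<le> 2 * M" using le2M order_trans by blast
      then show False by simp
    qed
  qed
  have "norm (xb - yb) < R"
  proof -
    have "K * 1 \<le> K * (1 / D xb ^ k)" by (rule mult_left_mono[OF \<zeta>1[OF xb]]) (use K in simp)
    from mult_right_mono[OF this norm_ge_zero, of "xb - yb"]
    have "K * norm (xb - yb) \<le> K * (1 / D xb ^ k) * norm (xb - yb)" by simp
    then have "K * norm (xb - yb) < K * R" using le2M K(2) by (meson order.strict_trans1 order_trans)
    then show ?thesis using K by simp
  qed
  then have yb_int: "norm (yb - x0) < 2 * R"
    using xb_int norm_triangle_ineq4[of "xb - x0" "xb - yb"] by simp
  show thesis
  proof (rule that[OF \<delta> D_def xb_int yb_int ne _ le2M])
    show "u x - u y - K * (1 / D x ^ k) * norm (x - y) \<le> u xb - u yb - K * (1 / D xb ^ k) * norm (xb - yb)"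
      if "x \<in> cball x0 R" "y \<in> cball x0 (2 * R)" for x y
      using z(2)[of "(x, y)"] that by (simp add: \<Phi>_def zb B_def)
  qed
qed

text \<open>The polarisation of the second order part of \<open>weighted_distance_bound\<close>.
  After halving, \<open>4 * \<kappa>\<close> contributes \<open>2 * \<kappa>\<close>: one
  \<open>\<kappa>\<close> pays for the third order remainder, the other makes the maximum
  strict.\<close>

lemma doubling_operator:
  fixes e b :: "'a::euclidean_space"
  obtains T :: "'a \<times> 'a \<Rightarrow> 'a \<times> 'a" where "linear T" "\<And>z w. z \<bullet> T w = T z \<bullet> w"
    "\<And>\<xi> \<eta>. (\<xi>, \<eta>) \<bullet> T (\<xi>, \<eta>) = P * ((norm (\<xi> - \<eta>))\<^sup>2 / \<rho> + 2 * (b \<bullet> \<xi>) * (e \<bullet> (\<xi> - \<eta>)) + 2 * c * \<rho> * (norm \<xi>)\<^sup>2)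
        + 4 * \<kappa> * ((norm \<xi>)\<^sup>2 + (norm \<eta>)\<^sup>2)"
proof -
  define T :: "'a \<times> 'a \<Rightarrow> 'a \<times> 'a" where
    "T z = (let \<xi> = fst z; \<eta> = snd z; d = \<xi> - \<eta> in
       (P *\<^sub>R ((1 / \<rho>) *\<^sub>R d + (e \<bullet> d) *\<^sub>R b + (b \<bullet> \<xi>) *\<^sub>R e + (2 * c * \<rho>) *\<^sub>R \<xi>) + (4 * \<kappa>) *\<^sub>R \<xi>,
        P *\<^sub>R (- (1 / \<rho>) *\<^sub>R d - (b \<bullet> \<xi>) *\<^sub>R e) + (4 * \<kappa>) *\<^sub>R \<eta>))" for z
  have "linear T"
    by (rule linearI) (simp_all add: T_def Let_def inner_add_right inner_diff_right algebra_simps)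
  moreover have "z \<bullet> T w = T z \<bullet> w" for z w
    by (cases z; cases w)
      (simp add: T_def Let_def inner_add_left inner_add_right inner_diff_left inner_diff_right inner_commute algebra_simps)
  moreover have "(\<xi>, \<eta>) \<bullet> T (\<xi>, \<eta>) = P * ((norm (\<xi> - \<eta>))\<^sup>2 / \<rho> + 2 * (b \<bullet> \<xi>) * (e \<bullet> (\<xi> - \<eta>)) + 2 * c * \<rho> * (norm \<xi>)\<^sup>2)
        + 4 * \<kappa> * ((norm \<xi>)\<^sup>2 + (norm \<eta>)\<^sup>2)" for \<xi> \<eta>
    by (simp add: T_def Let_def power2_norm_eq_inner inner_add_left inner_add_right inner_diff_left inner_diff_right inner_commute
        add_divide_distrib diff_divide_distrib algebra_simps)
  ultimately show thesis by (rule that)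
qed

section \<open>Absorbing the error terms\<close>

text \<open>The unit is \<open>\<tau> * c0 * P powr m\<close>. As
  \<open>s^2 - 1 \<ge> 2 * \<tau>\<close> and \<open>np \<ge> P / 2\<close>, the coercive term is at
  least one unit, which explains the factor \<open>2 powr (1 - m)\<close> in \<open>c0\<close>.
  Three groups of errors get a quarter each: those proportional to \<open>\<beta> * \<rho>\<close>
  by the choice of \<open>\<Lambda>\<close>, the constants \<open>C1\<close> and \<open>N\<close> by
  \<open>P1\<close>, the matrix error by \<open>P2\<close>.\<close>

lemma gradient_bound_contradiction:
  fixes P \<tau> \<rho> \<beta> \<Lambda> np nq npq s Hp Hq Hpy fx fy :: real
  assumes main: "s\<^sup>2 * Hp - Hq \<le> s\<^sup>2 * fx - fy + CF * (14 * \<Lambda> * P * \<beta> * \<tau>)"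
    and Hp: "- C1 + C2 * np powr m \<le> Hp" and Hx: "\<bar>Hp - Hpy\<bar> \<le> (C3 * np powr m + C1) * \<rho>"
    and Hpq: "\<bar>Hpy - Hq\<bar> \<le> C3 * (np + nq + 1) powr (m - 1) * npq"
    and f: "\<bar>fx - fy\<bar> \<le> L * \<rho>" "\<bar>fx\<bar> \<le> N"
    and np: "P / 2 \<le> np" "np \<le> 2 * P" "nq = P" "npq \<le> \<rho> * \<beta> * P" "P \<ge> 1"
    and s: "s = 1 + \<tau>" "0 < \<tau>" "\<tau> \<le> 1" "\<tau> = \<Lambda> * \<beta> * \<rho>" "\<beta> \<ge> 1" "\<Lambda> \<ge> 1" "\<rho> > 0"
    and C: "m > 1" "C1 > 0" "C2 > 0" "C3 > 0" "CF > 0" "L \<ge> 0" "N \<ge> 0"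
    and c0: "c0 = 2 powr (1 - m) * C2" and \<Lambda>: "C3 * 2 powr m + C1 + C3 * 4 powr (m - 1) + L \<le> \<Lambda> * c0 / 4"
    and P1: "3 * (C1 + N) \<le> c0 / 4 * P" and P2: "14 * CF * \<Lambda> * \<beta> \<le> c0 / 4 * P powr (m - 1)"
  shows False
proof -
  define Q where "Q = P powr m"
  define \<sigma> where "\<sigma> = \<beta> * \<rho>"
  have \<sigma>: "\<sigma> > 0" "\<rho> \<le> \<sigma>" "\<Lambda> * \<sigma> = \<tau>" using s by (auto simp: \<sigma>_def)
  have c0p: "c0 > 0" using C c0 by simp
  have PQ: "P powr (m - 1) * P = Q" using np C by (simp add: Q_def powr_diff)
  have Q1: "P \<le> Q" using powr_mono[of 1 m P] np C by (simp add: Q_def)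
  have Q: "1 \<le> Q" using Q1 np by linarith
  define \<theta> where "\<theta> = s\<^sup>2 - 1"
  have \<theta>eq: "\<theta> = 2 * \<tau> + \<tau> * \<tau>" by (simp add: \<theta>_def s(1) power2_eq_square algebra_simps)
  have tt: "\<tau> * \<tau> \<le> \<tau> * 1" using s by (intro mult_left_mono) auto
  have \<theta>: "2 * \<tau> \<le> \<theta>" "\<theta> \<le> 3 * \<tau>" using \<theta>eq tt s(2) by auto
  have npm: "c0 * Q \<le> 2 * (C2 * np powr m)"
  proof -
    have "(P / 2) powr m \<le> np powr m" using np C by (intro powr_mono2) auto
    moreover have "(P / 2) powr m = Q / 2 powr m" using np by (simp add: Q_def powr_divide)
    moreover have "2 powr (1 - m) = 2 / 2 powr m" by (simp add: powr_diff)
    ultimately have "2 powr (1 - m) * Q \<le> 2 * np powr m" by simp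
    then have "C2 * (2 powr (1 - m) * Q) \<le> C2 * (2 * np powr m)" using C by (intro mult_left_mono) auto
    then show ?thesis by (simp add: c0 mult_ac)
  qed
  have npu: "np powr m \<le> 2 powr m * Q"
  proof -
    have "np powr m \<le> (2 * P) powr m" using np C by (intro powr_mono2) auto
    then show ?thesis using np by (simp add: Q_def powr_mult)
  qed
  \<comment> \<open>The base is at most \<open>2 * P + P + P\<close>, whence the constant
    \<open>4 powr (m - 1)\<close>.\<close>
  have nn: "(np + nq + 1) powr (m - 1) * npq \<le> 4 powr (m - 1) * Q * \<sigma>"
  proof -
    have "(np + nq + 1) powr (m - 1) \<le> (4 * P) powr (m - 1)" using np C by (intro powr_mono2) auto
    then have "(np + nq + 1) powr (m - 1) * npq \<le> (4 * P) powr (m - 1) * (\<rho> * \<beta> * P)"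
    proof -
      have "(np + nq + 1) powr (m - 1) * npq \<le> (np + nq + 1) powr (m - 1) * (\<rho> * \<beta> * P)"
        using np by (intro mult_left_mono) auto
      also have "\<dots> \<le> (4 * P) powr (m - 1) * (\<rho> * \<beta> * P)"
        using \<open>(np + nq + 1) powr (m - 1) \<le> (4 * P) powr (m - 1)\<close> s np by (intro mult_right_mono) auto
      finally show ?thesis .
    qed
    also have "\<dots> = 4 powr (m - 1) * (P powr (m - 1) * P) * \<sigma>" using np by (simp add: powr_mult \<sigma>_def mult_ac)
    finally show ?thesis by (simp add: PQ)
  qed
  have lower: "\<tau> * c0 * Q - 3 * \<tau> * C1 \<le> \<theta> * Hp"
  proof -
    have "\<theta> * (- C1 + C2 * np powr m) \<le> \<theta> * Hp" using Hp \<theta> s(2) by (intro mult_left_mono) auto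
    moreover have "2 * \<tau> * (C2 * np powr m) \<le> \<theta> * (C2 * np powr m)" using \<theta> C by (intro mult_right_mono) auto
    moreover have "\<tau> * (c0 * Q) \<le> \<tau> * (2 * (C2 * np powr m))" using npm s by (intro mult_left_mono) auto
    moreover have "\<theta> * C1 \<le> 3 * \<tau> * C1" using \<theta> C by (intro mult_right_mono) auto
    ultimately show ?thesis by (simp add: algebra_simps)
  qed
  have upper1: "Hq - Hp \<le> (C3 * 2 powr m + C1 + C3 * 4 powr (m - 1)) * Q * \<sigma>"
  proof -
    have "C3 * np powr m \<le> C3 * (2 powr m * Q)" using npu C by (intro mult_left_mono) auto
    moreover have "C1 * 1 \<le> C1 * Q" using Q C by (intro mult_left_mono) auto
    ultimately have "C3 * np powr m + C1 \<le> C3 * (2 powr m * Q) + C1 * Q" by simp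
    moreover have "0 \<le> C3 * np powr m + C1" using C by simp
    ultimately have "(C3 * np powr m + C1) * \<rho> \<le> (C3 * (2 powr m * Q) + C1 * Q) * \<sigma>"
      using \<sigma> s by (intro mult_mono) auto
    moreover have "C3 * ((np + nq + 1) powr (m - 1) * npq) \<le> C3 * (4 powr (m - 1) * Q * \<sigma>)"
      using nn C by (intro mult_left_mono) auto
    moreover have "Hq - Hp \<le> (C3 * np powr m + C1) * \<rho> + C3 * ((np + nq + 1) powr (m - 1) * npq)"
      using Hx Hpq by (simp add: mult.assoc)
    ultimately show ?thesis by (simp add: algebra_simps)
  qed
  have upper2: "fx - fy \<le> L * Q * \<sigma>"
  proof -
    have "L * \<rho> \<le> L * (Q * \<sigma>)"
      using C Q \<sigma> s mult_mono[of 1 Q \<rho> \<sigma>] by (intro mult_left_mono) auto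
    then show ?thesis using f by (simp add: mult.assoc)
  qed
  have upper3: "\<theta> * fx \<le> 3 * \<tau> * N"
  proof -
    have "\<theta> * fx \<le> \<theta> * N" using f(2) \<theta> s(2) by (intro mult_left_mono) auto
    also have "\<dots> \<le> 3 * \<tau> * N" using \<theta> C by (intro mult_right_mono) auto
    finally show ?thesis .
  qed
  have g1: "(C3 * 2 powr m + C1 + C3 * 4 powr (m - 1) + L) * (Q * \<sigma>) \<le> \<tau> * c0 * Q / 4"
  proof -
    have "(C3 * 2 powr m + C1 + C3 * 4 powr (m - 1) + L) * (Q * \<sigma>) \<le> \<Lambda> * c0 / 4 * (Q * \<sigma>)"
      using \<Lambda> Q \<sigma> by (intro mult_right_mono) auto
    also have "\<dots> = (\<Lambda> * \<sigma>) * c0 * Q / 4" by simp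
    finally show ?thesis using \<sigma> by simp
  qed
  have g2: "3 * (C1 + N) * \<tau> \<le> \<tau> * c0 * Q / 4"
  proof -
    have "3 * (C1 + N) * \<tau> \<le> c0 / 4 * P * \<tau>" using P1 s by (intro mult_right_mono) auto
    also have "\<dots> \<le> c0 / 4 * Q * \<tau>" using Q1 c0p s by (intro mult_right_mono mult_left_mono) auto
    finally show ?thesis by (simp add: mult_ac)
  qed
  have g3: "CF * (14 * \<Lambda> * P * \<beta> * \<tau>) \<le> \<tau> * c0 * Q / 4"
  proof -
    have "14 * CF * \<Lambda> * \<beta> * (P * \<tau>) \<le> c0 / 4 * P powr (m - 1) * (P * \<tau>)"
      using P2 np s by (intro mult_right_mono) auto
    also have "\<dots> = c0 / 4 * (P powr (m - 1) * P) * \<tau>" by simp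
    finally show ?thesis unfolding PQ by (simp add: mult_ac)
  qed
  have "\<theta> * Hp \<le> (Hq - Hp) + \<theta> * fx + (fx - fy) + CF * (14 * \<Lambda> * P * \<beta> * \<tau>)"
    using main by (simp add: \<theta>_def algebra_simps)
  then have "\<tau> * c0 * Q - 3 * \<tau> * C1 \<le> (C3 * 2 powr m + C1 + C3 * 4 powr (m - 1)) * Q * \<sigma> + 3 * \<tau> * N + L * Q * \<sigma> + \<tau> * c0 * Q / 4"
    using lower upper1 upper2 upper3 g3 by linarith
  moreover have "(C3 * 2 powr m + C1 + C3 * 4 powr (m - 1) + L) * (Q * \<sigma>)
     = (C3 * 2 powr m + C1 + C3 * 4 powr (m - 1)) * Q * \<sigma> + L * Q * \<sigma>" by (simp add: algebra_simps)
  moreover have "3 * (C1 + N) * \<tau> = 3 * \<tau> * C1 + 3 * \<tau> * N" by (simp add: algebra_simps)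
  moreover have "0 < \<tau> * c0 * Q" using s c0p Q by simp
  ultimately show False using g1 g2 by linarith
qed

text \<open>At the penalized maximum both gradients have size comparable to
  \<open>P = K * \<zeta>\<close>. Since \<open>P * \<rho> \<le> 2 * M\<close>, a large
  \<open>K\<close> forces the points together and keeps \<open>\<tau>\<close> below
  \<open>1/2\<close>. The conditions \<open>Kc\<close> list all demands on the constant; they
  involve \<open>k\<close>, \<open>Ck\<close> and \<open>\<Lambda>\<close>, which are fixed before
  it.\<close>

lemma lipschitz_at_center:
  fixes u f :: "real ^ 'n \<Rightarrow> real" and k :: nat
  assumes F: "degenerate_elliptic_lipschitz CF F" "CF > 0" "positively_homogeneous F"
    and sol: "viscosity_solution \<Omega> F H f u" and f: "L-lipschitz_on \<Omega> f"
    and H: "hamiltonian_conditions \<Omega> m C1 C2 C3 H" and C: "m > 1" "C1 > 0" "C2 > 0" "C3 > 0"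
    and R: "R > 0" "cball x0 (2 * R) \<subseteq> \<Omega>"
    and bounds: "\<And>x. x \<in> cball x0 (2 * R) \<Longrightarrow> \<bar>u x\<bar> \<le> M" "\<And>x. x \<in> cball x0 (2 * R) \<Longrightarrow> \<bar>f x\<bar> \<le> N"
    and k: "k \<ge> 1" "real k * (m - 1) \<ge> 1"
    and Ck: "Ck \<ge> 0" "\<And>t::real. \<bar>t\<bar> \<le> 1 / 2 \<Longrightarrow> 1 / (1 - t) ^ k \<le> 1 + real k * t + Ck * t\<^sup>2"
    and \<beta>0: "\<beta>0 = 1 + (real k + 3 * Ck + 1) / R" and c0: "c0 = 2 powr (1 - m) * C2"
    and \<Lambda>: "\<Lambda> \<ge> 1" "C3 * 2 powr m + C1 + C3 * 4 powr (m - 1) + L \<le> \<Lambda> * c0 / 4"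
    and Kc: "Kc \<ge> 1" "3 * (C1 + 1) \<le> c0 / 4 * Kc" "14 * CF * \<Lambda> * \<beta>0 \<le> c0 / 4 * Kc powr (m - 1)"
       "4 * \<Lambda> * \<beta>0 \<le> Kc" "2 < Kc * R"
    and y1: "y1 \<in> cball x0 (2 * R)"
  shows "u x0 - u y1 \<le> Kc * 2 ^ k * (1 + M + N) * norm (x0 - y1)"
proof (rule ccontr)
  assume neg: "\<not> ?thesis"
  have x0: "x0 \<in> cball x0 (2 * R)" using R by simp
  have MN: "M \<ge> 0" "N \<ge> 0" using bounds[OF x0] by linarith+
  have L0: "L \<ge> 0" using f by (rule lipschitz_on_nonneg)
  define A where "A = 1 + M + N"
  have A: "A \<ge> 1" "M \<le> A" "1 + N \<le> A" using MN by (auto simp: A_def)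
  define K where "K = Kc * A"
  have K: "Kc \<le> K" "K \<ge> 1" "K > 0"
  proof -
    show "Kc \<le> K" using Kc(1) A(1) mult_left_mono[of 1 A Kc] by (simp add: K_def)
    then show "K \<ge> 1" "K > 0" using Kc(1) by auto
  qed
  have c0p: "c0 > 0" using C by (simp add: c0)
  have MK: "2 * M < K * R"
  proof -
    have "2 * M \<le> 2 * A" using A by simp
    also have "\<dots> < (Kc * R) * A" using Kc(5) A(1) by (intro mult_strict_right_mono) auto
    finally show ?thesis by (simp add: K_def mult_ac)
  qed
  have cont: "continuous_on (cball x0 (2 * R)) u"
    using sol R(2) unfolding viscosity_solution_def by (auto intro: continuous_on_subset)
  have big: "K * 2 ^ k * norm (x0 - y1) < u x0 - u y1"
    using neg by (simp add: K_def A_def mult_ac)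
  obtain \<delta> D xb yb where \<delta>: "\<delta> > 0" "\<delta> \<le> 1" and D: "D = (\<lambda>x. (1 + \<delta> - (norm (x - x0))\<^sup>2 / R\<^sup>2) / 2)"
    and xb: "norm (xb - x0) < R" and yb: "norm (yb - x0) < 2 * R" and ne: "xb \<noteq> yb"
    and max: "\<And>x y. x \<in> cball x0 R \<Longrightarrow> y \<in> cball x0 (2 * R) \<Longrightarrow>
       u x - u y - K * (1 / D x ^ k) * norm (x - y) \<le> u xb - u yb - K * (1 / D xb ^ k) * norm (xb - yb)"
    and le2M: "K * (1 / D xb ^ k) * norm (xb - yb) \<le> 2 * M"
    using penalized_maximum[OF cont bounds(1) R(1) K(3) MK k(1) y1 big] by metis
  have xbO: "xb \<in> \<Omega>" and ybO: "yb \<in> \<Omega>"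
    using xb yb R by (auto intro!: subsetD[OF R(2)] simp: dist_norm norm_minus_commute)
  define B where "B = D xb"
  have B: "0 < B" "B \<le> 1"
  proof -
    have "(norm (xb - x0))\<^sup>2 \<le> R\<^sup>2" using xb by (intro power_mono) auto
    then have "(norm (xb - x0))\<^sup>2 / R\<^sup>2 \<le> 1" using R by simp
    moreover have "0 \<le> (norm (xb - x0))\<^sup>2 / R\<^sup>2" by simp
    ultimately show "0 < B" "B \<le> 1" using \<delta> unfolding B_def D by argo+
  qed
  define \<zeta> where "\<zeta> = 1 / B ^ k"
  define P where "P = K * \<zeta>"
  define \<rho> where "\<rho> = norm (xb - yb)"
  define e where "e = (1 / \<rho>) *\<^sub>R (xb - yb)"
  define b where "b = (real k / (R\<^sup>2 * B)) *\<^sub>R (xb - x0)"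
  define c where "c = (real k + 3 * Ck) / (R\<^sup>2 * B\<^sup>2)"
  \<comment> \<open>\<open>b\<close> and \<open>c\<close> are the first and second order
    coefficients of the weight relative to its value at \<open>xb\<close>; \<open>\<beta>\<close>
    dominates \<open>norm b\<close> and \<open>\<beta>^2\<close> dominates \<open>c\<close>.\<close>
  define \<beta> where "\<beta> = \<beta>0 / B"
  define \<tau> where "\<tau> = \<Lambda> * \<beta> * \<rho>"
  \<comment> \<open>The divisor 20 makes \<open>4 * \<kappa> * (s^2 + 1)\<close>, where
    \<open>s \<le> 2\<close>, at most \<open>\<Lambda> * P * \<beta> * \<tau>\<close>.\<close>
  define \<kappa>' where "\<kappa>' = \<Lambda> * \<beta> * \<tau> / 20"
  define \<kappa> where "\<kappa> = P * \<kappa>'"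
  have \<zeta>B: "1 / B \<le> \<zeta>"
  proof -
    have "B ^ k \<le> B ^ 1" using B k by (intro power_decreasing) auto
    then have "1 / B ^ 1 \<le> 1 / B ^ k" using B by (intro divide_left_mono) auto
    then show ?thesis by (simp add: \<zeta>_def)
  qed
  have B1: "1 \<le> 1 / B" using B by simp
  then have \<zeta>1: "1 \<le> \<zeta>" using \<zeta>B by linarith
  have PK: "K \<le> P" using mult_left_mono[OF \<zeta>1, of K] K by (simp add: P_def)
  have P1: "P \<ge> 1" using PK K by linarith
  have \<rho>: "\<rho> > 0" using ne by (simp add: \<rho>_def)
  have ne1: "norm e = 1" using \<rho> by (simp add: e_def \<rho>_def)
  have \<beta>01: "\<beta>0 \<ge> 1" using Ck R by (simp add: \<beta>0)
  have \<beta>1: "\<beta> \<ge> 1" using mult_mono[OF \<beta>01 B1] \<beta>01 by (simp add: \<beta>_def)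
  have nb: "norm b \<le> \<beta>"
  proof -
    have "norm b = real k / (R\<^sup>2 * B) * norm (xb - x0)" using B by (simp add: b_def abs_mult)
    also have "\<dots> \<le> real k / (R\<^sup>2 * B) * R" using xb B by (intro mult_left_mono) auto
    also have "\<dots> = (real k / R) / B" using R by (simp add: power2_eq_square)
    also have "\<dots> \<le> \<beta>0 / B"
    proof (rule divide_right_mono)
      have "real k / R \<le> (real k + 3 * Ck + 1) / R" using Ck R by (intro divide_right_mono) auto
      then show "real k / R \<le> \<beta>0" by (simp add: \<beta>0)
    qed (use B in simp)
    finally show ?thesis by (simp add: \<beta>_def)
  qed
  have c: "0 \<le> c" "c \<le> \<beta>\<^sup>2"
  proof -
    show "0 \<le> c" using Ck by (simp add: c_def)
    define w where "w = real k + 3 * Ck + 1"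
    have w: "w \<ge> 1" using Ck by (simp add: w_def)
    have "real k + 3 * Ck \<le> w * 1" by (simp add: w_def)
    also have "\<dots> \<le> w * w" using w by (intro mult_left_mono) auto
    finally have "(real k + 3 * Ck) / R\<^sup>2 \<le> (w * w) / R\<^sup>2" by (intro divide_right_mono) auto
    also have "\<dots> = (w / R)\<^sup>2" by (simp add: power_divide power2_eq_square)
    also have "\<dots> \<le> \<beta>0\<^sup>2" using w R by (intro power_mono) (auto simp: \<beta>0 w_def)
    finally have "(real k + 3 * Ck) / R\<^sup>2 / B\<^sup>2 \<le> \<beta>0\<^sup>2 / B\<^sup>2" by (intro divide_right_mono) auto
    then show "c \<le> \<beta>\<^sup>2" by (simp add: c_def \<beta>_def power_divide)
  qed
  have P\<rho>: "P * \<rho> \<le> 2 * M" using le2M by (simp add: P_def \<zeta>_def B_def \<rho>_def)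
  have \<tau>0: "\<tau> > 0" using \<Lambda> \<beta>1 \<rho> by (simp add: \<tau>_def)
  \<comment> \<open>\<open>1 / B \<le> \<zeta>\<close> bounds \<open>K * \<beta> * \<rho>\<close> by
    \<open>\<beta>0 * P * \<rho> \<le> 2 * \<beta>0 * M\<close>; the condition
    \<open>4 * \<Lambda> * \<beta>0 \<le> Kc\<close> does the rest.\<close>
  have \<tau>half: "\<tau> \<le> 1 / 2"
  proof -
    have "\<beta> \<le> \<beta>0 * \<zeta>" using mult_left_mono[OF \<zeta>B, of \<beta>0] \<beta>01 by (simp add: \<beta>_def)
    then have "\<tau> \<le> \<Lambda> * (\<beta>0 * \<zeta>) * \<rho>"
      unfolding \<tau>_def using \<Lambda> \<rho> by (intro mult_right_mono mult_left_mono) auto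
    then have "K * \<tau> \<le> K * (\<Lambda> * (\<beta>0 * \<zeta>) * \<rho>)" using K by (intro mult_left_mono) auto
    also have "\<dots> = \<Lambda> * \<beta>0 * (P * \<rho>)" by (simp add: P_def mult_ac)
    also have "\<dots> \<le> \<Lambda> * \<beta>0 * (2 * A)" using P\<rho> A \<Lambda> \<beta>01 by (intro mult_left_mono) auto
    also have "\<dots> = (4 * \<Lambda> * \<beta>0) * A / 2" by simp
    also have "\<dots> \<le> Kc * A / 2" using Kc(4) A by (intro divide_right_mono mult_right_mono) auto
    finally have "K * \<tau> \<le> K * (1 / 2)" by (simp add: K_def)
    then show ?thesis using K(3) by simp
  qed
  have \<beta>\<rho>: "\<rho> * \<beta> \<le> \<tau>" "\<rho> * \<beta> > 0"
  proof -
    show "\<rho> * \<beta> > 0" using \<rho> \<beta>1 by simp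
    then have "1 * (\<rho> * \<beta>) \<le> \<Lambda> * (\<rho> * \<beta>)" using \<Lambda> by (intro mult_right_mono) auto
    then show "\<rho> * \<beta> \<le> \<tau>" by (simp add: \<tau>_def mult_ac)
  qed
  have \<kappa>'0: "\<kappa>' > 0" using \<Lambda> \<beta>1 \<tau>0 by (simp add: \<kappa>'_def)
  have \<kappa>0: "\<kappa> > 0" using \<kappa>'0 P1 by (simp add: \<kappa>_def)
  define S where "S = \<beta> / \<rho> + 2 * c + c / \<rho>"
  have S: "S \<ge> 0" using \<beta>1 \<rho> c by (simp add: S_def)
  \<comment> \<open>The radius keeps both balls inside the domain of the maximum, permits the
    expansion of the weight, and makes the third order remainder at most
    \<open>\<kappa>'\<close>.\<close>
  have "\<exists>r>0. r \<le> a1 \<and> r \<le> a2 \<and> r \<le> a3 \<and> r \<le> 1 \<and> r \<le> a4" if "a1 > 0" "a2 > 0" "a3 > 0" "a4 > 0" for a1 a2 a3 a4 :: real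
    using that by (intro exI[of _ "min a1 (min a2 (min a3 (min 1 a4)))"]) (auto simp: min_def)
  from this[of "R * B / 3" "R - norm (xb - x0)" "2 * R - norm (yb - x0)" "\<kappa>' / (S + 1)"]
  obtain r where r: "r > 0" "r \<le> R * B / 3" "r \<le> R - norm (xb - x0)" "r \<le> 2 * R - norm (yb - x0)" "r \<le> 1" "r \<le> \<kappa>' / (S + 1)"
    using R B xb yb \<kappa>'0 S by (auto simp: add_nonneg_pos)
  have rS: "\<beta> * r / \<rho> + 2 * c * r + c * r\<^sup>2 / \<rho> \<le> \<kappa>'"
  proof -
    have "r * r \<le> r * 1" using r by (intro mult_left_mono) auto
    then have "c * r\<^sup>2 / \<rho> \<le> c * r / \<rho>" using c \<rho> by (intro divide_right_mono mult_left_mono) (auto simp: power2_eq_square)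
    then have "\<beta> * r / \<rho> + 2 * c * r + c * r\<^sup>2 / \<rho> \<le> r * S" by (simp add: S_def algebra_simps)
    also have "\<dots> \<le> r * (S + 1)" using r by (intro mult_left_mono) auto
    also have "\<dots> \<le> \<kappa>'" using r(6) S by (simp add: pos_le_divide_eq)
    finally show ?thesis .
  qed
  obtain T :: "(real ^ 'n) \<times> (real ^ 'n) \<Rightarrow> (real ^ 'n) \<times> (real ^ 'n)" where T: "linear T" "\<And>z w. z \<bullet> T w = T z \<bullet> w"
    and Tq: "\<And>\<xi> \<eta>. (\<xi>, \<eta>) \<bullet> T (\<xi>, \<eta>) = P * ((norm (\<xi> - \<eta>))\<^sup>2 / \<rho> + 2 * (b \<bullet> \<xi>) * (e \<bullet> (\<xi> - \<eta>)) + 2 * c * \<rho> * (norm \<xi>)\<^sup>2)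
        + 4 * \<kappa> * ((norm \<xi>)\<^sup>2 + (norm \<eta>)\<^sup>2)"
    by (rule doubling_operator[of P \<rho> b e c \<kappa>]) (rule that)
  define l where "l = (P *\<^sub>R (e + \<rho> *\<^sub>R b), - (P *\<^sub>R e))"
  have upper: "u x - u y \<le> u xb - u yb + l \<bullet> ((x, y) - (xb, yb)) + (((x, y) - (xb, yb)) \<bullet> T ((x, y) - (xb, yb))) / 2
          - \<kappa> * (norm ((x, y) - (xb, yb)))\<^sup>2"
    if x: "x \<in> cball xb r" and y: "y \<in> cball yb r" for x y
  proof -
    define \<xi> where "\<xi> = x - xb"
    define \<eta> where "\<eta> = y - yb"
    have \<xi>: "norm \<xi> \<le> r" and \<eta>: "norm \<eta> \<le> r" using x y by (auto simp: \<xi>_def \<eta>_def dist_norm norm_minus_commute)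
    have x_eq: "x = xb + \<xi>" and y_eq: "y = yb + \<eta>" by (auto simp: \<xi>_def \<eta>_def)
    have xin: "x \<in> cball x0 R"
      using norm_triangle_ineq[of "xb - x0" \<xi>] \<xi> r(3) by (simp add: x_eq dist_norm norm_minus_commute algebra_simps)
    have yin: "y \<in> cball x0 (2 * R)"
      using norm_triangle_ineq[of "yb - x0" \<eta>] \<eta> r(4) by (simp add: y_eq dist_norm norm_minus_commute algebra_simps)
    define X where "X = (norm \<xi>)\<^sup>2"
    define q where "q = X + (norm \<eta>)\<^sup>2"
    have q0: "q \<ge> 0" by (simp add: q_def X_def)
    have Dx: "0 < D x" "1 / D x ^ k \<le> \<zeta> * (1 + b \<bullet> \<xi> + c * X)"
      using cutoff_upper_bound[OF Ck R(1) D _ _ less_imp_le[OF xb], of \<xi>] B \<xi> r(2)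
      by (auto simp: x_eq B_def[symmetric] \<zeta>_def b_def c_def X_def)
    \<comment> \<open>The weight relative to its value at \<open>xb\<close>: the factor
      \<open>P\<close> splits off, and \<open>g\<close> has the normalised expansion starting with
      1.\<close>
    define g where "g = (1 / D x ^ k) * B ^ k"
    have g0: "0 \<le> g" using Dx B by (simp add: g_def)
    have "g \<le> \<zeta> * (1 + b \<bullet> \<xi> + c * X) * B ^ k"
      unfolding g_def using Dx(2) B by (intro mult_right_mono) auto
    also have "\<dots> = 1 + b \<bullet> \<xi> + c * X" using B by (simp add: \<zeta>_def)
    finally have g1: "g \<le> 1 + b \<bullet> \<xi> + c * (norm \<xi>)\<^sup>2" by (simp add: X_def)
    have Pg: "K * (1 / D x ^ k) = P * g" using B by (simp add: P_def g_def \<zeta>_def)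
    have "xb - yb \<noteq> 0" using ne by simp
    from weighted_distance_bound[OF this \<rho>_def e_def g0 g1 nb c(1) \<xi> \<eta>]
    have "g * norm (x - y) \<le> \<rho> + (e \<bullet> (\<xi> - \<eta>) + \<rho> * (b \<bullet> \<xi>))
       + ((norm (\<xi> - \<eta>))\<^sup>2 / (2 * \<rho>) + (b \<bullet> \<xi>) * (e \<bullet> (\<xi> - \<eta>)) + c * \<rho> * X)
       + (\<beta> * r / \<rho> + 2 * c * r + c * r\<^sup>2 / \<rho>) * q"
      by (simp add: x_eq y_eq X_def q_def add_diff_eq diff_add_eq diff_diff_eq2 algebra_simps)
    also have "\<dots> \<le> \<rho> + (e \<bullet> (\<xi> - \<eta>) + \<rho> * (b \<bullet> \<xi>))
       + ((norm (\<xi> - \<eta>))\<^sup>2 / (2 * \<rho>) + (b \<bullet> \<xi>) * (e \<bullet> (\<xi> - \<eta>)) + c * \<rho> * X) + \<kappa>' * q"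
      using rS q0 by (intro add_left_mono mult_right_mono) auto
    finally have "P * (g * norm (x - y)) \<le> P * (\<rho> + (e \<bullet> (\<xi> - \<eta>) + \<rho> * (b \<bullet> \<xi>))
       + ((norm (\<xi> - \<eta>))\<^sup>2 / (2 * \<rho>) + (b \<bullet> \<xi>) * (e \<bullet> (\<xi> - \<eta>)) + c * \<rho> * X) + \<kappa>' * q)"
      using P1 by (intro mult_left_mono) auto
    also have "\<dots> = P * \<rho> + P * (e \<bullet> (\<xi> - \<eta>) + \<rho> * (b \<bullet> \<xi>))
       + P * ((norm (\<xi> - \<eta>))\<^sup>2 / (2 * \<rho>) + (b \<bullet> \<xi>) * (e \<bullet> (\<xi> - \<eta>)) + c * \<rho> * X) + \<kappa> * q"
      by (simp add: \<kappa>_def distrib_left)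
    finally have "P * (g * norm (x - y)) \<le> P * \<rho> + P * (e \<bullet> (\<xi> - \<eta>) + \<rho> * (b \<bullet> \<xi>))
       + P * ((norm (\<xi> - \<eta>))\<^sup>2 / (2 * \<rho>) + (b \<bullet> \<xi>) * (e \<bullet> (\<xi> - \<eta>)) + c * \<rho> * X) + \<kappa> * q" .
    moreover have "u x - u y - P * (g * norm (x - y)) \<le> u xb - u yb - P * \<rho>"
    proof -
      have PB: "K * (1 / D xb ^ k) = P" by (simp add: P_def \<zeta>_def B_def)
      show ?thesis using max[OF xin yin] unfolding Pg PB by (simp add: \<rho>_def mult.assoc)
    qed
    moreover have "(x, y) - (xb, yb) = (\<xi>, \<eta>)" by (simp add: \<xi>_def \<eta>_def)
    moreover have "l \<bullet> (\<xi>, \<eta>) = P * (e \<bullet> (\<xi> - \<eta>) + \<rho> * (b \<bullet> \<xi>))"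
      by (simp add: l_def inner_add_left inner_diff_right algebra_simps)
    moreover have "((\<xi>, \<eta>) \<bullet> T (\<xi>, \<eta>)) / 2 = P * ((norm (\<xi> - \<eta>))\<^sup>2 / (2 * \<rho>) + (b \<bullet> \<xi>) * (e \<bullet> (\<xi> - \<eta>)) + c * \<rho> * X) + 2 * (\<kappa> * q)"
    proof -
      have "(P * (d1 + 2 * B * i + 2 * c * \<rho> * X) + 4 * \<kappa> * q) / 2 = P * (d1 / 2 + B * i + c * \<rho> * X) + 2 * (\<kappa> * q)"
        for d1 B i :: real by (simp add: field_simps)
      from this[of "(norm (\<xi> - \<eta>))\<^sup>2 / \<rho>" "b \<bullet> \<xi>" "e \<bullet> (\<xi> - \<eta>)"]
      show ?thesis unfolding Tq by (simp add: X_def q_def mult.commute)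
    qed
    moreover have "\<kappa> * (norm (\<xi>, \<eta>))\<^sup>2 = \<kappa> * q" by (simp add: norm_Pair_sq q_def X_def)
    ultimately show ?thesis by (simp only:)
  qed
  define s where "s = 1 + \<tau>"
  \<comment> \<open>In units of \<open>P * \<beta> * \<tau>\<close>: \<open>\<Lambda>\<close> from
    \<open>|s \<eta> - \<eta>|^2 / \<rho>\<close>, 4 from the mixed term, 8 from the
    \<open>c\<close> term and \<open>\<Lambda>\<close> from \<open>\<kappa>\<close>. As
    \<open>\<Lambda> \<ge> 1\<close>, the sum is at most \<open>14 * \<Lambda>\<close>.\<close>
  define E where "E = 14 * \<Lambda> * P * \<beta> * \<tau>"
  have E0: "E \<ge> 0" using \<Lambda> P1 \<beta>1 \<tau>0 by (simp add: E_def)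
  have TE: "(s *\<^sub>R \<eta>, \<eta>) \<bullet> T (s *\<^sub>R \<eta>, \<eta>) \<le> E * (norm \<eta>)\<^sup>2" for \<eta>
  proof -
    define q where "q = (norm \<eta>)\<^sup>2"
    have q0: "q \<ge> 0" by (simp add: q_def)
    have s2: "0 \<le> s" "s \<le> 2" using \<tau>0 \<tau>half by (auto simp: s_def)
    have ss: "s\<^sup>2 \<le> 4" using power_mono[OF s2(2) s2(1), of 2] by simp
    have diff: "s *\<^sub>R \<eta> - \<eta> = \<tau> *\<^sub>R \<eta>" by (simp add: s_def algebra_simps)
    have 1: "(norm (s *\<^sub>R \<eta> - \<eta>))\<^sup>2 / \<rho> = \<Lambda> * \<beta> * \<tau> * q"
      unfolding diff using \<rho> by (simp add: power_mult_distrib q_def) (simp add: \<tau>_def power2_eq_square)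
    have 2: "2 * (b \<bullet> (s *\<^sub>R \<eta>)) * (e \<bullet> (s *\<^sub>R \<eta> - \<eta>)) \<le> 4 * \<beta> * \<tau> * q"
    proof -
      have "\<bar>b \<bullet> \<eta>\<bar> \<le> \<beta> * norm \<eta>"
        using Cauchy_Schwarz_ineq2[of b \<eta>] mult_right_mono[OF nb norm_ge_zero, of \<eta>] by linarith
      moreover have "\<bar>e \<bullet> \<eta>\<bar> \<le> norm \<eta>" using Cauchy_Schwarz_ineq2[of e \<eta>] ne1 by simp
      ultimately have "\<bar>b \<bullet> \<eta>\<bar> * \<bar>e \<bullet> \<eta>\<bar> \<le> (\<beta> * norm \<eta>) * norm \<eta>" using \<beta>1 by (intro mult_mono) auto
      then have "(b \<bullet> \<eta>) * (e \<bullet> \<eta>) \<le> \<beta> * q"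
        by (simp add: q_def power2_eq_square abs_mult[symmetric] mult.assoc)
      then have "(2 * s * \<tau>) * ((b \<bullet> \<eta>) * (e \<bullet> \<eta>)) \<le> (2 * s * \<tau>) * (\<beta> * q)"
        using s2 \<tau>0 by (intro mult_left_mono) auto
      also have "\<dots> \<le> (2 * 2 * \<tau>) * (\<beta> * q)"
        using s2 \<tau>0 \<beta>1 q0 by (intro mult_right_mono mult_left_mono) auto
      finally show ?thesis unfolding diff by (simp add: mult_ac)
    qed
    have 3: "2 * c * \<rho> * (norm (s *\<^sub>R \<eta>))\<^sup>2 \<le> 8 * \<beta> * \<tau> * q"
    proof -
      have "c * \<rho> \<le> \<beta>\<^sup>2 * \<rho>" using c \<rho> by (intro mult_right_mono) auto
      also have "\<dots> = \<beta> * (\<rho> * \<beta>)" by (simp add: power2_eq_square)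
      also have "\<dots> \<le> \<beta> * \<tau>" using \<beta>\<rho> \<beta>1 by (intro mult_left_mono) auto
      finally have "(c * \<rho>) * (s\<^sup>2 * q) \<le> (\<beta> * \<tau>) * (4 * q)"
        using mult_mono[OF _ mult_right_mono[OF ss q0], of "c * \<rho>" "\<beta> * \<tau>"] q0 \<beta>1 \<tau>0 by simp
      then show ?thesis by (simp add: power_mult_distrib q_def mult_ac)
    qed
    have 4: "4 * \<kappa> * ((norm (s *\<^sub>R \<eta>))\<^sup>2 + (norm \<eta>)\<^sup>2) \<le> \<Lambda> * P * \<beta> * \<tau> * q"
    proof -
      have "(norm (s *\<^sub>R \<eta>))\<^sup>2 + (norm \<eta>)\<^sup>2 = (s\<^sup>2 + 1) * q" by (simp add: power_mult_distrib q_def algebra_simps)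
      also have "\<dots> \<le> 5 * q" using ss q0 by (intro mult_right_mono) auto
      finally have "4 * \<kappa> * ((norm (s *\<^sub>R \<eta>))\<^sup>2 + (norm \<eta>)\<^sup>2) \<le> 4 * \<kappa> * (5 * q)" using \<kappa>0 by (intro mult_left_mono) auto
      then show ?thesis by (simp add: \<kappa>_def \<kappa>'_def mult_ac)
    qed
    have "P * ((norm (s *\<^sub>R \<eta> - \<eta>))\<^sup>2 / \<rho> + 2 * (b \<bullet> (s *\<^sub>R \<eta>)) * (e \<bullet> (s *\<^sub>R \<eta> - \<eta>)) + 2 * c * \<rho> * (norm (s *\<^sub>R \<eta>))\<^sup>2)
       \<le> P * (\<Lambda> * \<beta> * \<tau> * q + 4 * \<beta> * \<tau> * q + 8 * \<beta> * \<tau> * q)"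
      by (intro mult_left_mono add_mono eq_refl[OF 1] 2 3) (use P1 in simp)
    also have "\<dots> = \<Lambda> * (P * \<beta> * \<tau> * q) + 12 * (1 * (P * \<beta> * \<tau> * q))" by (simp add: algebra_simps)
    also have "\<dots> \<le> \<Lambda> * (P * \<beta> * \<tau> * q) + 12 * (\<Lambda> * (P * \<beta> * \<tau> * q))"
      using \<Lambda> P1 \<beta>1 \<tau>0 q0 by (intro add_left_mono mult_left_mono mult_right_mono) auto
    finally show ?thesis unfolding Tq using 4 by (simp add: E_def q_def[symmetric] mult_ac)
  qed
  have rsub: "cball xb r \<subseteq> \<Omega>" "cball yb r \<subseteq> \<Omega>"
  proof -
    have "x \<in> cball x0 (2 * R)" if "x \<in> cball xb r" for x
      using norm_triangle_ineq[of "xb - x0" "x - xb"] that r(3) R by (simp add: dist_norm norm_minus_commute)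
    moreover have "x \<in> cball x0 (2 * R)" if "x \<in> cball yb r" for x
      using norm_triangle_ineq[of "yb - x0" "x - yb"] that r(4) by (simp add: dist_norm norm_minus_commute)
    ultimately show "cball xb r \<subseteq> \<Omega>" "cball yb r \<subseteq> \<Omega>" using R(2) by blast+
  qed
  define p where "p = P *\<^sub>R (e + \<rho> *\<^sub>R b)"
  define q where "q = P *\<^sub>R e"
  have main: "s\<^sup>2 * H p xb - H q yb \<le> s\<^sup>2 * f xb - f yb + CF * E"
    using doubling_viscosity_inequality[OF F sol f H C(1,2,4) r(1) rsub T \<kappa>0 upper E0 TE]
    by (simp add: l_def p_def q_def)
  have pq: "norm (p - q) \<le> \<rho> * \<beta> * P"
  proof -
    have "p - q = (P * \<rho>) *\<^sub>R b" by (simp add: p_def q_def algebra_simps)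
    then have "norm (p - q) = P * \<rho> * norm b" using P1 \<rho> by simp
    also have "\<dots> \<le> P * \<rho> * \<beta>" using nb P1 \<rho> by (intro mult_left_mono) auto
    finally show ?thesis by (simp add: mult_ac)
  qed
  have nq: "norm q = P" using ne1 P1 by (simp add: q_def)
  have half: "\<rho> * \<beta> * P \<le> 1 / 2 * P" using \<beta>\<rho> \<tau>half P1 by (intro mult_right_mono) auto
  have np: "P / 2 \<le> norm p" "norm p \<le> 2 * P"
    using half pq nq norm_triangle_ineq2[of p q] norm_triangle_ineq2[of q p] P1
    unfolding norm_minus_commute[of q p] by linarith+
  have H1: "- C1 + C2 * norm p powr m \<le> H p xb"
    using H xbO unfolding hamiltonian_conditions_def by blast
  have H2: "\<bar>H p xb - H p yb\<bar> \<le> (C3 * norm p powr m + C1) * \<rho>"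
    using H xbO ybO unfolding hamiltonian_conditions_def \<rho>_def by blast
  have H3: "\<bar>H p yb - H q yb\<bar> \<le> C3 * (norm p + norm q + 1) powr (m - 1) * norm (p - q)"
    using H ybO unfolding hamiltonian_conditions_def by blast
  have f1: "\<bar>f xb - f yb\<bar> \<le> L * \<rho>"
    using lipschitz_onD[OF f xbO ybO] by (simp add: dist_norm \<rho>_def)
  have f2: "\<bar>f xb\<bar> \<le> N" by (rule bounds(2)) (use xb R in \<open>simp add: dist_norm norm_minus_commute\<close>)
  have P1': "3 * (C1 + N) \<le> c0 / 4 * P"
  proof -
    have "C1 + N \<le> (C1 + 1) * (1 + N)" using C MN by (simp add: algebra_simps)
    also have "\<dots> \<le> (C1 + 1) * A" using A C by (intro mult_left_mono) auto
    finally have "3 * (C1 + N) \<le> 3 * ((C1 + 1) * A)" by (rule mult_left_mono) simp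
    also have "\<dots> = 3 * (C1 + 1) * A" by (rule mult.assoc[symmetric])
    also have "\<dots> \<le> c0 / 4 * Kc * A" using Kc(2) A by (intro mult_right_mono) auto
    also have "\<dots> = c0 / 4 * K" by (simp add: K_def)
    also have "\<dots> \<le> c0 / 4 * P" using PK c0p by (intro mult_left_mono) auto
    finally show ?thesis .
  qed
  have P2': "14 * CF * \<Lambda> * \<beta> \<le> c0 / 4 * P powr (m - 1)"
  proof -
    \<comment> \<open>The choice of the exponent \<open>k\<close> acts here: the right side is
      \<open>1 / B\<close> to the power \<open>k * (m - 1) \<ge> 1\<close>, and
      \<open>1 / B \<ge> 1\<close>.\<close>
    have "1 / B \<le> \<zeta> powr (m - 1)"
    proof -
      have "(1 / B) powr 1 \<le> (1 / B) powr (real k * (m - 1))" using B1 k by (intro powr_mono) auto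
      also have "\<dots> = ((1 / B) powr real k) powr (m - 1)" by (simp add: powr_powr)
      also have "(1 / B) powr real k = \<zeta>" using B by (simp add: powr_realpow \<zeta>_def power_one_over)
      finally show ?thesis using B by simp
    qed
    then have "\<beta> \<le> \<beta>0 * \<zeta> powr (m - 1)" using mult_left_mono[of "1 / B" "\<zeta> powr (m - 1)" \<beta>0] \<beta>01 by (simp add: \<beta>_def)
    then have "14 * CF * \<Lambda> * \<beta> \<le> 14 * CF * \<Lambda> * (\<beta>0 * \<zeta> powr (m - 1))"
      using F \<Lambda> by (intro mult_left_mono) auto
    also have "\<dots> = (14 * CF * \<Lambda> * \<beta>0) * \<zeta> powr (m - 1)" by simp
    also have "\<dots> \<le> (c0 / 4 * Kc powr (m - 1)) * \<zeta> powr (m - 1)" using Kc(3) by (intro mult_right_mono) auto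
    also have "\<dots> \<le> (c0 / 4 * K powr (m - 1)) * \<zeta> powr (m - 1)"
      using K Kc C c0p by (intro mult_right_mono mult_left_mono powr_mono2) auto
    also have "\<dots> = c0 / 4 * P powr (m - 1)" using K \<zeta>1 by (simp add: P_def powr_mult)
    finally show ?thesis .
  qed
  show False
    by (rule gradient_bound_contradiction[OF main[unfolded E_def] H1 H2 H3 f1 f2 np nq pq P1 s_def \<tau>0 _ \<tau>_def \<beta>1 \<Lambda>(1) \<rho>
          C F(2) L0 MN(2) c0 \<Lambda>(2) P1' P2'])
      (use \<tau>half in simp)
qed

section \<open>Uniform constants and the final estimates\<close>

text \<open>A single \<open>C\<close> serves all \<open>F\<close>, \<open>H\<close>,
  \<open>f\<close>, \<open>u\<close> and all centres, as the claimed dependence on the data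
  requires. \<open>M\<close> and \<open>N\<close> are bounds on the ball only, so the estimate also
  covers \<open>u\<close> that is unbounded on \<open>\<Omega>\<close>.\<close>

definition center_estimate ::
    "(real ^ 'n) set \<Rightarrow> real \<Rightarrow> real \<Rightarrow> real \<Rightarrow> real \<Rightarrow> real \<Rightarrow> real \<Rightarrow> real \<Rightarrow> real \<Rightarrow> bool" where
  "center_estimate \<Omega> CF m C1 C2 C3 L R C \<longleftrightarrow> (\<forall>F H f u M N x0 y.
     degenerate_elliptic_lipschitz CF F \<longrightarrow> positively_homogeneous F \<longrightarrow> viscosity_solution \<Omega> F H f u \<longrightarrow>
     L-lipschitz_on \<Omega> f \<longrightarrow> hamiltonian_conditions \<Omega> m C1 C2 C3 H \<longrightarrow> cball x0 (2 * R) \<subseteq> \<Omega> \<longrightarrow>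
     (\<forall>x\<in>cball x0 (2 * R). \<bar>u x\<bar> \<le> M \<and> \<bar>f x\<bar> \<le> N) \<longrightarrow> y \<in> cball x0 (2 * R) \<longrightarrow>
     u x0 - u y \<le> C * (1 + M + N) * norm (x0 - y))"

lemma center_estimateD:
  assumes "center_estimate \<Omega> CF m C1 C2 C3 L R C"
    and "degenerate_elliptic_lipschitz CF F" "positively_homogeneous F" "viscosity_solution \<Omega> F H f u"
    and "L-lipschitz_on \<Omega> f" "hamiltonian_conditions \<Omega> m C1 C2 C3 H" "cball x0 (2 * R) \<subseteq> \<Omega>"
    and "\<And>x. x \<in> cball x0 (2 * R) \<Longrightarrow> \<bar>u x\<bar> \<le> M \<and> \<bar>f x\<bar> \<le> N" and "y \<in> cball x0 (2 * R)"
  shows "u x0 - u y \<le> C * (1 + M + N) * norm (x0 - y)"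
  using assms unfolding center_estimate_def by blast

lemma uniform_center_estimate:
  fixes \<Omega> :: "(real ^ 'n) set" and CF m C1 C2 C3 L R :: real
  assumes "CF > 0" "m > 1" "C1 > 0" "C2 > 0" "C3 > 0" "R > 0"
  obtains C where "C > 0" "center_estimate \<Omega> CF m C1 C2 C3 L R C"
proof -
  obtain k0 :: nat where "1 / (m - 1) \<le> k0" using real_arch_simple by blast
  then have "1 / (m - 1) \<le> real (Suc k0)" by simp
  then have k: "Suc k0 \<ge> 1" "real (Suc k0) * (m - 1) \<ge> 1" using assms(2) by (auto simp: pos_divide_le_eq)
  obtain Ck where Ck: "Ck \<ge> 0" "\<And>t::real. \<bar>t\<bar> \<le> 1 / 2 \<Longrightarrow> 1 / (1 - t) ^ Suc k0 \<le> 1 + real (Suc k0) * t + Ck * t\<^sup>2"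
    using inverse_power_quadratic_bound[of "Suc k0"] by blast
  define \<beta>0 where "\<beta>0 = 1 + (real (Suc k0) + 3 * Ck + 1) / R"
  define c0 where "c0 = 2 powr (1 - m) * C2"
  have c0: "c0 > 0" using assms by (simp add: c0_def)
  have \<beta>0: "\<beta>0 > 0" using Ck assms by (simp add: \<beta>0_def add_pos_nonneg)
  define \<Lambda> where "\<Lambda> = max 1 (4 * (C3 * 2 powr m + C1 + C3 * 4 powr (m - 1) + L) / c0)"
  have "4 * (C3 * 2 powr m + C1 + C3 * 4 powr (m - 1) + L) / c0 \<le> \<Lambda>" unfolding \<Lambda>_def by (rule max.cobounded2)
  then have \<Lambda>2: "C3 * 2 powr m + C1 + C3 * 4 powr (m - 1) + L \<le> \<Lambda> * c0 / 4"
    using c0 by (simp add: pos_divide_le_eq)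
  have \<Lambda>1: "\<Lambda> \<ge> 1" unfolding \<Lambda>_def by (rule max.cobounded1)
  define w where "w = 56 * CF * \<Lambda> * \<beta>0 / c0"
  have w: "w \<ge> 0" using assms \<Lambda>1 \<beta>0 c0 by (simp add: w_def)
  \<comment> \<open>One summand for each demand of \<open>lipschitz_at_center\<close>, plus 1. As
    \<open>c0 / 4 * w = 14 * CF * \<Lambda> * \<beta>0\<close>, the root of \<open>w\<close> meets
    the demand on \<open>Kc powr (m - 1)\<close>.\<close>
  define Kc where "Kc = 1 + 12 * (C1 + 1) / c0 + w powr (1 / (m - 1)) + 4 * \<Lambda> * \<beta>0 + 2 / R"
  have parts: "0 \<le> 12 * (C1 + 1) / c0" "0 \<le> w powr (1 / (m - 1))" "0 \<le> 4 * \<Lambda> * \<beta>0" "0 < 2 / R"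
    using assms \<Lambda>1 \<beta>0 c0 by auto
  have Kc: "Kc \<ge> 1" "12 * (C1 + 1) / c0 \<le> Kc" "w powr (1 / (m - 1)) \<le> Kc" "4 * \<Lambda> * \<beta>0 \<le> Kc" "2 / R < Kc"
    using parts unfolding Kc_def by linarith+
  have Kc2: "3 * (C1 + 1) \<le> c0 / 4 * Kc" using Kc(2) c0 by (simp add: pos_divide_le_eq algebra_simps)
  have Kc3: "14 * CF * \<Lambda> * \<beta>0 \<le> c0 / 4 * Kc powr (m - 1)"
  proof -
    have "w = (w powr (1 / (m - 1))) powr (m - 1)" using w assms by (simp add: powr_powr)
    also have "\<dots> \<le> Kc powr (m - 1)" using Kc(3) assms by (intro powr_mono2) auto
    finally have "c0 / 4 * w \<le> c0 / 4 * Kc powr (m - 1)" using c0 by (intro mult_left_mono) auto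
    then show ?thesis using c0 by (simp add: w_def)
  qed
  have Kc5: "2 < Kc * R" using Kc(5) assms by (simp add: pos_divide_less_eq)
  show thesis
  proof (rule that[of "Kc * 2 ^ Suc k0"])
    show "Kc * 2 ^ Suc k0 > 0" using Kc(1) by simp
    show "center_estimate \<Omega> CF m C1 C2 C3 L R (Kc * 2 ^ Suc k0)"
      unfolding center_estimate_def
    proof (intro allI impI)
      fix F H f u M N and x0 y :: "real ^ 'n"
      assume F: "degenerate_elliptic_lipschitz CF F" "positively_homogeneous F"
        and sol: "viscosity_solution \<Omega> F H f u" "L-lipschitz_on \<Omega> f" "hamiltonian_conditions \<Omega> m C1 C2 C3 H"
        and sub: "cball x0 (2 * R) \<subseteq> \<Omega>" and bd: "\<forall>x\<in>cball x0 (2 * R). \<bar>u x\<bar> \<le> M \<and> \<bar>f x\<bar> \<le> N"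
        and y: "y \<in> cball x0 (2 * R)"
      have bdu: "\<And>x. x \<in> cball x0 (2 * R) \<Longrightarrow> \<bar>u x\<bar> \<le> M" and bdf: "\<And>x. x \<in> cball x0 (2 * R) \<Longrightarrow> \<bar>f x\<bar> \<le> N"
        using bd by blast+
      show "u x0 - u y \<le> Kc * 2 ^ Suc k0 * (1 + M + N) * norm (x0 - y)"
        by (rule lipschitz_at_center[OF F(1) assms(1) F(2) sol assms(2-6) sub bdu bdf k Ck \<beta>0_def c0_def \<Lambda>1 \<Lambda>2
              Kc(1) Kc2 Kc3 Kc(4) Kc5 y])
    qed
  qed
qed

text \<open>The set where \<open>\<bar>g\<bar>\<close> exceeds the norm is null, and by continuity
  it is open, hence empty.\<close>

lemma Linf_norm_pointwise:
  assumes \<Omega>: "open \<Omega>" and g: "continuous_on \<Omega> g" and fin: "Linf_norm \<Omega> g < \<infinity>" and x: "x \<in> \<Omega>"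
  shows "\<bar>g x\<bar> \<le> enn2real (Linf_norm \<Omega> g)"
proof (rule ccontr)
  assume neg: "\<not> ?thesis"
  define c where "c = enn2real (Linf_norm \<Omega> g)"
  have c: "Linf_norm \<Omega> g = ennreal c" "c \<ge> 0" using fin by (auto simp: c_def less_top)
  define V where "V = \<Omega> \<inter> (\<lambda>y. \<bar>g y\<bar>) -` {c<..}"
  have "open V"
    unfolding V_def by (intro continuous_open_preimage \<Omega> continuous_intros g)
  moreover have "x \<in> V" using x neg by (simp add: V_def c_def)
  moreover have "negligible V"
  proof -
    have "AE y in lebesgue_on \<Omega>. ennreal \<bar>g y\<bar> \<le> ennreal c"
      using esssup_AE[of "\<lambda>y. ennreal \<bar>g y\<bar>" "lebesgue_on \<Omega>"] c(1) by (simp add: Linf_norm_def)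
    then have "AE y in lebesgue. y \<in> \<Omega> \<longrightarrow> ennreal \<bar>g y\<bar> \<le> ennreal c"
      using \<Omega> by (subst (asm) AE_restrict_space_iff) auto
    then have "AE y in lebesgue. y \<notin> V"
      by eventually_elim (use c(2) in \<open>auto simp: V_def\<close>)
    then show ?thesis
      using \<open>open V\<close> by (simp add: negligible_iff_null_sets AE_iff_null_sets)
  qed
  ultimately show False using open_not_negligible by blast
qed

lemma continuous_on_cball_bounded:
  fixes g :: "'a::euclidean_space \<Rightarrow> real"
  assumes "continuous_on (cball x r) g"
  obtains B where "\<And>y. y \<in> cball x r \<Longrightarrow> \<bar>g y\<bar> \<le> B"
proof -
  have "bounded (g ` cball x r)"
    by (rule compact_imp_bounded[OF compact_continuous_image[OF assms compact_cball]])
  then obtain B where "\<forall>y\<in>cball x r. \<bar>g y\<bar> \<le> B" unfolding bounded_iff by auto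
  then show thesis using that[of B] by blast
qed

text \<open>The order of the quantifiers expresses the dependence of \<open>C\<close>: it is chosen
  after \<open>\<Omega>'\<close>, the structural constants and \<open>L\<close>, but before
  \<open>F\<close>, \<open>H\<close>, \<open>f\<close> and \<open>u\<close>. The estimate lives in
  \<open>ennreal\<close> so that it makes sense for \<open>u\<close> of infinite norm.\<close>

theorem theorem1:
  fixes \<Omega> :: "(real ^ 'n) set"
    and CF m C1 C2 C3 L :: real
  assumes "open \<Omega>"
    and "CF > 0" and "m > 1" and "C1 > 0" and "C2 > 0" and "C3 > 0"
  shows
    "(\<forall>F H f u.
        degenerate_elliptic_lipschitz CF F \<and> positively_homogeneous F \<and>
        in_Linf \<Omega> f \<and> L-lipschitz_on \<Omega> f \<and>
        hamiltonian_conditions \<Omega> m C1 C2 C3 H \<and>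
        viscosity_solution \<Omega> F H f u \<longrightarrow>
          locally_lipschitz_on \<Omega> u) \<and>
     (\<forall>\<Omega>'. compactly_contained \<Omega>' \<Omega> \<longrightarrow>
        (\<exists>C>0. \<forall>F H f u.
           degenerate_elliptic_lipschitz CF F \<and> positively_homogeneous F \<and>
           in_Linf \<Omega> f \<and> L-lipschitz_on \<Omega> f \<and>
           hamiltonian_conditions \<Omega> m C1 C2 C3 H \<and>
           viscosity_solution \<Omega> F H f u \<longrightarrow>
             (\<forall>x\<in>\<Omega>'. \<forall>y\<in>\<Omega>'.
                ennreal \<bar>u x - u y\<bar>
                  \<le> ennreal C * (1 + Linf_norm \<Omega> u + Linf_norm \<Omega> f) * ennreal (norm (x - y)))))"
proof (intro conjI allI impI)
  fix F :: "real ^ 'n ^ 'n \<Rightarrow> real" and H f u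
  assume "degenerate_elliptic_lipschitz CF F \<and> positively_homogeneous F \<and>
        in_Linf \<Omega> f \<and> L-lipschitz_on \<Omega> f \<and>
        hamiltonian_conditions \<Omega> m C1 C2 C3 H \<and>
        viscosity_solution \<Omega> F H f u"
  then have F: "degenerate_elliptic_lipschitz CF F" "positively_homogeneous F" and f: "L-lipschitz_on \<Omega> f"
    and H: "hamiltonian_conditions \<Omega> m C1 C2 C3 H" and sol: "viscosity_solution \<Omega> F H f u" by auto
  have cu: "continuous_on \<Omega> u" using sol by (simp add: viscosity_solution_def)
  have cf: "continuous_on \<Omega> f" using f by (rule lipschitz_on_continuous_on)
  show "locally_lipschitz_on \<Omega> u"
    unfolding locally_lipschitz_on_def
  proof
    fix x assume "x \<in> \<Omega>"
    then obtain r where r: "r > 0" "cball x r \<subseteq> \<Omega>" using assms(1) open_contains_cball by blast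
    \<comment> \<open>Points of \<open>cball x R\<close> are at most \<open>2 * R\<close> apart, and
      the balls of radius \<open>2 * R\<close> about them stay within \<open>3 * R < r\<close> of
      \<open>x\<close>.\<close>
    define R where "R = r / 4"
    have R: "R > 0" using r by (simp add: R_def)
    have sub: "cball y (2 * R) \<subseteq> cball x r" if "y \<in> cball x R" for y
      using that r by (intro cball_subset_cball_iff[THEN iffD2]) (auto simp: R_def dist_commute)
    obtain M where M: "\<And>y. y \<in> cball x r \<Longrightarrow> \<bar>u y\<bar> \<le> M"
      using continuous_on_cball_bounded continuous_on_subset[OF cu r(2)] by blast
    obtain N where N: "\<And>y. y \<in> cball x r \<Longrightarrow> \<bar>f y\<bar> \<le> N"
      using continuous_on_cball_bounded continuous_on_subset[OF cf r(2)] by blast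
    obtain C where C: "C > 0" and est: "center_estimate \<Omega> CF m C1 C2 C3 L R C"
      by (rule uniform_center_estimate[OF assms(2-6) R])
    have le: "u y - u z \<le> C * (1 + M + N) * norm (y - z)" if y: "y \<in> cball x R" and z: "z \<in> cball x R" for y z
    proof (rule center_estimateD[OF est F sol f H])
      show "cball y (2 * R) \<subseteq> \<Omega>" using sub[OF y] r(2) by blast
      show "\<bar>u x'\<bar> \<le> M \<and> \<bar>f x'\<bar> \<le> N" if "x' \<in> cball y (2 * R)" for x'
        using M N sub[OF y] that by blast
      show "z \<in> cball y (2 * R)"
        using y z dist_triangle[of y z x] by (simp add: dist_commute)
    qed
    have x: "x \<in> cball x r" using r by simp
    have "(C * (1 + M + N))-lipschitz_on (cball x R \<inter> \<Omega>) u"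
    proof (rule lipschitz_onI)
      show "dist (u y) (u z) \<le> C * (1 + M + N) * dist y z" if "y \<in> cball x R \<inter> \<Omega>" "z \<in> cball x R \<inter> \<Omega>" for y z
        using le[of y z] le[of z y] that by (auto simp: dist_real_def dist_norm norm_minus_commute abs_le_iff)
      show "0 \<le> C * (1 + M + N)" using C M[OF x] N[OF x] by (intro mult_nonneg_nonneg) auto
    qed
    then show "\<exists>r>0. \<exists>K. K-lipschitz_on (cball x r \<inter> \<Omega>) u" using R by blast
  qed
next
  fix \<Omega>' assume cc: "compactly_contained \<Omega>' \<Omega>"
  then obtain r where r: "r > 0" "(\<Union>x\<in>closure \<Omega>'. cball x r) \<subseteq> \<Omega>"
    using compact_subset_open_imp_cball_epsilon_subset[of "closure \<Omega>'" \<Omega>] assms(1)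
    unfolding compactly_contained_def by blast
  define R where "R = r / 2"
  have R: "R > 0" using r by (simp add: R_def)
  have sub: "cball x (2 * R) \<subseteq> \<Omega>" if "x \<in> \<Omega>'" for x
    using r(2) closure_subset that by (fastforce simp: R_def)
  obtain C where C: "C > 0" and est: "center_estimate \<Omega> CF m C1 C2 C3 L R C"
    by (rule uniform_center_estimate[OF assms(2-6) R])
  \<comment> \<open>Pairs further apart than \<open>2 * R\<close> are not reached by the centre
    estimate; for them the oscillation \<open>2 * M\<close> is at most
    \<open>1 / R * M * norm (x - y)\<close>.\<close>
  define C' where "C' = C + 1 / R"
  have C': "C' > 0" "C \<le> C'" "1 / R \<le> C'" using C R by (auto simp: C'_def add_pos_pos)
  have "ennreal \<bar>u x - u y\<bar> \<le> ennreal C' * (1 + Linf_norm \<Omega> u + Linf_norm \<Omega> f) * ennreal (norm (x - y))"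
    if F: "degenerate_elliptic_lipschitz CF F" "positively_homogeneous F" and fL: "in_Linf \<Omega> f" and f: "L-lipschitz_on \<Omega> f"
      and H: "hamiltonian_conditions \<Omega> m C1 C2 C3 H" and sol: "viscosity_solution \<Omega> F H f u"
      and x: "x \<in> \<Omega>'" and y: "y \<in> \<Omega>'" for F H f u x y
  proof (cases "x = y \<or> Linf_norm \<Omega> u = \<infinity>")
    case True
    \<comment> \<open>For \<open>x \<noteq> y\<close> an infinite norm makes the right side
      infinite. For \<open>x = y\<close> the right side is 0 even then, since
      \<open>\<infinity> * 0 = 0\<close> in \<open>ennreal\<close>, and so is the left side.\<close>
    show ?thesis
    proof (cases "x = y")
      case False
      then have "ennreal C' * (1 + Linf_norm \<Omega> u + Linf_norm \<Omega> f) * ennreal (norm (x - y)) = \<infinity>"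
        using True C' by (simp add: ennreal_mult_top ennreal_top_mult)
      then show ?thesis by simp
    qed simp
  next
    case False
    have cu: "continuous_on \<Omega> u" using sol by (simp add: viscosity_solution_def)
    have cf: "continuous_on \<Omega> f" using f by (rule lipschitz_on_continuous_on)
    have ufin: "Linf_norm \<Omega> u < \<infinity>" using False by (simp add: less_top)
    have ffin: "Linf_norm \<Omega> f < \<infinity>" using fL by (simp add: in_Linf_def)
    define M where "M = enn2real (Linf_norm \<Omega> u)"
    define N where "N = enn2real (Linf_norm \<Omega> f)"
    have M0: "M \<ge> 0" "N \<ge> 0" by (auto simp: M_def N_def)
    have M: "\<bar>u x\<bar> \<le> M" "\<bar>f x\<bar> \<le> N" if "x \<in> \<Omega>" for x
      using Linf_norm_pointwise[OF assms(1) cu ufin that] Linf_norm_pointwise[OF assms(1) cf ffin that]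
      by (auto simp: M_def N_def)
    have eM: "Linf_norm \<Omega> u = ennreal M" "Linf_norm \<Omega> f = ennreal N"
      using ufin ffin by (auto simp: M_def N_def less_top)
    have le: "u x - u y \<le> C' * (1 + M + N) * norm (x - y)" if x: "x \<in> \<Omega>'" and y: "y \<in> \<Omega>'" for x y
    proof (cases "y \<in> cball x (2 * R)")
      case True
      have "u x - u y \<le> C * (1 + M + N) * norm (x - y)"
        by (rule center_estimateD[OF est F sol f H sub[OF x] _ True]) (use M sub[OF x] in blast)
      also have "\<dots> \<le> C' * (1 + M + N) * norm (x - y)"
        using C' M0 by (intro mult_right_mono) auto
      finally show ?thesis .
    next
      case far: False
      have xO: "x \<in> \<Omega>" "y \<in> \<Omega>" using sub x y R by fastforce+
      have "u x - u y \<le> 2 * M" using M(1)[OF xO(1)] M(1)[OF xO(2)] by linarith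
      also have "\<dots> = 1 / R * M * (2 * R)" using R by simp
      also have "\<dots> \<le> C' * (1 + M + N) * norm (x - y)"
        using far R C' M0 by (intro mult_mono) (auto simp: dist_norm)
      finally show ?thesis .
    qed
    have "\<bar>u x - u y\<bar> \<le> C' * (1 + M + N) * norm (x - y)"
      using le[OF x y] le[OF y x] by (simp add: norm_minus_commute abs_le_iff)
    then have "ennreal \<bar>u x - u y\<bar> \<le> ennreal (C' * (1 + M + N) * norm (x - y))" by (rule ennreal_leI)
    also have "\<dots> = ennreal C' * (1 + Linf_norm \<Omega> u + Linf_norm \<Omega> f) * ennreal (norm (x - y))"
      using C' M0 by (simp add: eM ennreal_mult ennreal_plus flip: ennreal_1)
    finally show ?thesis .
  qed
  then show "\<exists>C>0. \<forall>F H f u.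
           degenerate_elliptic_lipschitz CF F \<and> positively_homogeneous F \<and>
           in_Linf \<Omega> f \<and> L-lipschitz_on \<Omega> f \<and>
           hamiltonian_conditions \<Omega> m C1 C2 C3 H \<and>
           viscosity_solution \<Omega> F H f u \<longrightarrow>
             (\<forall>x\<in>\<Omega>'. \<forall>y\<in>\<Omega>'.
                ennreal \<bar>u x - u y\<bar>
                  \<le> ennreal C * (1 + Linf_norm \<Omega> u + Linf_norm \<Omega> f) * ennreal (norm (x - y)))"
    using C'(1) by (intro exI[of _ C']) blast
qed

end
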